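(* Let $r\ge1$ and let $(G_n)$ be a sequence of graphs satisfying the geometry condition with parameter $r$. Let $\beta,C>0$ be constants not depending on $n$ and let $f_0=f_{0,n}\in H^\beta(C)$ for every $n$. Suppose one observes $Y_1,\dots,Y_n$ from the regression model $$Y_i=f_0(i)+\epsilon_i,\qquad i=1,\dots,n,$$ with $\epsilon_i$ independent $N(0,\sigma^2)$ variables, $\sigma>0$. Either $\sigma$ is known, or $\sigma$ is unknown and belongs to a compact interval $[a,b]\subset(0,\infty)$, in which case it is endowed with a prior with a positive, continuous density on $[a,b]$, independent of the prior on $f$. (i) (Power of the Laplacian.) If $\alpha>0$ is fixed, $\beta\le\alpha+r/2$, and the prior on $f$ is given by $$c\sim\mathrm{Exp}(1),\qquad f\mid c\sim N\Big(0,\Big(\big((n/c)^{2/r}(L+n^{-2}I)\big)^{\alpha+r/2}\Big)^{-1}\Big),$$ then the posterior contracts around $f_0$ at the rate $n^{-\beta/(r+2\beta)}$. (ii) (Exponential of the Laplacian.) If the prior on $f$ is given by $$c\sim\mathrm{Exp}(1),\qquad f\mid c\sim N\big(0,\,n\,e^{-(n/c)^{2/r}L}\big),$$ then the posterior contracts around $f_0$ at the rate $n^{-\beta/(r+2\beta)}\log^{\kappa}n$ for some $\kappa>0$.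
   Context: Graphs: $n$ tends to infinity through an infinite set of positive integers, and for each such $n$, $G=G_n$ is a connected, simple (no loops, multiple edges or weights), undirected graph with vertices $1,\dots,n$. Let $A_G$ be its adjacency matrix, $D$ the diagonal matrix of vertex degrees, and $L=L_n=D-A_G$ its Laplacian, with eigenvalues $0=\lambda_0<\lambda_1\le\dots\le\lambda_{n-1}$ (dependence on $n$ suppressed). $I$ is the identity matrix; powers and exponentials of symmetric matrices are defined spectrally. Geometry condition with parameter $r\ge1$: there exist $i_0\in\mathbb{N}$, $\kappa_0\in(0,1]$ and $C_1,C_2>0$ (not depending on $n$) such that for all $n$ large enough, $C_1(i/n)^{2/r}\le\lambda_i\le C_2(i/n)^{2/r}$ for all integers $i_0\le i\le\kappa_0 n$, $i\le n-1$. A function $f$ on $G_n$ is identified with the vector $(f(1),\dots,f(n))\in\mathbb{R}^n$. $\langle f,g\rangle_n=\frac1n\sum_{i=1}^nf(i)g(i)$ and $\|f\|_n^2=\langle f,f\rangle_n$. For $\beta,C>0$ (independent of $n$), $H^\beta(C)=\{f:\langle f,(I+(n^{2/r}L)^\beta)f\rangle_n\le C^2\}$. $\mathrm{Exp}(1)$ is the standard exponential distribution; $N(0,\Sigma)$ is the centered Gaussian law on $\mathbb{R}^n$ with covariance matrix $\Sigma$. For a prior $\Pi$, $\Pi(\cdot\mid Y_1,\dots,Y_n)$ denotes the corresponding (marginal) posterior distribution of $f$. For positive numbers $\varepsilon_n\to0$, the posterior is said to contract around $f_0$ at the rate $\varepsilon_n$ if for all large enough $M>0$, $\Pi(f:\|f-f_0\|_n\ge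 M\varepsilon_n\mid Y_1,\dots,Y_n)\to0$ in probability, as $n\to\infty$, under the law $P_{f_0}$ of the data in the regression model with true function $f_0$ (and true $\sigma$). *)

theory Defs
  imports
    "HOL-Probability.Probability"
    "Graph_Theory.Pair_Digraph"
    "Graph_Theory.Digraph_Component"
    "Jordan_Normal_Form.Char_Poly"
begin

(* A graph on n vertices has vertex set {..<n} (0-based, to match the matrix indices). A function
   on it is an element of {..<n} \<rightarrow>\<^sub>E UNIV, the space of the measure fun_space n. *)

abbreviation fun_space :: "nat \<Rightarrow> (nat \<Rightarrow> real) measure" where
  "fun_space n \<equiv> PiM {..<n} (\<lambda>_. borel)"

definition apply_mat :: "nat \<Rightarrow> real mat \<Rightarrow> (nat \<Rightarrow> real) \<Rightarrow> (nat \<Rightarrow> real)" where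
  "apply_mat n A f = (\<lambda>i\<in>{..<n}. \<Sum>j<n. A $$ (i, j) * f j)"

definition inner_n :: "nat \<Rightarrow> (nat \<Rightarrow> real) \<Rightarrow> (nat \<Rightarrow> real) \<Rightarrow> real" where
  "inner_n n f g = (\<Sum>i<n. f i * g i) / real n"

definition norm_n :: "nat \<Rightarrow> (nat \<Rightarrow> real) \<Rightarrow> real" where
  "norm_n n f = sqrt (inner_n n f f)"


(* The locale pair_graph describes finite, symmetric, loop-free edge relations, i.e. finite simple
   undirected graphs; each edge {i,j} is present as both arcs (i,j) and (j,i), so the out-degree is
   the vertex degree. *)

definition adjacency_mat :: "nat \<Rightarrow> nat pair_pre_digraph \<Rightarrow> real mat" where
  "adjacency_mat n G = Matrix.mat n n (\<lambda>(i, j). if (i, j) \<in> parcs G then 1 else 0)"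

definition degree_mat :: "nat \<Rightarrow> nat pair_pre_digraph \<Rightarrow> real mat" where
  "degree_mat n G = mat_diag n (\<lambda>i. real (out_degree (with_proj G) i))"

definition laplacian :: "nat \<Rightarrow> nat pair_pre_digraph \<Rightarrow> real mat" where
  "laplacian n G = degree_mat n G - adjacency_mat n G"

(* For a symmetric matrix: all eigenvalues, repeated by multiplicity, in increasing order. *)
definition eigenvalue_list :: "real mat \<Rightarrow> real list" where
  "eigenvalue_list A = sorted_list_of_multiset (proots (char_poly A))"

definition laplacian_eigenvalue :: "nat \<Rightarrow> nat pair_pre_digraph \<Rightarrow> nat \<Rightarrow> real" where
  "laplacian_eigenvalue n G i = eigenvalue_list (laplacian n G) ! i"

(* Spectral calculus: if A = U diag(d) U^T with U orthogonal then \<phi>(A) = U diag(\<phi>(d)) U^T.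
   For symmetric A such a decomposition exists and the result does not depend on its choice. *)
definition spectral_fun :: "(real \<Rightarrow> real) \<Rightarrow> real mat \<Rightarrow> real mat" where
  "spectral_fun \<phi> A = (SOME B. \<exists>U d.
     similar_mat_wit A (mat_diag (dim_row A) d) U (transpose_mat U) \<and>
     B = U * mat_diag (dim_row A) (\<lambda>i. \<phi> (d i)) * transpose_mat U)"

abbreviation mat_powr :: "real mat \<Rightarrow> real \<Rightarrow> real mat" where
  "mat_powr A p \<equiv> spectral_fun (\<lambda>x. x powr p) A"

abbreviation mat_inv_spec :: "real mat \<Rightarrow> real mat" where
  "mat_inv_spec A \<equiv> spectral_fun inverse A"

abbreviation mat_exp :: "real mat \<Rightarrow> real mat" where
  "mat_exp A \<equiv> spectral_fun exp A"


(* The filter "n tends to infinity through N". *)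
abbreviation at_top_along :: "nat set \<Rightarrow> nat filter" where
  "at_top_along N \<equiv> inf sequentially (principal N)"

definition graph_sequence :: "nat set \<Rightarrow> (nat \<Rightarrow> nat pair_pre_digraph) \<Rightarrow> bool" where
  "graph_sequence N G \<longleftrightarrow>
     infinite N \<and> 0 \<notin> N \<and>
     (\<forall>n\<in>N. pair_graph (G n) \<and> pverts (G n) = {..<n} \<and>
        Digraph_Component.connected (with_proj (G n)))"

definition geometry_condition :: "nat set \<Rightarrow> (nat \<Rightarrow> nat pair_pre_digraph) \<Rightarrow> real \<Rightarrow> bool" where
  "geometry_condition N G r \<longleftrightarrow>
     (\<exists>(i0::nat) (\<kappa>0::real) (C1::real) (C2::real).
        0 < \<kappa>0 \<and> \<kappa>0 \<le> 1 \<and> 0 < C1 \<and> 0 < C2 \<and>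
        (\<forall>\<^sub>F n in at_top_along N. \<forall>i::nat.
           i0 \<le> i \<and> real i \<le> \<kappa>0 * real n \<and> i \<le> n - 1 \<longrightarrow>
             C1 * (real i / real n) powr (2 / r) \<le> laplacian_eigenvalue n (G n) i \<and>
             laplacian_eigenvalue n (G n) i \<le> C2 * (real i / real n) powr (2 / r)))"

definition sobolev_ball ::
    "nat \<Rightarrow> nat pair_pre_digraph \<Rightarrow> real \<Rightarrow> real \<Rightarrow> real \<Rightarrow> (nat \<Rightarrow> real) set" where
  "sobolev_ball n G r \<beta> C =
     {f \<in> {..<n} \<rightarrow>\<^sub>E UNIV.
        inner_n n f (apply_mat n
          (1\<^sub>m n + mat_powr ((real n powr (2 / r)) \<cdot>\<^sub>m laplacian n G) \<beta>) f) \<le> C\<^sup>2}"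


(* N(0, \<Sigma>) as the law of \<Sigma>^(1/2) Z with Z a vector of n independent standard normals. *)
definition gaussian :: "nat \<Rightarrow> real mat \<Rightarrow> (nat \<Rightarrow> real) measure" where
  "gaussian n \<Sigma> =
     distr (PiM {..<n} (\<lambda>_. density lborel std_normal_density)) (fun_space n)
       (apply_mat n (spectral_fun sqrt \<Sigma>))"

definition exp1_law :: "real measure" where
  "exp1_law = density lborel (exponential_density 1)"

definition power_cov :: "nat \<Rightarrow> nat pair_pre_digraph \<Rightarrow> real \<Rightarrow> real \<Rightarrow> real \<Rightarrow> real mat" where
  "power_cov n G r \<alpha> c =
     mat_inv_spec (mat_powr
       (((real n / c) powr (2 / r)) \<cdot>\<^sub>m (laplacian n G + (1 / (real n)\<^sup>2) \<cdot>\<^sub>m 1\<^sub>m n))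
       (\<alpha> + r / 2))"

definition power_prior ::
    "nat \<Rightarrow> nat pair_pre_digraph \<Rightarrow> real \<Rightarrow> real \<Rightarrow> (nat \<Rightarrow> real) measure" where
  "power_prior n G r \<alpha> = exp1_law \<bind> (\<lambda>c. gaussian n (power_cov n G r \<alpha> c))"

definition exponential_cov :: "nat \<Rightarrow> nat pair_pre_digraph \<Rightarrow> real \<Rightarrow> real \<Rightarrow> real mat" where
  "exponential_cov n G r c =
     real n \<cdot>\<^sub>m mat_exp ((- ((real n / c) powr (2 / r))) \<cdot>\<^sub>m laplacian n G)"

definition exponential_prior ::
    "nat \<Rightarrow> nat pair_pre_digraph \<Rightarrow> real \<Rightarrow> (nat \<Rightarrow> real) measure" where
  "exponential_prior n G r = exp1_law \<bind> (\<lambda>c. gaussian n (exponential_cov n G r c))"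


(* Joint law of Y_i = f(i) + \<epsilon>_i, i < n, with independent N(0, \<sigma>^2) errors, and its density. *)
definition data_law :: "nat \<Rightarrow> real \<Rightarrow> (nat \<Rightarrow> real) \<Rightarrow> (nat \<Rightarrow> real) measure" where
  "data_law n \<sigma> f = PiM {..<n} (\<lambda>i. density lborel (normal_density (f i) \<sigma>))"

definition likelihood :: "nat \<Rightarrow> real \<Rightarrow> (nat \<Rightarrow> real) \<Rightarrow> (nat \<Rightarrow> real) \<Rightarrow> real" where
  "likelihood n \<sigma> f y = (\<Prod>i<n. normal_density (f i) \<sigma> (y i))"

(* Bayes' formula: l is the likelihood as a function of the parameter. *)
definition bayes :: "'a measure \<Rightarrow> ('a \<Rightarrow> real) \<Rightarrow> 'a measure" where
  "bayes prior l = density prior (\<lambda>\<theta>. ennreal (l \<theta> / (LINT \<theta>'|prior. l \<theta>')))"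

definition posterior_known_var ::
    "real \<Rightarrow> nat \<Rightarrow> (nat \<Rightarrow> real) measure \<Rightarrow> (nat \<Rightarrow> real) \<Rightarrow> (nat \<Rightarrow> real) measure" where
  "posterior_known_var \<sigma> n prior y = bayes prior (\<lambda>f. likelihood n \<sigma> f y)"

(* Marginal posterior of f when (f, \<sigma>) has the product prior, f ~ prior and \<sigma> ~ Q independent. *)
definition posterior_unknown_var ::
    "real measure \<Rightarrow> nat \<Rightarrow> (nat \<Rightarrow> real) measure \<Rightarrow> (nat \<Rightarrow> real) \<Rightarrow> (nat \<Rightarrow> real) measure" where
  "posterior_unknown_var Q n prior y =
     distr (bayes (prior \<Otimes>\<^sub>M Q) (\<lambda>(f, s). likelihood n s f y)) prior fst"

definition contracts_at_rate ::
    "nat set \<Rightarrow> real \<Rightarrow> (nat \<Rightarrow> nat \<Rightarrow> real) \<Rightarrow>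
     (nat \<Rightarrow> (nat \<Rightarrow> real) \<Rightarrow> (nat \<Rightarrow> real) measure) \<Rightarrow> (nat \<Rightarrow> real) \<Rightarrow> bool" where
  "contracts_at_rate N \<sigma> f0 post \<epsilon> \<longleftrightarrow>
     (\<exists>M0>0. \<forall>M\<ge>M0. \<forall>\<delta>>0.
        ((\<lambda>n. measure (data_law n \<sigma> (f0 n))
           {y \<in> space (data_law n \<sigma> (f0 n)).
              measure (post n y)
                {f \<in> space (fun_space n). norm_n n (\<lambda>i. f i - f0 n i) \<ge> M * \<epsilon> n} \<ge> \<delta>})
         \<longlongrightarrow> 0) (at_top_along N))"

end

theory Submission
  imports Defs "Jordan_Normal_Form.Schur_Decomposition"
begin

text \<open>In an orthonormal eigenbasis of the Laplacian the prior given \<open>c\<close> is a product of centered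
  normal laws with variances \<open>v\<^sub>i(c)\<close>, and the data are a Gaussian sequence. With
  \<open>I = n powr (r/(r + 2\<beta>))\<close>, three estimates on the scale \<open>n \<epsilon>\<^sub>n\<^sup>2\<close> give contraction: a chi-square test on
  the low frequencies; an exponential bound for the prior mass of the high frequencies, obtained
  by truncating \<open>c\<close> at a multiple of the evidence exponent; and a lower bound for the evidence. For the last
  one, the Cauchy--Schwarz inequality bounds a negative moment of the evidence by
  \<open>W\<^sup>-\<^sup>2\<close> with \<open>W = \<integral>exp(-\<tau> \<Sum>\<^sub>i(f i - f\<^sub>0 i)\<^sup>2)d\<Pi>\<close>, and given \<open>c\<close> this Gaussian integral is explicit:
  \<open>-ln W = \<Sum>\<^sub>i(\<tau> g\<^sub>i\<^sup>2/(1 + 2\<tau>v\<^sub>i) + ln(1 + 2\<tau>v\<^sub>i)/2)\<close>, where \<open>g\<close> are the coefficients of \<open>f\<^sub>0\<close>. For \<open>c\<close> in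
  \<open>[I, 2I]\<close> it is of order \<open>I\<close> for the power prior, and of order \<open>I\<close> times a power of \<open>ln n\<close> for the
  exponential one. An unknown \<open>\<sigma>\<close> only costs the factor \<open>1/n\<close> of prior mass near the true value, and a
  known \<open>\<sigma>\<close> is the case of a point mass.\<close>

text \<open>The weight in W is dictated by the likelihoods. With d = sum of (f i - f0 i)^2, the data
  integral of the squared true likelihood over that of (f, s) is at most 2 exp(2 d / \<sigma>^2) for
  s close to \<sigma>; so \<tau> = 1 / \<sigma>^2 is the value for which the squared weight cancels
  it. A small ball around the truth has no closed-form prior mass, whereas this integral factorises
  over the eigenbasis. The geometry condition is silent below an index \<open>i0\<close>, and the
  truth is controlled only through weights 1 + (n^(2/r) \<lambda>)^\<beta>. Hence the bias is split
  by comparing n^(2/r) \<lambda> with I^(2/r), not by index. Only variances are bounded by index,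
  and the finitely many uncontrolled ones enter the evidence through logarithms and are left to the
  test elsewhere. I solves n I^(-2\<beta>/r) = I, the balance of squared bias and number of
  coefficients. Evidence and test have separate exponents E and k. They coincide for the power
  prior. For the exponential prior, truncating c at a multiple of E pushes the frequency beyond
  which the prior is negligible past E by a further power of the logarithm, and k has to
  follow.\<close>

unbundle no vec_syntax and no inner_syntax

section \<open>Eigenbases of symmetric matrices\<close>

text \<open>Over the complex numbers the polynomial splits. For a root \<open>a\<close> with
  eigenvector \<open>v\<close>, the Hermitian form \<open>q\<close> equals \<open>a\<close> times
  the squared norm of \<open>v\<close>, and it is its own conjugate because the entries are real and
  symmetric; so \<open>a\<close> is real. The factorisation then descends along the injective
  embedding of the reals.\<close>

lemma symmetric_char_poly_splits:
  fixes A :: "real mat"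
  assumes A: "A \<in> carrier_mat n n" and sym: "transpose_mat A = A"
  shows "\<exists>es. char_poly A = (\<Prod>e\<leftarrow>es. [:- e, 1:])"
proof -
  define B where "B = map_mat complex_of_real A"
  have B: "B \<in> carrier_mat n n" using A by (auto simp: B_def)
  interpret h: map_poly_inj_comm_ring_hom complex_of_real ..
  have symA: "A $$ (i, j) = A $$ (j, i)" if "i < n" "j < n" for i j
    using that A arg_cong[OF sym, of "\<lambda>M. M $$ (i, j)"] by auto
  obtain as where as: "char_poly B = (\<Prod>a\<leftarrow>as. [:- a, 1:])"
    using char_poly_factorized[OF B] by blast
  have real: "of_real (Re a) = a" if a: "a \<in> set as" for a
  proof -
    have "poly (char_poly B) a = 0"
      unfolding as using a by (induction as) auto
    then obtain v where v: "eigenvector B v a"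
      using eigenvalue_root_char_poly[OF B] unfolding eigenvalue_def by blast
    then have v_carr: "v \<in> carrier_vec n" and v0: "v \<noteq> 0\<^sub>v n" and ev: "B *\<^sub>v v = a \<cdot>\<^sub>v v"
      using B unfolding eigenvector_def by auto
    have row: "(\<Sum>j<n. of_real (A $$ (i, j)) * v $ j) = a * v $ i" if "i < n" for i
      using arg_cong[OF ev, of "\<lambda>w. w $ i"] that B A v_carr
      by (simp add: B_def scalar_prod_def lessThan_atLeast0)
    define q where "q = (\<Sum>i<n. \<Sum>j<n. cnj (v $ i) * of_real (A $$ (i, j)) * v $ j)"
    define s where "s = (\<Sum>i<n. (cmod (v $ i))\<^sup>2)"
    have "q = (\<Sum>i<n. cnj (v $ i) * (\<Sum>j<n. of_real (A $$ (i, j)) * v $ j))"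
      unfolding q_def by (simp add: sum_distrib_left mult.assoc)
    also have "\<dots> = (\<Sum>i<n. cnj (v $ i) * (a * v $ i))"
      by (intro sum.cong refl) (simp add: row)
    also have "\<dots> = a * of_real s"
      unfolding s_def by (simp add: sum_distrib_left complex_norm_square[symmetric] complex_mult_cnj mult_ac flip: complex_norm_square)
    finally have q: "q = a * of_real s" .
    have "cnj q = (\<Sum>i<n. \<Sum>j<n. v $ i * of_real (A $$ (i, j)) * cnj (v $ j))"
      unfolding q_def by simp
    also have "\<dots> = (\<Sum>j<n. \<Sum>i<n. v $ i * of_real (A $$ (i, j)) * cnj (v $ j))"
      by (rule sum.swap)
    also have "\<dots> = q" unfolding q_def
      by (intro sum.cong refl) (simp add: symA mult_ac)
    finally have "cnj a * of_real s = a * of_real s" using q by simp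
    moreover obtain i where "i < n" "v $ i \<noteq> 0" using v0 v_carr by (metis eq_vecI index_zero_vec carrier_vecD)
    then have "0 < s" unfolding s_def by (intro sum_pos2[of _ i]) auto
    ultimately have "cnj a = a" by simp
    then show ?thesis by (simp add: complex_eq_iff)
  qed
  have "map_poly complex_of_real (char_poly A) = char_poly B"
    unfolding B_def by (rule of_real_hom.char_poly_hom[OF A, symmetric])
  also have "\<dots> = (\<Prod>a\<leftarrow>as. [:- a, 1:])" by (rule as)
  also have "\<dots> = (\<Prod>a\<leftarrow>as. [:- of_real (Re a), 1:])"
    using real by (intro arg_cong[where f = prod_list] map_cong) auto
  also have "\<dots> = map_poly complex_of_real (\<Prod>e\<leftarrow>map Re as. [:- e, 1:])"
  proof (induction as)
    case (Cons a as)
    have "map_poly complex_of_real [:- Re a, 1:] = [:- of_real (Re a), 1:]" by simp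
    then show ?case using Cons by (simp only: list.map prod_list.Cons h.hom_mult)
  qed simp
  finally have "char_poly A = (\<Prod>e\<leftarrow>map Re as. [:- e, 1:])"
    by (simp only: h.eq_iff)
  then show ?thesis by blast
qed

lemma mult_four_block_diag:
  fixes A1 :: "'a :: comm_ring_1 mat"
  assumes "A1 \<in> carrier_mat k k" "A2 \<in> carrier_mat k k" "B1 \<in> carrier_mat m m" "B2 \<in> carrier_mat m m"
  shows "four_block_mat A1 (0\<^sub>m k m) (0\<^sub>m m k) B1 * four_block_mat A2 (0\<^sub>m k m) (0\<^sub>m m k) B2
    = four_block_mat (A1 * A2) (0\<^sub>m k m) (0\<^sub>m m k) (B1 * B2)"
proof -
  have "A1 * A2 \<in> carrier_mat k k" "B1 * B2 \<in> carrier_mat m m"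
    using assms by (auto intro: mult_carrier_mat)
  then show ?thesis
    using assms by (subst mult_four_block_mat[of _ k k _ m _ m _ _ k _ m]) simp_all
qed

text \<open>Deflation: one eigenvector is completed to an orthonormal basis, symmetry makes the
  matrix block diagonal in it, and the smaller symmetric block is handled by induction. Running
  along the list \<open>es\<close> puts the eigenvalues on the diagonal in a prescribed order, so
  that a sorted list yields a sorted diagonal.\<close>

lemma real_spectral_decomposition:
  fixes A :: "real mat"
  assumes "A \<in> carrier_mat n n" and "transpose_mat A = A" and "char_poly A = (\<Prod>e\<leftarrow>es. [:- e, 1:])"
  shows "\<exists>U \<in> carrier_mat n n. transpose_mat U * U = 1\<^sub>m n \<and> A = U * mat_diag n (\<lambda>i. es ! i) * transpose_mat U"
  using assms
proof (induct es arbitrary: n A)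
  case Nil
  then have "n = 0" using degree_monic_char_poly[of A n] by simp
  then show ?case using Nil by (intro bexI[of _ "1\<^sub>m 0"]) (auto intro!: eq_matI)
next
  case (Cons e es n A)
  let ?n1 = "n - 1"
  note A = Cons(2) and sym = Cons(3)
  have cp: "char_poly A = [: -e, 1 :] * (\<Prod>e \<leftarrow> es. [:- e, 1:])" using Cons(4) by simp
  have mon: "monic (\<Prod>e\<leftarrow> es. [:- e, 1:])" by (rule monic_prod_list, auto)
  have deg: "degree (char_poly A) = Suc (degree (\<Prod>e\<leftarrow> es. [:- e, 1:]))" unfolding cp
    by (subst degree_mult_eq, insert mon, auto)
  with degree_monic_char_poly[OF A] have n: "n \<noteq> 0" by auto
  have "eigenvalue A e" unfolding eigenvalue_root_char_poly[OF A] cp by simp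
  then obtain v where "eigenvector A v e" unfolding eigenvalue_def by blast
  then have v: "v \<in> carrier_vec n" and v0: "v \<noteq> 0\<^sub>v n" and ev: "A *\<^sub>v v = e \<cdot>\<^sub>v v"
    using A unfolding eigenvector_def by auto
  define ws where "ws = gram_schmidt n (basis_completion v)"
  interpret cof_vec_space n "TYPE(real)" .
  note bc = basis_completion[OF v v0]
  obtain vs where bv: "basis_completion v = v # vs" using bc(6,7) n by (cases "basis_completion v") auto
  have ws: "set ws \<subseteq> carrier_vec n" "corthogonal ws" "length ws = n"
    using gram_schmidt_result[OF bc(2,4,5) ws_def] bc(6) by auto
  have hdws: "ws ! 0 = v" using gram_schmidt_hd[OF v, of vs, folded bv] ws(3) n
    unfolding ws_def by (metis hd_conv_nth length_0_conv)
  have wsc: "ws ! i \<in> carrier_vec n" if "i < n" for i using ws that by auto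
  have orth: "ws ! i \<bullet> ws ! j = 0 \<longleftrightarrow> i \<noteq> j" if "i < n" "j < n" for i j
    using corthogonalD[OF ws(2), of i j] that ws(3) by simp
  have pos: "ws ! i \<bullet> ws ! i > 0" if "i < n" for i
  proof -
    have "ws ! i \<bullet> ws ! i \<ge> 0" by (simp add: scalar_prod_def sum_nonneg)
    then show ?thesis using orth[OF that that] by (simp add: less_le)
  qed
  \<comment> \<open>Gram-Schmidt leaves the vectors orthogonal but of arbitrary length; after
    normalisation the transpose of \<open>W\<close> is its inverse.\<close>
  define w where "w i = (1 / sqrt (ws ! i \<bullet> ws ! i)) \<cdot>\<^sub>v ws ! i" for i
  have wc: "w i \<in> carrier_vec n" if "i < n" for i using wsc[OF that] by (auto simp: w_def)
  have ww: "w i \<bullet> w j = (if i = j then 1 else 0)" if "i < n" "j < n" for i j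
  proof -
    have "w i \<bullet> w j = 1 / sqrt (ws ! i \<bullet> ws ! i) * (1 / sqrt (ws ! j \<bullet> ws ! j)) * (ws ! i \<bullet> ws ! j)"
      using wsc that by (simp add: w_def smult_scalar_prod_distrib[of _ n] scalar_prod_smult_distrib[of _ n])
    then show ?thesis using orth[OF that] pos[OF that(1)] by (auto simp: real_sqrt_mult[symmetric])
  qed
  define W where "W = mat_of_cols n (map w [0..<n])"
  have W: "W \<in> carrier_mat n n" using mat_of_cols_carrier(1)[of n "map w [0..<n]"] by (simp add: W_def)
  have colW: "col W i = w i" if "i < n" for i
    using that wc by (simp add: W_def)
  have WtW: "transpose_mat W * W = 1\<^sub>m n"
    using W by (intro eq_matI) (auto simp: colW ww)
  have WWt: "W * transpose_mat W = 1\<^sub>m n"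
    using mat_mult_left_right_inverse[OF _ W WtW] W by simp
  define A' where "A' = transpose_mat W * A * W"
  have A': "A' \<in> carrier_mat n n" using W A by (auto simp: A'_def)
  have symA': "transpose_mat A' = A'"
    unfolding A'_def using W A sym
    by (simp add: transpose_mult[of _ n n _ n] assoc_mult_mat[of _ n n _ n _ n] mult_carrier_mat[of _ n n _ n])
  have AA': "A = W * A' * transpose_mat W"
  proof -
    have "W * A' * transpose_mat W = (W * transpose_mat W) * A * (W * transpose_mat W)"
      unfolding A'_def using W A by (simp add: assoc_mult_mat[of _ n n _ n _ n] mult_carrier_mat[of _ n n _ n])
    then show ?thesis using WWt A by simp
  qed
  have w0: "A *\<^sub>v w 0 = e \<cdot>\<^sub>v w 0"
    using v A ev by (simp add: w_def hdws mult_mat_vec smult_smult_assoc mult.commute)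
  have col0: "A' $$ (i, 0) = (if i = 0 then e else 0)" if i: "i < n" for i
  proof -
    have "A' $$ (i, 0) = (transpose_mat W * (A * W)) $$ (i, 0)"
      unfolding A'_def using W A by (simp add: assoc_mult_mat[of _ n n _ n _ n] mult_carrier_mat[of _ n n _ n])
    also have "\<dots> = col W i \<bullet> col (A * W) 0"
      using W A i n by (subst index_mult_mat(1)) auto
    also have "\<dots> = w i \<bullet> (A *\<^sub>v w 0)"
      using i n by (subst col_mult2[OF A W]) (simp_all add: colW)
    also have "\<dots> = e * (w i \<bullet> w 0)" using wc[OF i] wc[of 0] n by (simp add: w0)
    finally show ?thesis using ww[OF i, of 0] n by simp
  qed
  \<comment> \<open>Symmetry of \<open>A'\<close> carries the zeros of the first column over to the
    first row, which gives a diagonal form instead of a triangular one.\<close>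
  have row0: "A' $$ (0, i) = (if i = 0 then e else 0)" if i: "i < n" for i
  proof -
    have "A' $$ (0, i) = transpose_mat A' $$ (i, 0)" using A' i n by simp
    then show ?thesis using col0[OF i] by (simp only: symA')
  qed
  define B where "B = Matrix.mat ?n1 ?n1 (\<lambda>(i, j). A' $$ (Suc i, Suc j))"
  have B: "B \<in> carrier_mat ?n1 ?n1" by (simp add: B_def)
  let ?E = "Matrix.mat 1 1 (\<lambda>_. e)"
  have blk: "A' = four_block_mat ?E (0\<^sub>m 1 ?n1) (0\<^sub>m ?n1 1) B"
  proof (rule eq_matI)
    fix i j assume "i < dim_row (four_block_mat ?E (0\<^sub>m 1 ?n1) (0\<^sub>m ?n1 1) B)"
      "j < dim_col (four_block_mat ?E (0\<^sub>m 1 ?n1) (0\<^sub>m ?n1 1) B)"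
    then have ij: "i < n" "j < n" using n B by auto
    then show "A' $$ (i, j) = four_block_mat ?E (0\<^sub>m 1 ?n1) (0\<^sub>m ?n1 1) B $$ (i, j)"
      using n by (cases i; cases j) (simp_all add: B_def col0 row0)
  qed (use A' B n in auto)
  have symB: "transpose_mat B = B"
  proof (rule eq_matI)
    fix i j assume "i < dim_row B" "j < dim_col B"
    then have ij: "i < ?n1" "j < ?n1" using B by auto
    then have "A' $$ (Suc j, Suc i) = transpose_mat A' $$ (Suc i, Suc j)" using A' by simp
    then show "transpose_mat B $$ (i, j) = B $$ (i, j)" using ij by (simp add: B_def symA')
  qed (use B in auto)
  have "similar_mat A A'"
    by (rule similar_matI[of _ _ W "transpose_mat W" n]) (use W A A' AA' WtW WWt in auto)
  then have "char_poly A' = [: -e, 1 :] * (\<Prod>e \<leftarrow> es. [:- e, 1:])"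
    using cp char_poly_similar[of A A'] by simp
  moreover have "char_poly A' = char_poly ?E * char_poly B"
    unfolding blk by (rule char_poly_four_block_zeros_col[OF _ _ B]) auto
  moreover have "char_poly ?E = [: -e,1 :]"
    by (simp add: char_poly_defs det_def sign_def)
  ultimately have "[: -e, 1 :] * char_poly B = [: -e, 1 :] * (\<Prod> e \<leftarrow> es. [:- e, 1:])"
    by (simp only:)
  then have "char_poly B = (\<Prod> e \<leftarrow> es. [:- e, 1:])"
    by (subst (asm) mult_cancel_left) simp
  from Cons(1)[OF B symB this] obtain P where P: "P \<in> carrier_mat ?n1 ?n1"
    and PtP: "transpose_mat P * P = 1\<^sub>m ?n1"
    and BP: "B = P * mat_diag ?n1 (\<lambda>i. es ! i) * transpose_mat P" by blast
  let ?D = "mat_diag ?n1 (\<lambda>i. es ! i)"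
  have D: "?D \<in> carrier_mat ?n1 ?n1" by simp
  define V where "V = four_block_mat (1\<^sub>m 1) (0\<^sub>m 1 ?n1) (0\<^sub>m ?n1 1) P"
  have n1: "1 + ?n1 = n" using n by simp
  have V: "V \<in> carrier_mat n n"
    unfolding V_def using four_block_carrier_mat[of "1\<^sub>m 1" 1 1 P ?n1 ?n1] P n1 by (metis one_carrier_mat)
  have Vt: "transpose_mat V = four_block_mat (1\<^sub>m 1) (0\<^sub>m 1 ?n1) (0\<^sub>m ?n1 1) (transpose_mat P)"
    unfolding V_def using P by (subst transpose_four_block_mat[of _ 1 1 _ ?n1 _ ?n1]) auto
  have oneblk: "four_block_mat (1\<^sub>m 1) (0\<^sub>m 1 ?n1) (0\<^sub>m ?n1 1) (1\<^sub>m ?n1) = (1\<^sub>m n :: real mat)"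
    using n1 by (intro eq_matI) auto
  have VtV: "transpose_mat V * V = 1\<^sub>m n"
    unfolding Vt unfolding V_def using P
    by (subst mult_four_block_diag) (simp_all only: PtP oneblk transpose_carrier_mat one_carrier_mat left_mult_one_mat[OF one_carrier_mat])
  have dg: "mat_diag n (\<lambda>i. (e # es) ! i) = four_block_mat ?E (0\<^sub>m 1 ?n1) (0\<^sub>m ?n1 1) ?D"
    using n by (intro eq_matI) (auto simp: mat_diag_def nth_Cons')
  have "V * mat_diag n (\<lambda>i. (e # es) ! i) = four_block_mat ?E (0\<^sub>m 1 ?n1) (0\<^sub>m ?n1 1) (P * ?D)"
    unfolding dg V_def using P by (subst mult_four_block_diag) simp_all
  moreover have "four_block_mat ?E (0\<^sub>m 1 ?n1) (0\<^sub>m ?n1 1) (P * ?D) * transpose_mat V = A'"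
    unfolding Vt blk BP using P mult_carrier_mat[OF P D] by (subst mult_four_block_diag) simp_all
  ultimately have "V * mat_diag n (\<lambda>i. (e # es) ! i) * transpose_mat V = A'" by simp
  then have "A = W * (V * mat_diag n (\<lambda>i. (e # es) ! i) * transpose_mat V) * transpose_mat W"
    using AA' by simp
  also have "\<dots> = (W * V) * mat_diag n (\<lambda>i. (e # es) ! i) * transpose_mat (W * V)"
    using W V by (simp add: transpose_mult[of _ n n _ n] assoc_mult_mat[of _ n n _ n _ n] mult_carrier_mat[of _ n n _ n])
  finally have "A = (W * V) * mat_diag n (\<lambda>i. (e # es) ! i) * transpose_mat (W * V)" .
  moreover have "transpose_mat (W * V) * (W * V) = transpose_mat V * (transpose_mat W * W) * V"
    using W V by (simp add: transpose_mult[of _ n n _ n] assoc_mult_mat[of _ n n _ n _ n] mult_carrier_mat[of _ n n _ n])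
  then have "transpose_mat (W * V) * (W * V) = 1\<^sub>m n" using WtW VtV V by simp
  moreover have "W * V \<in> carrier_mat n n" by (rule mult_carrier_mat[OF W V])
  ultimately show ?case by blast
qed

definition orth_mat :: "nat \<Rightarrow> real mat \<Rightarrow> bool" where
  "orth_mat n U \<longleftrightarrow> U \<in> carrier_mat n n \<and> transpose_mat U * U = 1\<^sub>m n"

definition diagonalized :: "nat \<Rightarrow> real mat \<Rightarrow> (nat \<Rightarrow> real) \<Rightarrow> real mat" where
  "diagonalized n U d = U * mat_diag n d * transpose_mat U"

lemma orth_matD:
  assumes "orth_mat n U"
  shows "U \<in> carrier_mat n n" "transpose_mat U * U = 1\<^sub>m n" "U * transpose_mat U = 1\<^sub>m n"
  using assms mat_mult_left_right_inverse[of "transpose_mat U" n U]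
  by (auto simp: orth_mat_def)

lemma orth_mat_cols:
  assumes "orth_mat n U" "i < n" "j < n"
  shows "(\<Sum>k<n. U $$ (k, i) * U $$ (k, j)) = (if i = j then 1 else 0)"
  using arg_cong[OF orth_matD(2)[OF assms(1)], of "\<lambda>M. M $$ (i, j)"]
    orth_matD(1)[OF assms(1)] assms(2,3)
  by (simp add: scalar_prod_def lessThan_atLeast0)

lemma orth_mat_rows:
  assumes "orth_mat n U" "i < n" "j < n"
  shows "(\<Sum>k<n. U $$ (i, k) * U $$ (j, k)) = (if i = j then 1 else 0)"
  using arg_cong[OF orth_matD(3)[OF assms(1)], of "\<lambda>M. M $$ (i, j)"]
    orth_matD(1)[OF assms(1)] assms(2,3)
  by (simp add: scalar_prod_def lessThan_atLeast0)

lemma diagonalized_carrier [simp]: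
  "orth_mat n U \<Longrightarrow> diagonalized n U d \<in> carrier_mat n n"
  by (auto simp: diagonalized_def orth_mat_def intro!: mult_carrier_mat[of _ n n _ n])

lemma dim_diagonalized [simp]:
  assumes "orth_mat n U"
  shows "dim_row (diagonalized n U d) = n" "dim_col (diagonalized n U d) = n"
  using diagonalized_carrier[OF assms, of d] by auto

lemma index_diagonalized:
  assumes "orth_mat n U" "i < n" "j < n"
  shows "diagonalized n U d $$ (i, j) = (\<Sum>k<n. U $$ (i, k) * d k * U $$ (j, k))"
  using orth_matD(1)[OF assms(1)] assms(2,3)
  by (simp add: diagonalized_def mat_diag_mult_right[of _ n] scalar_prod_def lessThan_atLeast0)

lemma similar_mat_wit_diagonalized:
  "orth_mat n U \<Longrightarrow> similar_mat_wit (diagonalized n U d) (mat_diag n d) U (transpose_mat U)"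
  by (rule similar_mat_witI[of _ _ n]) (auto dest: orth_matD simp flip: diagonalized_def)

lemma similar_mat_wit_imp_diagonalized:
  assumes "similar_mat_wit A (mat_diag n d) U (transpose_mat U)" "A \<in> carrier_mat n n"
  shows "orth_mat n U" "A = diagonalized n U d"
proof -
  note * = similar_mat_witD2[OF assms(2,1)]
  show "orth_mat n U" using * by (simp add: orth_mat_def)
  show "A = diagonalized n U d" unfolding diagonalized_def by (rule *(3))
qed

text \<open>The transition matrix \<open>V\<^sup>T U\<close> between two eigenbases only connects equal eigenvalues,
  so it also intertwines the images of the eigenvalues under \<open>\<phi>\<close>.\<close>

lemma diagonalized_unique:
  assumes U: "orth_mat n U" and V: "orth_mat n V"
    and eq: "diagonalized n U d = diagonalized n V e"
  shows "diagonalized n U (\<lambda>i. \<phi> (d i)) = diagonalized n V (\<lambda>i. \<phi> (e i))"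
proof -
  note u = orth_matD[OF U] and v = orth_matD[OF V]
  define W where "W = transpose_mat V * U"
  have W: "W \<in> carrier_mat n n" using u v by (auto simp: W_def)
  have *: "transpose_mat V * diagonalized n U f * U = W * mat_diag n f" for f
  proof -
    have "transpose_mat V * diagonalized n U f * U = W * mat_diag n f * (transpose_mat U * U)"
      unfolding diagonalized_def W_def using u(1) v(1) by (simp add: assoc_mult_mat[of _ n n _ n _ n] mult_carrier_mat[of _ n n _ n])
    then show ?thesis
      using u W right_mult_one_mat[OF mult_carrier_mat[OF W mat_diag_dim[of n f]]] by simp
  qed
  have **: "transpose_mat V * diagonalized n V f * U = mat_diag n f * W" for f
  proof -
    have "transpose_mat V * diagonalized n V f * U = (transpose_mat V * V) * mat_diag n f * W"
      unfolding diagonalized_def W_def using u(1) v(1) by (simp add: assoc_mult_mat[of _ n n _ n _ n] mult_carrier_mat[of _ n n _ n])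
    then show ?thesis using v W left_mult_one_mat[OF mat_diag_dim[of n f]] by simp
  qed
  have comm: "W * mat_diag n d = mat_diag n e * W" using *[of d] **[of e] eq by simp
  have com: "W $$ (i, j) * d j = e i * W $$ (i, j)" if ij: "i < n" "j < n" for i j
  proof -
    have "(W * mat_diag n d) $$ (i, j) = (mat_diag n e * W) $$ (i, j)" by (simp only: comm)
    then show ?thesis
      using ij by (simp add: mat_diag_mult_left[OF W] mat_diag_mult_right[OF W])
  qed
  have eq': "W $$ (i, j) * \<phi> (d j) = \<phi> (e i) * W $$ (i, j)" if "i < n" "j < n" for i j
    using com[OF that] by (cases "W $$ (i, j) = 0") auto
  then have "W * mat_diag n (\<lambda>i. \<phi> (d i)) = mat_diag n (\<lambda>i. \<phi> (e i)) * W"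
    unfolding mat_diag_mult_left[OF W] mat_diag_mult_right[OF W]
    by (intro cong_mat) (simp_all add: eq')
  then have "transpose_mat V * diagonalized n U (\<lambda>i. \<phi> (d i)) * U
      = transpose_mat V * diagonalized n V (\<lambda>i. \<phi> (e i)) * U"
    by (simp add: * **)
  then have "V * (transpose_mat V * diagonalized n U (\<lambda>i. \<phi> (d i)) * U) * transpose_mat U
      = V * (transpose_mat V * diagonalized n V (\<lambda>i. \<phi> (e i)) * U) * transpose_mat U" by simp
  moreover have "V * (transpose_mat V * X * U) * transpose_mat U
      = (V * transpose_mat V) * X * (U * transpose_mat U)" if "X \<in> carrier_mat n n" for X
    using that u(1) v(1) by (simp add: assoc_mult_mat[of _ n n _ n _ n] mult_carrier_mat[of _ n n _ n])
  ultimately have "(V * transpose_mat V) * diagonalized n U (\<lambda>i. \<phi> (d i)) * (U * transpose_mat U)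
      = (V * transpose_mat V) * diagonalized n V (\<lambda>i. \<phi> (e i)) * (U * transpose_mat U)"
    using diagonalized_carrier[OF U] diagonalized_carrier[OF V] by simp
  then show ?thesis
    unfolding u(3) v(3) using diagonalized_carrier[OF U] diagonalized_carrier[OF V]
    by (simp add: left_mult_one_mat[of _ n n] right_mult_one_mat[of _ n n])
qed

text \<open>The choice operator in \<open>spectral_fun\<close> is harmless: every admissible pair is
  another eigenbasis of the same matrix, and \<open>diagonalized_unique\<close> forces the same
  value. All matrix powers, inverses, exponentials and square roots below are evaluated on
  eigenvalues through this equation.\<close>

lemma spectral_fun_diagonalized:
  assumes U: "orth_mat n U"
  shows "spectral_fun \<phi> (diagonalized n U d) = diagonalized n U (\<lambda>i. \<phi> (d i))"
proof -
  have dim: "dim_row (diagonalized n U d) = n" using diagonalized_carrier[OF U, of d] by blast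
  show ?thesis
    unfolding spectral_fun_def dim
  proof (rule some_equality)
    show "\<exists>Ua da. similar_mat_wit (diagonalized n U d) (mat_diag n da) Ua (transpose_mat Ua) \<and>
        diagonalized n U (\<lambda>i. \<phi> (d i)) = Ua * mat_diag n (\<lambda>i. \<phi> (da i)) * transpose_mat Ua"
      using similar_mat_wit_diagonalized[OF U] by (auto simp: diagonalized_def)
  next
    fix B assume "\<exists>Ua da. similar_mat_wit (diagonalized n U d) (mat_diag n da) Ua (transpose_mat Ua) \<and>
        B = Ua * mat_diag n (\<lambda>i. \<phi> (da i)) * transpose_mat Ua"
    then obtain V e where sim: "similar_mat_wit (diagonalized n U d) (mat_diag n e) V (transpose_mat V)"
      and B: "B = diagonalized n V (\<lambda>i. \<phi> (e i))" by (auto simp: diagonalized_def)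
    have "orth_mat n V" "diagonalized n U d = diagonalized n V e"
      using similar_mat_wit_imp_diagonalized[OF sim] U by auto
    then show "B = diagonalized n U (\<lambda>i. \<phi> (d i))"
      unfolding B using diagonalized_unique[OF U] by metis
  qed
qed

lemma smult_diagonalized:
  "orth_mat n U \<Longrightarrow> c \<cdot>\<^sub>m diagonalized n U d = diagonalized n U (\<lambda>i. c * d i)"
  by (rule eq_matI) (simp_all add: index_diagonalized sum_distrib_left mult_ac)

lemma add_diagonalized:
  "orth_mat n U \<Longrightarrow>
    diagonalized n U d + diagonalized n U e = diagonalized n U (\<lambda>i. d i + e i)"
  by (rule eq_matI) (simp_all add: index_diagonalized sum.distrib distrib_left distrib_right)

lemma one_diagonalized: "orth_mat n U \<Longrightarrow> 1\<^sub>m n = diagonalized n U (\<lambda>_. 1)"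
  by (rule eq_matI) (simp_all add: index_diagonalized orth_mat_rows)

text \<open>The roots of a product of linear factors, as a multiset, are the list that indexes it;
  so sorting the list found by \<open>symmetric_char_poly_splits\<close> reproduces
  \<open>eigenvalue_list\<close>, and the decomposition is taken along that order.\<close>

lemma ex_sorted_diagonalization:
  assumes A: "A \<in> carrier_mat n n" and sym: "transpose_mat A = A"
  shows "\<exists>U. orth_mat n U \<and> A = diagonalized n U (\<lambda>i. eigenvalue_list A ! i) \<and>
    length (eigenvalue_list A) = n \<and> sorted (eigenvalue_list A)"
proof -
  obtain fs where fs: "char_poly A = (\<Prod>e\<leftarrow>fs. [:- e, 1:])"
    using symmetric_char_poly_splits[OF A sym] by blast
  have proots: "proots (\<Prod>e\<leftarrow>gs. [:- e, 1:]) = mset gs" for gs :: "real list"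
  proof (induction gs)
    case (Cons a gs)
    have "monic (\<Prod>e\<leftarrow>gs. [:- e, 1:])" by (rule monic_prod_list) auto
    then have "(\<Prod>e\<leftarrow>gs. [:- e, 1:]) \<noteq> 0" by auto
    then have "proots ([:- a, 1:] * (\<Prod>e\<leftarrow>gs. [:- e, 1:])) = {#a#} + mset gs"
      using Cons by (subst proots_mult) auto
    then show ?case by (simp only: list.map prod_list.Cons mset.simps add_mset_add_single[of a "mset gs"] union_commute)
  qed simp
  have es: "eigenvalue_list A = sort fs"
    by (simp only: eigenvalue_list_def fs proots sorted_list_of_multiset_mset)
  have "prod_mset (image_mset (\<lambda>e. [:- e, 1:]) (mset fs)) = prod_mset (image_mset (\<lambda>e. [:- e, 1:]) (mset (sort fs)))"
    by (simp only: mset_sort)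
  then have "char_poly A = (\<Prod>e\<leftarrow>eigenvalue_list A. [:- e, 1:])"
    unfolding fs es by (simp only: prod_mset_prod_list flip: mset_map)
  from real_spectral_decomposition[OF A sym this] obtain U where "U \<in> carrier_mat n n"
    "transpose_mat U * U = 1\<^sub>m n" "A = U * mat_diag n (\<lambda>i. eigenvalue_list A ! i) * transpose_mat U"
    by blast
  moreover have "length fs = n"
    using degree_monic_char_poly[OF A] degree_linear_factors[of "\<lambda>e. - e" fs] fs by simp
  then have "length (eigenvalue_list A) = n" "sorted (eigenvalue_list A)"
    by (simp_all only: es length_sort sorted_sort)
  ultimately show ?thesis
    unfolding orth_mat_def diagonalized_def by blast
qed

section \<open>Rotation invariance of Lebesgue measure and Gaussian laws\<close>

abbreviation lborel_n :: "nat \<Rightarrow> (nat \<Rightarrow> real) measure" where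
  "lborel_n n \<equiv> PiM {..<n} (\<lambda>_. lborel)"

interpretation lborel_PiM: product_sigma_finite "\<lambda>_::nat. lborel :: real measure"
  by unfold_locales

lemma sigma_finite_lborel_n: "sigma_finite_measure (lborel_n n)"
  by (rule lborel_PiM.sigma_finite) simp

lemma pair_sigma_finite_lborel_n: "pair_sigma_finite (lborel_n n) (lborel_n n)"
  by (intro pair_sigma_finite.intro sigma_finite_lborel_n)

lemma sets_lborel_n [measurable_cong]: "sets (lborel_n n) = sets (fun_space n)"
  by (intro sets_PiM_cong) auto

lemma space_lborel_n: "space (lborel_n n) = {..<n} \<rightarrow>\<^sub>E UNIV"
  by (simp add: space_PiM)

lemma measurable_apply_mat [measurable]:
  "(\<lambda>x. apply_mat n A x) \<in> measurable (fun_space n) (fun_space n)"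
  unfolding apply_mat_def by measurable

lemma measurable_affine_n:
  fixes c :: real
  assumes "f \<in> measurable M (fun_space n)" "g \<in> measurable M (fun_space n)"
  shows "(\<lambda>w. \<lambda>i\<in>{..<n}. f w i + c * g w i) \<in> measurable M (fun_space n)"
proof (rule measurable_restrict)
  fix i assume "i \<in> {..<n}"
  then have "(\<lambda>w. f w i) \<in> borel_measurable M" "(\<lambda>w. g w i) \<in> borel_measurable M"
    using measurable_compose[OF assms(1) measurable_component_singleton[of i "{..<n}"]]
      measurable_compose[OF assms(2) measurable_component_singleton[of i "{..<n}"]] by auto
  then show "(\<lambda>w. f w i + c * g w i) \<in> borel_measurable M" by simp
qed

lemma measurable_to_lborel_n: "measurable M (lborel_n n) = measurable M (fun_space n)"
  by (rule measurable_cong_sets) (simp_all add: sets_lborel_n)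

lemma measurable_from_lborel_n: "measurable (lborel_n n) M = measurable (fun_space n) M"
  by (rule measurable_cong_sets) (simp_all add: sets_lborel_n)

text \<open>Each coordinate map preserves \<open>lborel\<close>, and the product measure is
  determined by boxes. Both signs of \<open>c\<close> are used: translations have c = 1, and c = -1
  is the reflection that closes the proof of rotation invariance.\<close>

lemma nn_integral_lborel_n_affine:
  assumes g: "g \<in> borel_measurable (fun_space n)" and c: "\<bar>c\<bar> = (1 :: real)"
  shows "(\<integral>\<^sup>+x. g (\<lambda>i\<in>{..<n}. t i + c * x i) \<partial>lborel_n n) = (\<integral>\<^sup>+x. g x \<partial>lborel_n n)"
proof -
  let ?h = "\<lambda>x. \<lambda>i\<in>{..<n}. t i + c * x i"
  have m: "?h \<in> measurable (lborel_n n) (lborel_n n)" by measurable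
  have "distr (lborel_n n) (lborel_n n) ?h = lborel_n n"
  proof (rule lborel_PiM.PiM_eqI)
    fix A :: "nat \<Rightarrow> real set" assume A: "\<And>i. i \<in> {..<n} \<Longrightarrow> A i \<in> sets lborel"
    have "emeasure (distr (lborel_n n) (lborel_n n) ?h) (Pi\<^sub>E {..<n} A)
        = emeasure (lborel_n n) (?h -` Pi\<^sub>E {..<n} A \<inter> space (lborel_n n))"
      using A by (intro emeasure_distr m sets_PiM_I_finite) auto
    also have "?h -` Pi\<^sub>E {..<n} A \<inter> space (lborel_n n)
        = Pi\<^sub>E {..<n} (\<lambda>i. (\<lambda>x. t i + c * x) -` A i)"
      by (auto simp: space_lborel_n PiE_def Pi_def extensional_def)
    also have "emeasure (lborel_n n) \<dots> = (\<Prod>i<n. emeasure lborel ((\<lambda>x. t i + c * x) -` A i))"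
    proof (intro lborel_PiM.emeasure_PiM)
      fix i assume "i \<in> {..<n}"
      then have "(\<lambda>x. t i + c * x) -` A i \<inter> space borel \<in> sets borel"
        using A[of i] by (intro measurable_sets[of _ borel borel]) auto
      then show "(\<lambda>x. t i + c * x) -` A i \<in> sets lborel" by simp
    qed simp
    also have "\<dots> = (\<Prod>i<n. emeasure lborel (A i))"
    proof (intro prod.cong refl)
      fix i assume "i \<in> {..<n}"
      then have Ai: "A i \<in> sets borel" using A[of i] by simp
      have "lborel = distr lborel borel (\<lambda>x. t i + c * x)"
        using lborel_real_affine[of c "t i"] c density_1[of "distr lborel borel (\<lambda>x. t i + c * x)"]
        by (cases "c = 0") auto
      then have "emeasure lborel (A i) = emeasure (distr lborel borel (\<lambda>x. t i + c * x)) (A i)"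
        by simp
      also have "\<dots> = emeasure lborel ((\<lambda>x. t i + c * x) -` A i)"
        using Ai by (subst emeasure_distr) auto
      finally show "emeasure lborel ((\<lambda>x. t i + c * x) -` A i) = emeasure lborel (A i)" by simp
    qed
    finally show "emeasure (distr (lborel_n n) (lborel_n n) ?h) (Pi\<^sub>E {..<n} A)
        = (\<Prod>i<n. emeasure lborel (A i))" .
  qed auto
  then have "(\<integral>\<^sup>+x. g x \<partial>lborel_n n) = (\<integral>\<^sup>+x. g x \<partial>distr (lborel_n n) (lborel_n n) ?h)" by simp
  also have "\<dots> = (\<integral>\<^sup>+x. g (?h x) \<partial>lborel_n n)"
    using g by (intro nn_integral_distr m) (simp_all cong: measurable_cong_sets add: sets_lborel_n)
  finally show ?thesis by simp
qed

section \<open>Matrices acting on functions and orthogonal changes of coordinates\<close>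

lemma apply_mat_nth: "i < n \<Longrightarrow> apply_mat n A x i = (\<Sum>j<n. A $$ (i, j) * x j)"
  by (simp add: apply_mat_def)

lemma apply_mat_mult:
  assumes "A \<in> carrier_mat n n" "B \<in> carrier_mat n n"
  shows "apply_mat n A (apply_mat n B x) = apply_mat n (A * B) x"
proof (rule ext)
  fix i show "apply_mat n A (apply_mat n B x) i = apply_mat n (A * B) x i"
  proof (cases "i < n")
    case True
    have "apply_mat n A (apply_mat n B x) i = (\<Sum>j<n. A $$ (i, j) * (\<Sum>k<n. B $$ (j, k) * x k))"
      using True by (simp add: apply_mat_nth)
    also have "\<dots> = (\<Sum>k<n. (\<Sum>j<n. A $$ (i, j) * B $$ (j, k)) * x k)"
      unfolding sum_distrib_left sum_distrib_right by (subst sum.swap) (simp add: mult.assoc)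
    also have "\<dots> = (\<Sum>k<n. (A * B) $$ (i, k) * x k)"
      using True assms by (intro sum.cong refl) (simp add: scalar_prod_def lessThan_atLeast0)
    finally show ?thesis using True by (simp add: apply_mat_nth)
  qed (simp add: apply_mat_def)
qed

lemma apply_mat_one: "x \<in> {..<n} \<rightarrow>\<^sub>E UNIV \<Longrightarrow> apply_mat n (1\<^sub>m n) x = x"
  by (rule ext) (auto simp: apply_mat_def PiE_def extensional_def if_distrib[of "\<lambda>a. a * _"] cong: if_cong)

lemma apply_mat_orth_inverse:
  assumes "orth_mat n U" "x \<in> {..<n} \<rightarrow>\<^sub>E UNIV"
  shows "apply_mat n U (apply_mat n (transpose_mat U) x) = x"
    "apply_mat n (transpose_mat U) (apply_mat n U x) = x"
  using orth_matD[OF assms(1)] assms(2) by (simp_all add: apply_mat_mult apply_mat_one)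

lemma orth_mat_transpose:
  assumes "orth_mat n U"
  shows "orth_mat n (transpose_mat U)"
  unfolding orth_mat_def transpose_transpose transpose_carrier_mat
  by (rule conjI[OF orth_matD(1,3)[OF assms]])

lemma sum_squares_apply_mat:
  assumes "orth_mat n U"
  shows "(\<Sum>i<n. (apply_mat n U x i)\<^sup>2) = (\<Sum>i<n. (x i)\<^sup>2)"
proof -
  have "(\<Sum>i<n. (apply_mat n U x i)\<^sup>2) = (\<Sum>i<n. \<Sum>j<n. \<Sum>k<n. (U $$ (i, j) * U $$ (i, k)) * (x j * x k))"
    by (intro sum.cong refl) (simp add: apply_mat_nth power2_eq_square sum_product mult_ac)
  also have "\<dots> = (\<Sum>j<n. \<Sum>i<n. \<Sum>k<n. (U $$ (i, j) * U $$ (i, k)) * (x j * x k))"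
    by (rule sum.swap)
  also have "\<dots> = (\<Sum>j<n. \<Sum>k<n. (\<Sum>i<n. U $$ (i, j) * U $$ (i, k)) * (x j * x k))"
    unfolding sum_distrib_right by (rule sum.cong[OF refl], rule sum.swap)
  also have "\<dots> = (\<Sum>j<n. \<Sum>k<n. (if j = k then 1 else 0) * (x j * x k))"
    by (intro sum.cong refl) (simp add: orth_mat_cols[OF assms])
  also have "\<dots> = (\<Sum>i<n. (x i)\<^sup>2)"
    by (simp add: power2_eq_square if_distrib[of "\<lambda>a. a * _"] cong: if_cong)
  finally show ?thesis .
qed

lemma apply_mat_affine:
  "apply_mat n A (\<lambda>i\<in>{..<n}. t i + c * x i) = (\<lambda>i\<in>{..<n}. apply_mat n A t i + c * apply_mat n A x i)"
  by (rule ext) (simp add: apply_mat_def algebra_simps sum.distrib sum_distrib_left)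

lemma nn_integral_normal_density:
  "s > 0 \<Longrightarrow> (\<integral>\<^sup>+x. ennreal (normal_density m s x) \<partial>lborel) = 1"
  by (subst nn_integral_eq_integral) (auto simp: integral_normal_density)

text \<open>Uniqueness of translation-invariant measures: averaging \<open>g \<circ> U\<close> against a rotation
  invariant probability density \<open>f\<close> and using Fubini and translation invariance twice.\<close>

lemma nn_integral_lborel_n_orth:
  assumes U: "orth_mat n U" and g: "g \<in> borel_measurable (fun_space n)"
  shows "(\<integral>\<^sup>+x. g (apply_mat n U x) \<partial>lborel_n n) = (\<integral>\<^sup>+x. g x \<partial>lborel_n n)"
proof -
  interpret L: pair_sigma_finite "lborel_n n" "lborel_n n" by (rule pair_sigma_finite_lborel_n)
  note g [measurable]
  let ?T = "apply_mat n U" and ?S = "apply_mat n (transpose_mat U)"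
  define f :: "(nat \<Rightarrow> real) \<Rightarrow> ennreal" where "f x = (\<Prod>i<n. ennreal (std_normal_density (x i)))" for x
  have [measurable]: "f \<in> borel_measurable (fun_space n)" unfolding f_def by measurable
  have int_f: "(\<integral>\<^sup>+x. f x \<partial>lborel_n n) = 1"
    unfolding f_def by (subst lborel_PiM.product_nn_integral_prod) (auto simp: nn_integral_normal_density)
  have f_alt: "f x = ennreal ((1 / sqrt (2 * pi)) ^ n * exp (- (\<Sum>i<n. (x i)\<^sup>2) / 2))" for x
  proof -
    have "f x = ennreal (\<Prod>i<n. std_normal_density (x i))"
      unfolding f_def by (simp add: prod_ennreal)
    also have "(\<Prod>i<n. std_normal_density (x i)) = (1 / sqrt (2 * pi)) ^ n * exp (- (\<Sum>i<n. (x i)\<^sup>2) / 2)"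
      unfolding std_normal_density_def prod.distrib
      by (simp add: exp_sum[symmetric] sum_negf[symmetric] sum_divide_distrib)
    finally show ?thesis .
  qed
  have f': "f \<in> borel_measurable (fun_space n)" by measurable
  have T: "?T \<in> measurable (fun_space n) (fun_space n)" by (rule measurable_apply_mat)
  have fst: "fst \<in> measurable (lborel_n n \<Otimes>\<^sub>M lborel_n n) (fun_space n)"
    and snd: "snd \<in> measurable (lborel_n n \<Otimes>\<^sub>M lborel_n n) (fun_space n)"
    using measurable_fst[of "lborel_n n" "lborel_n n"] measurable_snd[of "lborel_n n" "lborel_n n"]
    by (simp_all add: measurable_to_lborel_n)
  have T': "(\<lambda>y. \<lambda>i\<in>{..<n}. - ?T y i) \<in> measurable (fun_space n) (fun_space n)"
    using measurable_affine_n[OF measurable_const[of "\<lambda>i\<in>{..<n}. 0" "fun_space n"] T, of "-1"]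
    by (simp add: space_PiM cong: restrict_cong)
  have m1: "(\<lambda>(x, y). f x * g (\<lambda>i\<in>{..<n}. ?T y i + 1 * x i)) \<in> borel_measurable (lborel_n n \<Otimes>\<^sub>M lborel_n n)"
    unfolding case_prod_beta
    by (intro borel_measurable_times_ennreal measurable_compose[OF fst f']
        measurable_compose[OF measurable_affine_n[OF measurable_compose[OF snd T] fst] g])
  have m2': "(\<lambda>w. f (\<lambda>i\<in>{..<n}. - ?T (snd w) i + 1 * fst w i)) \<in> borel_measurable (lborel_n n \<Otimes>\<^sub>M lborel_n n)"
    using measurable_compose[OF measurable_affine_n[OF measurable_compose[OF snd T'] fst, of 1] f']
    by (simp cong: restrict_cong)
  have m2: "(\<lambda>(x, y). f (\<lambda>i\<in>{..<n}. - ?T y i + 1 * x i) * g x) \<in> borel_measurable (lborel_n n \<Otimes>\<^sub>M lborel_n n)"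
    unfolding case_prod_beta
    by (intro borel_measurable_times_ennreal m2' measurable_compose[OF fst g])
  have m1': "(\<lambda>(y, x). f x * g (\<lambda>i\<in>{..<n}. ?T y i + 1 * x i)) \<in> borel_measurable (lborel_n n \<Otimes>\<^sub>M lborel_n n)"
    using measurable_pair_swap[OF m1] by (simp add: case_prod_beta)
  have f_T: "f (?T x) = f x" for x
    by (simp add: f_alt sum_squares_apply_mat[OF U])
  have f_cong: "f x = f y" if "\<And>i. i < n \<Longrightarrow> x i = y i" for x y
    unfolding f_def using that by (intro prod.cong) auto
  have "(\<integral>\<^sup>+y. g (?T y) \<partial>lborel_n n) = (\<integral>\<^sup>+x. f x * (\<integral>\<^sup>+y. g (?T y) \<partial>lborel_n n) \<partial>lborel_n n)"
    by (simp add: nn_integral_multc int_f)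
  also have "\<dots> = (\<integral>\<^sup>+x. \<integral>\<^sup>+y. f x * g (?T y) \<partial>lborel_n n \<partial>lborel_n n)"
    by (intro nn_integral_cong nn_integral_cmult[symmetric])
       (simp add: measurable_from_lborel_n measurable_compose[OF T g])
  also have "\<dots> = (\<integral>\<^sup>+x. \<integral>\<^sup>+y. f x * g (\<lambda>i\<in>{..<n}. ?T y i + 1 * x i) \<partial>lborel_n n \<partial>lborel_n n)"
  proof (rule nn_integral_cong)
    fix x assume x: "x \<in> space (lborel_n n)"
    have "?T (\<lambda>i\<in>{..<n}. ?S x i + 1 * y i) = (\<lambda>i\<in>{..<n}. ?T y i + 1 * x i)" for y
      unfolding apply_mat_affine using x
      by (intro ext) (simp add: apply_mat_orth_inverse(1)[OF U] space_lborel_n)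
    then show "(\<integral>\<^sup>+y. f x * g (?T y) \<partial>lborel_n n)
        = (\<integral>\<^sup>+y. f x * g (\<lambda>i\<in>{..<n}. ?T y i + 1 * x i) \<partial>lborel_n n)"
      using nn_integral_lborel_n_affine[of "\<lambda>y. f x * g (?T y)" n 1 "?S x"]
        measurable_compose[OF T g] by simp
  qed
  also have "\<dots> = (\<integral>\<^sup>+y. \<integral>\<^sup>+x. f x * g (\<lambda>i\<in>{..<n}. ?T y i + 1 * x i) \<partial>lborel_n n \<partial>lborel_n n)"
    by (rule L.Fubini'[symmetric, OF m1])
  also have "\<dots> = (\<integral>\<^sup>+y. \<integral>\<^sup>+x. f (\<lambda>i\<in>{..<n}. - ?T y i + 1 * x i) * g x \<partial>lborel_n n \<partial>lborel_n n)"
  proof (rule nn_integral_cong)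
    fix y assume y: "y \<in> space (lborel_n n)"
    have "(\<integral>\<^sup>+x. f (\<lambda>i\<in>{..<n}. - ?T y i + 1 * x i) * g x \<partial>lborel_n n)
        = (\<integral>\<^sup>+x. f (\<lambda>i\<in>{..<n}. - ?T y i + 1 * (\<lambda>i\<in>{..<n}. ?T y i + 1 * x i) i)
            * g (\<lambda>i\<in>{..<n}. ?T y i + 1 * x i) \<partial>lborel_n n)"
      by (subst nn_integral_lborel_n_affine[of "\<lambda>x. f (\<lambda>i\<in>{..<n}. - ?T y i + 1 * x i) * g x" n 1 "?T y"])
        (use y in \<open>simp_all add: borel_measurable_times_ennreal g measurable_compose[OF measurable_Pair2'[of y] m2', simplified] flip: measurable_from_lborel_n\<close>)
    also have "\<dots> = (\<integral>\<^sup>+x. f x * g (\<lambda>i\<in>{..<n}. ?T y i + 1 * x i) \<partial>lborel_n n)"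
      by (intro nn_integral_cong arg_cong2[where f = "(*)"] f_cong) auto
    finally show "(\<integral>\<^sup>+x. f x * g (\<lambda>i\<in>{..<n}. ?T y i + 1 * x i) \<partial>lborel_n n)
        = (\<integral>\<^sup>+x. f (\<lambda>i\<in>{..<n}. - ?T y i + 1 * x i) * g x \<partial>lborel_n n)" by simp
  qed
  also have "\<dots> = (\<integral>\<^sup>+x. \<integral>\<^sup>+y. f (\<lambda>i\<in>{..<n}. - ?T y i + 1 * x i) * g x \<partial>lborel_n n \<partial>lborel_n n)"
    by (rule L.Fubini'[OF m2])
  also have "\<dots> = (\<integral>\<^sup>+x. (\<integral>\<^sup>+y. f (\<lambda>i\<in>{..<n}. - ?T y i + 1 * x i) \<partial>lborel_n n) * g x \<partial>lborel_n n)"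
  proof (intro nn_integral_cong nn_integral_multc)
    fix x assume "x \<in> space (lborel_n n)"
    from measurable_compose[OF measurable_Pair1'[OF this] m2']
    show "(\<lambda>y. f (\<lambda>i\<in>{..<n}. - ?T y i + 1 * x i)) \<in> borel_measurable (lborel_n n)" by simp
  qed
  also have "\<dots> = (\<integral>\<^sup>+x. 1 * g x \<partial>lborel_n n)"
  proof (intro nn_integral_cong arg_cong2[where f = "(*)"] refl)
    fix x assume x: "x \<in> space (lborel_n n)"
    \<comment> \<open>With S the inverse of U one has x - U y = U (S x - y), and \<open>f\<close>
      does not see U; what remains is the integral of \<open>f\<close> after a reflection and a
      translation.\<close>
    have "(\<integral>\<^sup>+y. f (\<lambda>i\<in>{..<n}. - ?T y i + 1 * x i) \<partial>lborel_n n)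
        = (\<integral>\<^sup>+y. f (\<lambda>i\<in>{..<n}. ?S x i + (-1) * y i) \<partial>lborel_n n)"
    proof (rule nn_integral_cong)
      fix y
      have "?T (\<lambda>i\<in>{..<n}. ?S x i + (-1) * y i) = (\<lambda>i\<in>{..<n}. - ?T y i + 1 * x i)"
        unfolding apply_mat_affine using x
        by (intro ext) (simp add: apply_mat_orth_inverse(1)[OF U] space_lborel_n)
      then show "f (\<lambda>i\<in>{..<n}. - ?T y i + 1 * x i) = f (\<lambda>i\<in>{..<n}. ?S x i + (-1) * y i)"
        using f_T[of "\<lambda>i\<in>{..<n}. ?S x i + (-1) * y i"] by simp
    qed
    also have "\<dots> = 1"
      by (subst nn_integral_lborel_n_affine) (auto simp: int_f)
    finally show "(\<integral>\<^sup>+y. f (\<lambda>i\<in>{..<n}. - ?T y i + 1 * x i) \<partial>lborel_n n) = 1" .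
  qed
  finally show ?thesis by simp
qed

lemma PiM_density_lborel:
  assumes [measurable]: "\<And>i. d i \<in> borel_measurable borel"
    and one: "\<And>i. (\<integral>\<^sup>+x. ennreal (d i x) \<partial>lborel) = 1"
  shows "PiM {..<n::nat} (\<lambda>i. density lborel (\<lambda>x. ennreal (d i x)))
    = density (lborel_n n) (\<lambda>x. \<Prod>i<n. ennreal (d i (x i)))"
proof -
  have "prob_space (density lborel (\<lambda>x. ennreal (d i x)))" for i
    by (rule prob_spaceI) (simp add: emeasure_density one)
  then interpret P: product_prob_space "\<lambda>i. density lborel (\<lambda>x. ennreal (d i x))"
    by (intro product_prob_spaceI)
  have sets_eq: "sets (PiM {..<n::nat} (\<lambda>i. density lborel (\<lambda>x. ennreal (d i x)))) = sets (fun_space n)"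
    by (intro sets_PiM_cong) auto
  show ?thesis
  proof (rule P.PiM_eqI[symmetric])
    fix A :: "nat \<Rightarrow> real set" assume "\<And>i. i \<in> {..<n} \<Longrightarrow> A i \<in> sets (density lborel (\<lambda>x. ennreal (d i x)))"
    then have A: "\<And>i. i \<in> {..<n} \<Longrightarrow> A i \<in> sets borel" by simp
    have [measurable]: "Pi\<^sub>E {..<n} A \<in> sets (fun_space n)" using A by (intro sets_PiM_I_finite) auto
    have "emeasure (density (lborel_n n) (\<lambda>x. \<Prod>i<n. ennreal (d i (x i)))) (Pi\<^sub>E {..<n} A)
        = (\<integral>\<^sup>+x. (\<Prod>i<n. ennreal (d i (x i))) * indicator (Pi\<^sub>E {..<n} A) x \<partial>lborel_n n)"
      by (rule emeasure_density) (simp_all add: sets_lborel_n)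
    also have "\<dots> = (\<integral>\<^sup>+x. (\<Prod>i<n. ennreal (d i (x i)) * indicator (A i) (x i)) \<partial>lborel_n n)"
    proof (rule nn_integral_cong)
      fix x assume x: "x \<in> space (lborel_n n)"
      have "indicator (Pi\<^sub>E {..<n} A) x = (\<Prod>i<n. indicator (A i) (x i) :: ennreal)"
      proof (cases "\<forall>i\<in>{..<n}. x i \<in> A i")
        case True
        then show ?thesis using x by (auto simp: space_lborel_n PiE_iff)
      next
        case False
        then obtain i where i: "i < n" "x i \<notin> A i" by auto
        then have "(\<Prod>i<n. indicator (A i) (x i) :: ennreal) = 0" by (intro prod_zero bexI[of _ i]) auto
        moreover have "x \<notin> Pi\<^sub>E {..<n} A" using i by auto
        ultimately show ?thesis by simp
      qed
      then show "(\<Prod>i<n. ennreal (d i (x i))) * indicator (Pi\<^sub>E {..<n} A) x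
          = (\<Prod>i<n. ennreal (d i (x i)) * indicator (A i) (x i))"
        by (simp add: prod.distrib)
    qed
    also have "\<dots> = (\<Prod>i<n. \<integral>\<^sup>+x. ennreal (d i x) * indicator (A i) x \<partial>lborel)"
      using A by (intro lborel_PiM.product_nn_integral_prod) auto
    also have "\<dots> = (\<Prod>i<n. emeasure (density lborel (\<lambda>x. ennreal (d i x))) (A i))"
      using A by (intro prod.cong refl) (simp add: emeasure_density)
    finally show "emeasure (density (lborel_n n) (\<lambda>x. \<Prod>i<n. ennreal (d i (x i)))) (Pi\<^sub>E {..<n} A)
        = (\<Prod>i<n. emeasure (density lborel (\<lambda>x. ennreal (d i x))) (A i))" .
  qed (simp_all add: sets_eq sets_lborel_n)
qed

section \<open>The law of the data and its invariance under shifts and rotations\<close>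

lemma likelihood_eq:
  "likelihood n s f y = (1 / sqrt (2 * pi * s\<^sup>2)) ^ n * exp (- (\<Sum>i<n. (y i - f i)\<^sup>2) / (2 * s\<^sup>2))"
  unfolding likelihood_def normal_density_def prod.distrib
  by (simp add: exp_sum[symmetric] sum_negf[symmetric] sum_divide_distrib)

lemma likelihood_nonneg [simp]: "likelihood n s f y \<ge> 0"
  by (simp add: likelihood_eq)

lemma likelihood_pos: "s > 0 \<Longrightarrow> likelihood n s f y > 0"
  by (simp add: likelihood_eq)

lemma measurable_likelihood [measurable]:
  "(\<lambda>y. likelihood n s f y) \<in> borel_measurable (fun_space n)"
  unfolding likelihood_def by measurable

lemma data_law_density:
  assumes "s > 0"
  shows "data_law n s f = density (lborel_n n) (\<lambda>y. ennreal (likelihood n s f y))"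
proof -
  have "data_law n s f = density (lborel_n n) (\<lambda>x. \<Prod>i<n. ennreal (normal_density (f i) s (x i)))"
    unfolding data_law_def using assms
    by (intro PiM_density_lborel) (auto simp: nn_integral_normal_density)
  then show ?thesis by (simp add: likelihood_def prod_ennreal)
qed

lemma sets_data_law [measurable_cong]: "sets (data_law n s f) = sets (fun_space n)"
  unfolding data_law_def by (intro sets_PiM_cong) auto

lemma space_data_law: "space (data_law n s f) = {..<n} \<rightarrow>\<^sub>E UNIV"
  by (simp add: data_law_def space_PiM)

lemma prob_space_data_law: "s > 0 \<Longrightarrow> prob_space (data_law n s f)"
  unfolding data_law_def by (intro prob_space_PiM prob_space_normal_density)

lemma nn_integral_data_law:
  assumes "s > 0" "g \<in> borel_measurable (fun_space n)"
  shows "(\<integral>\<^sup>+y. g y \<partial>data_law n s f) = (\<integral>\<^sup>+y. ennreal (likelihood n s f y) * g y \<partial>lborel_n n)"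
  unfolding data_law_density[OF assms(1)] using assms(2)
  by (intro nn_integral_density) (simp_all add: measurable_from_lborel_n)

text \<open>The density of centered noise depends on the sum of squares only, so the invariance of
  Lebesgue measure passes to the noise.\<close>

lemma nn_integral_data_law_orth:
  assumes U: "orth_mat n U" and s: "s > 0" and g: "g \<in> borel_measurable (fun_space n)"
  shows "(\<integral>\<^sup>+x. g (apply_mat n U x) \<partial>data_law n s (\<lambda>_. 0)) = (\<integral>\<^sup>+x. g x \<partial>data_law n s (\<lambda>_. 0))"
proof -
  have *: "likelihood n s (\<lambda>_. 0) (apply_mat n U x) = likelihood n s (\<lambda>_. 0) x" for x
    by (simp add: likelihood_eq sum_squares_apply_mat[OF U])
  show ?thesis
    using nn_integral_lborel_n_orth[OF U, of "\<lambda>y. ennreal (likelihood n s (\<lambda>_. 0) y) * g y"] g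
    by (simp add: nn_integral_data_law s measurable_compose[OF measurable_apply_mat g] *)
qed

lemma measurable_minus_n: "(\<lambda>y. \<lambda>i\<in>{..<n}. y i - f i) \<in> measurable (fun_space n) (fun_space n)"
  by measurable

lemma nn_integral_data_law_shift:
  assumes s: "s > 0" and g: "g \<in> borel_measurable (fun_space n)"
  shows "(\<integral>\<^sup>+y. g (\<lambda>i\<in>{..<n}. y i - f i) \<partial>data_law n s f) = (\<integral>\<^sup>+x. g x \<partial>data_law n s (\<lambda>_. 0))"
proof -
  have *: "likelihood n s (\<lambda>_. 0) (\<lambda>i\<in>{..<n}. y i - f i) = likelihood n s f y" for y
    by (simp add: likelihood_eq)
  show ?thesis
    using nn_integral_lborel_n_affine[of "\<lambda>y. ennreal (likelihood n s (\<lambda>_. 0) y) * g y" n 1 "\<lambda>i. - f i"] g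
    by (simp add: nn_integral_data_law s measurable_compose[OF measurable_minus_n g] * cong: restrict_cong)
qed

text \<open>Coordinates with respect to the columns of \<open>U\<close>, which are orthonormal for
  the plain Euclidean product and not for \<open>inner_n\<close>. Sums of squared coefficients are
  therefore n times squared \<open>norm_n\<close>, which is why all thresholds below live on the
  scale of n times the squared rate.\<close>

definition coef :: "nat \<Rightarrow> real mat \<Rightarrow> (nat \<Rightarrow> real) \<Rightarrow> nat \<Rightarrow> real" where
  "coef n U f = apply_mat n (transpose_mat U) f"

lemma measurable_coef: "(\<lambda>f. coef n U f) \<in> measurable (fun_space n) (fun_space n)"
  unfolding coef_def by (rule measurable_apply_mat)

lemma measurable_coef_nth [measurable]:
  assumes "i < n" shows "(\<lambda>f. coef n U f i) \<in> borel_measurable (fun_space n)"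
  using measurable_compose[OF measurable_coef measurable_component_singleton] assms by simp

lemma coef_cong: "(\<And>i. i < n \<Longrightarrow> f i = g i) \<Longrightarrow> coef n U f = coef n U g"
  by (simp add: coef_def apply_mat_def)

lemma coef_diff: "i < n \<Longrightarrow> coef n U (\<lambda>j. f j - g j) i = coef n U f i - coef n U g i"
  by (simp add: coef_def apply_mat_def right_diff_distrib sum_subtractf)

lemma coef_apply_mat:
  assumes "orth_mat n U" "i < n" shows "coef n U (apply_mat n U x) i = x i"
proof -
  have "apply_mat n U x = apply_mat n U (restrict x {..<n})" by (simp add: apply_mat_def)
  then show ?thesis
    using apply_mat_orth_inverse(2)[OF assms(1), of "restrict x {..<n}"] assms(2)
    by (simp add: coef_def)
qed

lemma sum_coef_squares:
  "orth_mat n U \<Longrightarrow> (\<Sum>i<n. (coef n U f i)\<^sup>2) = (\<Sum>i<n. (f i)\<^sup>2)"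
  unfolding coef_def by (rule sum_squares_apply_mat[OF orth_mat_transpose])

text \<open>This is the Gaussian sequence model: in any orthonormal basis the noise coefficients are
  again independent N(0, s^2). Tests on a set of frequencies thereby become statements about
  products of one-dimensional integrals.\<close>

lemma nn_integral_data_law_coef:
  assumes U: "orth_mat n U" and s: "s > 0" and g: "g \<in> borel_measurable (fun_space n)"
  shows "(\<integral>\<^sup>+y. g (coef n U (\<lambda>i. y i - f i)) \<partial>data_law n s f) = (\<integral>\<^sup>+x. g x \<partial>data_law n s (\<lambda>_. 0))"
proof -
  have "coef n U (\<lambda>i. y i - f i) = coef n U (\<lambda>i\<in>{..<n}. y i - f i)" for y
    by (rule coef_cong) simp
  then show ?thesis
    using nn_integral_data_law_shift[OF s measurable_compose[OF measurable_coef[of n U] g], of f]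
      nn_integral_data_law_orth[OF orth_mat_transpose[OF U] s g]
    by (simp add: coef_def)
qed

lemma nn_integral_data_law_prod:
  assumes s: "s > 0" and h: "\<And>i. h i \<in> borel_measurable borel"
  shows "(\<integral>\<^sup>+x. (\<Prod>i<n. h i (x i)) \<partial>data_law n s f)
    = (\<Prod>i<n. \<integral>\<^sup>+x. ennreal (normal_density (f i) s x) * h i x \<partial>lborel)"
proof -
  note h [measurable]
  have "(\<integral>\<^sup>+x. (\<Prod>i<n. h i (x i)) \<partial>data_law n s f)
      = (\<integral>\<^sup>+x. ennreal (likelihood n s f x) * (\<Prod>i<n. h i (x i)) \<partial>lborel_n n)"
    by (rule nn_integral_data_law[OF s]) measurable
  also have "\<dots> = (\<integral>\<^sup>+x. (\<Prod>i<n. ennreal (normal_density (f i) s (x i)) * h i (x i)) \<partial>lborel_n n)"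
    by (simp add: likelihood_def prod.distrib prod_ennreal)
  also have "\<dots> = (\<Prod>i<n. \<integral>\<^sup>+x. ennreal (normal_density (f i) s x) * h i x \<partial>lborel)"
    by (rule lborel_PiM.product_nn_integral_prod) auto
  finally show ?thesis .
qed

section \<open>One-dimensional Gaussian integrals\<close>

text \<open>Completing the square. The parameters \<open>c\<close>, \<open>b\<close>,
  \<open>A\<close> form the common normal shape to which the three integrals below are
  reduced.\<close>

lemma nn_integral_exp_quadratic:
  fixes A b c :: real
  assumes A: "A > 0"
  shows "(\<integral>\<^sup>+x. ennreal (exp (c + b * x - A * x\<^sup>2 / 2)) \<partial>lborel)
    = ennreal (sqrt (2 * pi / A) * exp (c + b\<^sup>2 / (2 * A)))"
proof -
  let ?K = "sqrt (2 * pi / A) * exp (c + b\<^sup>2 / (2 * A))"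
  have eq: "exp (c + b * x - A * x\<^sup>2 / 2) = ?K * normal_density (b / A) (1 / sqrt A) x" for x
  proof -
    have "c + b * x - A * x\<^sup>2 / 2 = (c + b\<^sup>2 / (2 * A)) + (- (x - b / A)\<^sup>2 / (2 * (1 / A)))"
      using A by (simp add: field_simps power2_eq_square)
    then have "exp (c + b * x - A * x\<^sup>2 / 2)
        = exp (c + b\<^sup>2 / (2 * A)) * exp (- (x - b / A)\<^sup>2 / (2 * (1 / A)))"
      by (simp only: exp_add)
    moreover have "sqrt (2 * pi / A) * (1 / sqrt (2 * pi * (1 / A))) = 1" using A by simp
    moreover have "(1 / sqrt A)\<^sup>2 = 1 / A" using A by (simp add: power_divide)
    ultimately show ?thesis using A unfolding normal_density_def by (simp add: mult_ac)
  qed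
  have "(\<integral>\<^sup>+x. ennreal (exp (c + b * x - A * x\<^sup>2 / 2)) \<partial>lborel)
      = (\<integral>\<^sup>+x. ennreal ?K * ennreal (normal_density (b / A) (1 / sqrt A) x) \<partial>lborel)"
    unfolding eq using A by (intro nn_integral_cong ennreal_mult) auto
  also have "\<dots> = ennreal ?K"
    using A by (simp add: nn_integral_cmult nn_integral_normal_density)
  finally show ?thesis .
qed

lemma nn_integral_exp_quadratic_cmult:
  fixes A b c K :: real
  assumes "A > 0" "K \<ge> 0"
  shows "(\<integral>\<^sup>+x. ennreal (K * exp (c + b * x - A * x\<^sup>2 / 2)) \<partial>lborel)
    = ennreal (K * (sqrt (2 * pi / A) * exp (c + b\<^sup>2 / (2 * A))))"
  using nn_integral_exp_quadratic[OF assms(1), of c b] assms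
  by (simp add: ennreal_mult nn_integral_cmult)

text \<open>The Laplace transform of a scaled chi-square variable. It feeds both Chernoff bounds of
  the development, the one for the noise and the one for the high frequencies of the prior.\<close>

lemma normal_exp_square:
  fixes s t :: real
  assumes s: "s > 0" and t: "2 * t * s\<^sup>2 < 1"
  shows "(\<integral>\<^sup>+x. ennreal (normal_density 0 s x) * ennreal (exp (t * x\<^sup>2)) \<partial>lborel)
    = ennreal (1 / sqrt (1 - 2 * t * s\<^sup>2))"
proof -
  let ?A = "1 / s\<^sup>2 - 2 * t"
  have A: "?A > 0" using s t by (simp add: field_simps)
  have eq: "normal_density 0 s x * exp (t * x\<^sup>2)
      = 1 / sqrt (2 * pi * s\<^sup>2) * exp (0 + 0 * x - ?A * x\<^sup>2 / 2)" for x
    unfolding normal_density_def by (simp add: field_simps flip: exp_add)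
  have K: "1 / sqrt (2 * pi * s\<^sup>2) * sqrt (2 * pi / ?A) = 1 / sqrt (1 - 2 * t * s\<^sup>2)"
  proof -
    have "2 * pi / ?A = 2 * pi * s\<^sup>2 / (1 - 2 * t * s\<^sup>2)"
      using s t by (simp add: field_simps)
    then show ?thesis using s t by (simp add: real_sqrt_divide)
  qed
  have "(\<integral>\<^sup>+x. ennreal (normal_density 0 s x) * ennreal (exp (t * x\<^sup>2)) \<partial>lborel)
      = (\<integral>\<^sup>+x. ennreal (1 / sqrt (2 * pi * s\<^sup>2) * exp (0 + 0 * x - ?A * x\<^sup>2 / 2)) \<partial>lborel)"
    by (intro nn_integral_cong) (simp only: eq[symmetric], simp add: ennreal_mult)
  also have "\<dots> = ennreal (1 / sqrt (2 * pi * s\<^sup>2) * (sqrt (2 * pi / ?A) * exp (0 + 0\<^sup>2 / (2 * ?A))))"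
    using A by (intro nn_integral_exp_quadratic_cmult) auto
  also have "\<dots> = ennreal (1 / sqrt (1 - 2 * t * s\<^sup>2))"
    by (simp only: K[symmetric]) simp
  finally show ?thesis .
qed

text \<open>One coordinate of W: the prior coefficient is \<open>a\<close> times a standard normal,
  \<open>g\<close> is the true coefficient. The exponential factor is the price of bias, the square
  root that of prior spread.\<close>

lemma std_normal_exp_shifted_square:
  fixes a g \<tau> :: real
  assumes "\<tau> \<ge> 0"
  shows "(\<integral>\<^sup>+x. ennreal (std_normal_density x) * ennreal (exp (- \<tau> * (a * x - g)\<^sup>2)) \<partial>lborel)
    = ennreal (exp (- \<tau> * g\<^sup>2 / (1 + 2 * \<tau> * a\<^sup>2)) / sqrt (1 + 2 * \<tau> * a\<^sup>2))"
proof -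
  let ?A = "1 + 2 * \<tau> * a\<^sup>2"
  have A: "?A > 0" using assms by (simp add: add_pos_nonneg)
  have eq: "std_normal_density x * exp (- \<tau> * (a * x - g)\<^sup>2)
      = 1 / sqrt (2 * pi) * exp (- \<tau> * g\<^sup>2 + (2 * \<tau> * a * g) * x - ?A * x\<^sup>2 / 2)" for x
    unfolding std_normal_density_def by (simp add: field_simps power2_eq_square flip: exp_add)
  have e: "- \<tau> * g\<^sup>2 + (2 * \<tau> * a * g)\<^sup>2 / (2 * ?A) = - \<tau> * g\<^sup>2 / ?A"
    using A by (simp add: field_simps power2_eq_square)
  have "(\<integral>\<^sup>+x. ennreal (std_normal_density x) * ennreal (exp (- \<tau> * (a * x - g)\<^sup>2)) \<partial>lborel)
      = (\<integral>\<^sup>+x. ennreal (1 / sqrt (2 * pi) * exp (- \<tau> * g\<^sup>2 + (2 * \<tau> * a * g) * x - ?A * x\<^sup>2 / 2)) \<partial>lborel)"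
    by (intro nn_integral_cong) (simp only: eq[symmetric], simp add: ennreal_mult)
  also have "\<dots> = ennreal (1 / sqrt (2 * pi) * (sqrt (2 * pi / ?A) * exp (- \<tau> * g\<^sup>2 + (2 * \<tau> * a * g)\<^sup>2 / (2 * ?A))))"
    using A by (intro nn_integral_exp_quadratic_cmult) auto
  also have "\<dots> = ennreal (exp (- \<tau> * g\<^sup>2 / ?A) / sqrt ?A)"
    by (simp only: e) (simp add: real_sqrt_divide)
  finally show ?thesis .
qed

text \<open>The integral behind the chi-square divergence. The quadratic term has precision 2 /
  \<sigma>^2 - 1 / s^2, positive exactly under the hypothesis \<open>less\<close>; a likelihood with
  too small \<open>s\<close> has tails too light for the integral to converge.\<close>

lemma normal_square_ratio:
  fixes s \<sigma> m m' :: real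
  assumes s: "s > 0" and \<sigma>: "\<sigma> > 0" and less: "\<sigma>\<^sup>2 < 2 * s\<^sup>2"
  shows "(\<integral>\<^sup>+x. ennreal ((normal_density m \<sigma> x)\<^sup>2 / normal_density m' s x) \<partial>lborel)
    = ennreal (s\<^sup>2 / (\<sigma> * sqrt (2 * s\<^sup>2 - \<sigma>\<^sup>2)) * exp ((m' - m)\<^sup>2 / (2 * s\<^sup>2 - \<sigma>\<^sup>2)))"
proof -
  let ?A = "2 / \<sigma>\<^sup>2 - 1 / s\<^sup>2" and ?b = "2 * m / \<sigma>\<^sup>2 - m' / s\<^sup>2" and ?c = "- m\<^sup>2 / \<sigma>\<^sup>2 + m'\<^sup>2 / (2 * s\<^sup>2)"
  have pos: "2 * s\<^sup>2 - \<sigma>\<^sup>2 > 0" using less by simp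
  have A_eq: "?A = (2 * s\<^sup>2 - \<sigma>\<^sup>2) / (\<sigma>\<^sup>2 * s\<^sup>2)" using s \<sigma> by (simp add: field_simps)
  have A: "?A > 0" unfolding A_eq using pos s \<sigma> by simp
  have eq: "(normal_density m \<sigma> x)\<^sup>2 / normal_density m' s x
      = sqrt (2 * pi * s\<^sup>2) / (2 * pi * \<sigma>\<^sup>2) * exp (?c + ?b * x - ?A * x\<^sup>2 / 2)" for x
  proof -
    have "(normal_density m \<sigma> x)\<^sup>2 / normal_density m' s x
        = (1 / sqrt (2 * pi * \<sigma>\<^sup>2))\<^sup>2 / (1 / sqrt (2 * pi * s\<^sup>2))
          * (exp (- (x - m)\<^sup>2 / (2 * \<sigma>\<^sup>2)) ^ 2 / exp (- (x - m')\<^sup>2 / (2 * s\<^sup>2)))"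
      unfolding normal_density_def by (simp add: power_mult_distrib power_divide)
    also have "exp (- (x - m)\<^sup>2 / (2 * \<sigma>\<^sup>2)) ^ 2 / exp (- (x - m')\<^sup>2 / (2 * s\<^sup>2))
        = exp (2 * (- (x - m)\<^sup>2 / (2 * \<sigma>\<^sup>2)) - (- (x - m')\<^sup>2 / (2 * s\<^sup>2)))"
      by (simp only: exp_double[symmetric] exp_diff)
    also have "2 * (- (x - m)\<^sup>2 / (2 * \<sigma>\<^sup>2)) - (- (x - m')\<^sup>2 / (2 * s\<^sup>2)) = ?c + ?b * x - ?A * x\<^sup>2 / 2"
      using s \<sigma> by (simp add: field_simps power2_eq_square)
    also have "(1 / sqrt (2 * pi * \<sigma>\<^sup>2))\<^sup>2 / (1 / sqrt (2 * pi * s\<^sup>2)) = sqrt (2 * pi * s\<^sup>2) / (2 * pi * \<sigma>\<^sup>2)"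
      by (simp add: power_divide)
    finally show ?thesis .
  qed
  have e: "?c + ?b\<^sup>2 / (2 * ?A) = (m' - m)\<^sup>2 / (2 * s\<^sup>2 - \<sigma>\<^sup>2)"
  proof -
    define p q where "p = \<sigma>\<^sup>2" and "q = s\<^sup>2"
    have pq: "p > 0" "q > 0" "2 * q - p > 0" using s \<sigma> pos by (auto simp: p_def q_def)
    have "?c + ?b\<^sup>2 / (2 * ?A) = - m\<^sup>2 / p + m'\<^sup>2 / (2 * q) + (2 * m / p - m' / q)\<^sup>2 / (2 * ((2 * q - p) / (p * q)))"
      unfolding A_eq by (simp add: p_def q_def)
    also have "(2 * m / p - m' / q)\<^sup>2 / (2 * ((2 * q - p) / (p * q))) = (2 * m * q - m' * p)\<^sup>2 / (2 * p * q * (2 * q - p))"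
    proof -
      have "2 * m / p - m' / q = (2 * m * q - m' * p) / (p * q)" using pq by (simp add: field_simps)
      then show ?thesis using pq by (simp add: power2_eq_square)
    qed
    also have "- m\<^sup>2 / p + m'\<^sup>2 / (2 * q) = (m'\<^sup>2 * p - 2 * m\<^sup>2 * q) * (2 * q - p) / (2 * p * q * (2 * q - p))"
      using pq by (simp add: field_simps)
    also have "(m'\<^sup>2 * p - 2 * m\<^sup>2 * q) * (2 * q - p) / (2 * p * q * (2 * q - p)) + (2 * m * q - m' * p)\<^sup>2 / (2 * p * q * (2 * q - p))
        = (2 * p * q * (m' - m)\<^sup>2) / (2 * p * q * (2 * q - p))"
      unfolding add_divide_distrib[symmetric]
      by (rule arg_cong[where f = "\<lambda>z. z / _"]) (simp add: power2_eq_square algebra_simps)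
    also have "\<dots> = (m' - m)\<^sup>2 / (2 * q - p)" using pq by simp
    finally show ?thesis by (simp add: p_def q_def)
  qed
  have K: "sqrt (2 * pi * s\<^sup>2) / (2 * pi * \<sigma>\<^sup>2) * sqrt (2 * pi / ?A) = s\<^sup>2 / (\<sigma> * sqrt (2 * s\<^sup>2 - \<sigma>\<^sup>2))"
  proof -
    have "sqrt (2 * pi / ?A) = sqrt (2 * pi) * (\<sigma> * s) / sqrt (2 * s\<^sup>2 - \<sigma>\<^sup>2)"
      unfolding A_eq using s \<sigma> by (simp add: real_sqrt_divide real_sqrt_mult)
    moreover have "sqrt (2 * pi * s\<^sup>2) = sqrt (2 * pi) * s" using s by (simp add: real_sqrt_mult)
    moreover have "sqrt (2 * pi) * sqrt (2 * pi) = 2 * pi" by simp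
    ultimately have "sqrt (2 * pi * s\<^sup>2) / (2 * pi * \<sigma>\<^sup>2) * sqrt (2 * pi / ?A)
        = (2 * pi) * (s * (\<sigma> * s)) / (2 * pi * \<sigma>\<^sup>2 * sqrt (2 * s\<^sup>2 - \<sigma>\<^sup>2))"
      by (simp add: mult_ac)
    also have "\<dots> = s\<^sup>2 / (\<sigma> * sqrt (2 * s\<^sup>2 - \<sigma>\<^sup>2))"
      using \<sigma> pos by (simp add: power2_eq_square)
    finally show ?thesis .
  qed
  have "(\<integral>\<^sup>+x. ennreal ((normal_density m \<sigma> x)\<^sup>2 / normal_density m' s x) \<partial>lborel)
      = ennreal (sqrt (2 * pi * s\<^sup>2) / (2 * pi * \<sigma>\<^sup>2) * (sqrt (2 * pi / ?A) * exp (?c + ?b\<^sup>2 / (2 * ?A))))"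
    unfolding eq using A by (intro nn_integral_exp_quadratic_cmult) auto
  then show ?thesis by (simp only: e mult.assoc[symmetric] K)
qed

section \<open>Priors as scale mixtures of Gaussian laws with a common eigenbasis\<close>

lemma prob_space_exp1_law: "prob_space exp1_law"
  unfolding exp1_law_def by (rule prob_space_exponential_density) simp

lemma sets_exp1_law [measurable_cong, simp]: "sets exp1_law = sets borel"
  by (simp add: exp1_law_def)

lemma space_exp1_law [simp]: "space exp1_law = UNIV"
  by (simp add: exp1_law_def)

lemma apply_mat_diagonalized:
  assumes "orth_mat n U"
  shows "apply_mat n (diagonalized n U d) z = apply_mat n U (\<lambda>i\<in>{..<n}. d i * coef n U z i)"
proof (rule ext)
  fix i show "apply_mat n (diagonalized n U d) z i = apply_mat n U (\<lambda>i\<in>{..<n}. d i * coef n U z i) i"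
  proof (cases "i < n")
    case True
    have "apply_mat n (diagonalized n U d) z i = (\<Sum>j<n. \<Sum>k<n. U $$ (i, k) * (d k * (U $$ (j, k) * z j)))"
      using True by (simp add: apply_mat_nth index_diagonalized[OF assms] sum_distrib_left sum_distrib_right mult_ac)
    also have "\<dots> = (\<Sum>k<n. \<Sum>j<n. U $$ (i, k) * (d k * (U $$ (j, k) * z j)))"
      by (rule sum.swap)
    also have "\<dots> = (\<Sum>k<n. U $$ (i, k) * (d k * coef n U z k))"
      using orth_matD(1)[OF assms] by (simp add: coef_def apply_mat_nth sum_distrib_left)
    finally show ?thesis using True by (simp add: apply_mat_nth)
  qed (simp add: apply_mat_def)
qed

lemma gaussian_diagonalized:
  assumes "orth_mat n U"
  shows "gaussian n (diagonalized n U v) = distr (data_law n 1 (\<lambda>_. 0)) (fun_space n)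
    (apply_mat n (diagonalized n U (\<lambda>i. sqrt (v i))))"
  by (simp add: gaussian_def data_law_def spectral_fun_diagonalized[OF assms])

lemma measurable_scale_n:
  fixes f :: "'a \<Rightarrow> nat \<Rightarrow> real"
  assumes "\<And>i. (\<lambda>w. f w i) \<in> borel_measurable M" "g \<in> measurable M (fun_space n)"
  shows "(\<lambda>w. \<lambda>i\<in>{..<n}. f w i * g w i) \<in> measurable M (fun_space n)"
proof (rule measurable_restrict)
  fix i assume "i \<in> {..<n}"
  then have "(\<lambda>w. g w i) \<in> borel_measurable M"
    using measurable_compose[OF assms(2) measurable_component_singleton[of i "{..<n}"]] by auto
  then show "(\<lambda>w. f w i * g w i) \<in> borel_measurable M" using assms(1) by simp
qed

text \<open>To integrate against the mixture one needs a measurable kernel. Each Gaussian law is the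
  image of one fixed noise vector under a map that is jointly measurable in \<open>c\<close> and the
  noise, which \<open>measurable_distr2\<close> turns into measurability of the kernel. The integral
  formula has independent standard normals as eigen-coordinates, scaled by
  \<open>sqrt (v c i)\<close>.\<close>

lemma scale_mixture:
  assumes U: "orth_mat n U" and v: "\<And>i. (\<lambda>c. v c i) \<in> borel_measurable borel"
  defines "P \<equiv> exp1_law \<bind> (\<lambda>c. gaussian n (diagonalized n U (v c)))"
  shows sets_scale_mixture: "sets P = sets (fun_space n)"
    and prob_space_scale_mixture: "prob_space P"
    and nn_integral_scale_mixture: "h \<in> borel_measurable (fun_space n) \<Longrightarrow>
      (\<integral>\<^sup>+f. h f \<partial>P) = (\<integral>\<^sup>+c. \<integral>\<^sup>+z. h (apply_mat n U (\<lambda>i\<in>{..<n}. sqrt (v c i) * z i))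
        \<partial>data_law n 1 (\<lambda>_. 0) \<partial>exp1_law)"
proof -
  let ?D = "data_law n 1 (\<lambda>_. 0)"
  interpret E: prob_space exp1_law by (rule prob_space_exp1_law)
  interpret D: prob_space ?D by (rule prob_space_data_law) simp
  note v [measurable]
  let ?T = "\<lambda>c. apply_mat n (diagonalized n U (\<lambda>i. sqrt (v c i)))"
  have T_eq: "?T c z = apply_mat n U (\<lambda>i\<in>{..<n}. sqrt (v c i) * coef n U z i)" for c z
    by (rule apply_mat_diagonalized[OF U])
  have snd: "snd \<in> measurable (exp1_law \<Otimes>\<^sub>M ?D) (fun_space n)"
    using measurable_snd[of exp1_law ?D] by (simp cong: measurable_cong_sets add: sets_data_law)
  have T: "case_prod ?T \<in> measurable (exp1_law \<Otimes>\<^sub>M ?D) (fun_space n)"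
    unfolding T_eq case_prod_beta
    by (intro measurable_compose[OF measurable_scale_n measurable_apply_mat]
        measurable_compose[OF snd measurable_coef]) measurable
  have D: "(\<lambda>c. ?D) \<in> measurable exp1_law (subprob_algebra ?D)"
    by (rule measurable_const) (simp add: space_subprob_algebra D.subprob_space_axioms)
  have K_eq: "gaussian n (diagonalized n U (v c)) = distr ?D (fun_space n) (?T c)" for c
    by (rule gaussian_diagonalized[OF U])
  have K: "(\<lambda>c. gaussian n (diagonalized n U (v c))) \<in> measurable exp1_law (subprob_algebra (fun_space n))"
    unfolding K_eq by (rule measurable_distr2[OF T D])
  show "sets P = sets (fun_space n)"
    unfolding P_def using sets_kernel[OF K] by (intro sets_bind) auto
  have Tc: "?T c \<in> measurable ?D (fun_space n)" for c
    using measurable_Pair2[OF T, of c] by simp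
  show "prob_space P"
    unfolding P_def
  proof (rule E.prob_space_bind[OF _ K])
    show "AE c in exp1_law. prob_space (gaussian n (diagonalized n U (v c)))"
      unfolding K_eq using Tc by (auto intro!: D.prob_space_distr)
  qed
  assume h: "h \<in> borel_measurable (fun_space n)"
  have "(\<integral>\<^sup>+f. h f \<partial>P) = (\<integral>\<^sup>+c. \<integral>\<^sup>+f. h f \<partial>gaussian n (diagonalized n U (v c)) \<partial>exp1_law)"
    unfolding P_def by (rule nn_integral_bind[OF h K])
  also have "\<dots> = (\<integral>\<^sup>+c. \<integral>\<^sup>+z. h (?T c z) \<partial>?D \<partial>exp1_law)"
    unfolding K_eq using h by (intro nn_integral_cong nn_integral_distr[OF Tc]) simp
  also have "\<dots> = (\<integral>\<^sup>+c. \<integral>\<^sup>+z. h (apply_mat n U (\<lambda>i\<in>{..<n}. sqrt (v c i) * z i)) \<partial>?D \<partial>exp1_law)"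
  proof (rule nn_integral_cong)
    fix c
    have "(\<lambda>x. h (apply_mat n U (\<lambda>i\<in>{..<n}. sqrt (v c i) * x i))) \<in> borel_measurable (fun_space n)"
      by (intro measurable_compose[OF measurable_compose[OF measurable_scale_n measurable_apply_mat] h]) auto
    \<comment> \<open>The square root of the covariance first rotates the noise by the transpose of
      \<open>U\<close>; white noise is rotation invariant, so this inner rotation drops out.\<close>
    from nn_integral_data_law_orth[OF orth_mat_transpose[OF U] _ this, of 1]
    show "(\<integral>\<^sup>+z. h (?T c z) \<partial>?D) = (\<integral>\<^sup>+z. h (apply_mat n U (\<lambda>i\<in>{..<n}. sqrt (v c i) * z i)) \<partial>?D)"
      unfolding T_eq coef_def by simp
  qed
  finally show "(\<integral>\<^sup>+f. h f \<partial>P) = (\<integral>\<^sup>+c. \<integral>\<^sup>+z. h (apply_mat n U (\<lambda>i\<in>{..<n}. sqrt (v c i) * z i)) \<partial>?D \<partial>exp1_law)" .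
qed

section \<open>Posterior mass and evidence\<close>

text \<open>The negative moment of the evidence is controlled through
  \<open>2 t w \<le> t\<^sup>2 l + w\<^sup>2 / l\<close>, which for the weight \<open>w\<close> replaces the usual restriction
  of the prior to a small ball around the truth.\<close>

lemma evidence_or_mass:
  assumes M: "prob_space M"
    and l: "l \<in> borel_measurable M" "\<And>\<theta>. l \<theta> \<ge> 0" "AE \<theta> in M. 0 < l \<theta> \<and> l \<theta> \<le> K"
    and w: "w \<in> borel_measurable M" "\<And>\<theta>. 0 \<le> w \<theta>" and W: "0 < W" "ennreal W \<le> (\<integral>\<^sup>+\<theta>. ennreal (w \<theta>) \<partial>M)"
    and A: "A \<in> sets M" and pos: "\<delta> > 0" "\<eta> > 0" "p > 0"
    and post: "\<delta> \<le> measure (bayes M l) A"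
  shows "1 \<le> ennreal (\<eta> / W\<^sup>2 * p) * (\<integral>\<^sup>+\<theta>. ennreal ((w \<theta>)\<^sup>2 / l \<theta>) \<partial>M)
    \<or> 1 \<le> ennreal (1 / (\<delta> * \<eta> * p)) * (\<integral>\<^sup>+\<theta>. indicator A \<theta> * ennreal (l \<theta>) \<partial>M)"
proof -
  interpret prob_space M by (rule M)
  note l(1) [measurable] w(1) [measurable] A [measurable]
  have int_l: "integrable M l"
    by (rule integrable_const_bound[where B = K]) (use l in auto)
  define m where "m = (LINT \<theta>|M. l \<theta>)"
  have m_nn: "(\<integral>\<^sup>+\<theta>. ennreal (l \<theta>) \<partial>M) = ennreal m"
    unfolding m_def using int_l l(2) by (intro nn_integral_eq_integral) auto
  let ?X = "\<integral>\<^sup>+\<theta>. ennreal ((w \<theta>)\<^sup>2 / l \<theta>) \<partial>M" and ?N = "\<integral>\<^sup>+\<theta>. indicator A \<theta> * ennreal (l \<theta>) \<partial>M"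
  show ?thesis
  \<comment> \<open>Here \<open>p\<close> plays the role of the true density at the observed data.
    If the evidence \<open>m\<close> is at least \<eta> p, a posterior mass of \<delta> forces the
    numerator up to \<delta> \<eta> p; if it is smaller, the integral of w^2 / l has to be
    large.\<close>
  proof (cases "\<eta> * p \<le> m")
    case True
    then have m0: "m > 0" using pos by (meson less_le_trans mult_pos_pos)
    have "emeasure (bayes M l) A = (\<integral>\<^sup>+\<theta>. ennreal (l \<theta> / m) * indicator A \<theta> \<partial>M)"
      unfolding bayes_def m_def by (rule emeasure_density) simp_all
    also have "\<dots> = (\<integral>\<^sup>+\<theta>. ennreal (1 / m) * (indicator A \<theta> * ennreal (l \<theta>)) \<partial>M)"
      using m0 l(2) by (intro nn_integral_cong) (auto simp: ennreal_mult[symmetric] split: split_indicator)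
    also have "\<dots> = ennreal (1 / m) * ?N" by (rule nn_integral_cmult) measurable
    finally have e: "emeasure (bayes M l) A = ennreal (1 / m) * ?N" .
    have "?N \<le> (\<integral>\<^sup>+\<theta>. ennreal (l \<theta>) \<partial>M)"
      by (intro nn_integral_mono) (auto split: split_indicator)
    then have "?N \<le> ennreal m" by (simp only: m_nn)
    then obtain N where N: "?N = ennreal N" "N \<ge> 0"
      by (cases ?N) (auto simp: top_unique)
    have "measure (bayes M l) A = N / m"
      using e N m0 by (simp add: measure_def ennreal_mult[symmetric])
    then have "\<delta> \<le> N / m" using post by simp
    then have "\<delta> * m \<le> N" using m0 by (simp add: pos_le_divide_eq)
    moreover have "\<delta> * \<eta> * p \<le> \<delta> * m"
      unfolding mult.assoc using True pos by (intro mult_left_mono) auto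
    ultimately have "\<delta> * \<eta> * p \<le> N" by (rule order_trans[rotated])
    then have "1 \<le> 1 / (\<delta> * \<eta> * p) * N" using pos by (simp add: pos_le_divide_eq)
    then have "1 \<le> ennreal (1 / (\<delta> * \<eta> * p) * N)" by (simp add: ennreal_ge_1)
    moreover have "ennreal (1 / (\<delta> * \<eta> * p)) * ?N = ennreal (1 / (\<delta> * \<eta> * p) * N)"
      unfolding N(1) using N(2) pos by (intro ennreal_mult[symmetric]) auto
    ultimately have "1 \<le> ennreal (1 / (\<delta> * \<eta> * p)) * ?N" by simp
    then show ?thesis ..
  next
    case False
    \<comment> \<open>With m < \<eta> p this choice gives t^2 m <= t W, half of the left side 2 t W.
      The other half must then come from the integral of w^2 / l.\<close>
    define t where "t = W / (\<eta> * p)"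
    have t: "t > 0" using W pos by (simp add: t_def)
    have "ennreal (2 * t * W) = ennreal (2 * t) * ennreal W" using t W by (simp add: ennreal_mult)
    also have "\<dots> \<le> ennreal (2 * t) * (\<integral>\<^sup>+\<theta>. ennreal (w \<theta>) \<partial>M)" using W by (intro mult_left_mono) auto
    also have "\<dots> = (\<integral>\<^sup>+\<theta>. ennreal (2 * t * w \<theta>) \<partial>M)"
      using t w by (simp add: nn_integral_cmult[symmetric] ennreal_mult)
    also have "\<dots> \<le> (\<integral>\<^sup>+\<theta>. ennreal (t\<^sup>2) * ennreal (l \<theta>) + ennreal ((w \<theta>)\<^sup>2 / l \<theta>) \<partial>M)"
    proof (rule nn_integral_mono_AE, use l(3) in eventually_elim)
      fix \<theta> assume *: "0 < l \<theta> \<and> l \<theta> \<le> K"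
      have "0 \<le> (t * l \<theta> - w \<theta>)\<^sup>2 / l \<theta>" using * by simp
      also have "(t * l \<theta> - w \<theta>)\<^sup>2 / l \<theta> = t\<^sup>2 * l \<theta> + (w \<theta>)\<^sup>2 / l \<theta> - 2 * t * w \<theta>"
        using * by (simp add: field_simps power2_eq_square)
      finally have "2 * t * w \<theta> \<le> t\<^sup>2 * l \<theta> + (w \<theta>)\<^sup>2 / l \<theta>" by simp
      then have "ennreal (2 * t * w \<theta>) \<le> ennreal (t\<^sup>2 * l \<theta> + (w \<theta>)\<^sup>2 / l \<theta>)" by (rule ennreal_leI)
      then show "ennreal (2 * t * w \<theta>) \<le> ennreal (t\<^sup>2) * ennreal (l \<theta>) + ennreal ((w \<theta>)\<^sup>2 / l \<theta>)"
        using * by (simp add: ennreal_mult ennreal_plus)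
    qed
    also have "\<dots> = ennreal (t\<^sup>2) * ennreal m + ?X"
      by (simp add: nn_integral_add nn_integral_cmult m_nn)
    also have "ennreal (t\<^sup>2) * ennreal m = ennreal (t\<^sup>2 * m)"
      by (rule ennreal_mult'[symmetric]) simp
    also have "ennreal (t\<^sup>2 * m) \<le> ennreal (t * W)"
    proof (rule ennreal_leI)
      have "t\<^sup>2 * m \<le> t\<^sup>2 * (\<eta> * p)" using False by (intro mult_left_mono) auto
      also have "\<dots> = t * W" using pos by (simp add: t_def power2_eq_square)
      finally show "t\<^sup>2 * m \<le> t * W" .
    qed
    finally have *: "ennreal (2 * t * W) \<le> ennreal (t * W) + ?X" by (simp add: add_right_mono)
    have "ennreal (t * W) \<le> ?X"
    proof (cases ?X)
      case (real x)
      then show ?thesis using * t W by (simp add: ennreal_plus[symmetric] mult.commute del: ennreal_plus)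
    qed simp
    then have "ennreal (\<eta> / W\<^sup>2 * p) * ennreal (t * W) \<le> ennreal (\<eta> / W\<^sup>2 * p) * ?X"
      by (intro mult_left_mono) auto
    moreover have "ennreal (\<eta> / W\<^sup>2 * p) * ennreal (t * W) = ennreal (\<eta> / W\<^sup>2 * p * (t * W))"
      using pos W t by (intro ennreal_mult[symmetric]) auto
    moreover have "\<eta> / W\<^sup>2 * p * (t * W) = 1"
      using W pos by (simp add: t_def power2_eq_square)
    ultimately have "1 \<le> ennreal (\<eta> / W\<^sup>2 * p) * ?X" by (simp only: ennreal_1)
    then show ?thesis ..
  qed
qed

text \<open>The event of large posterior mass is covered by the rejection region \<open>R\<close>,
  by data with too little evidence relative to \<eta> times the true density, and by data outside
  \<open>R\<close> with a large numerator. Multiplied by the true density, the alternatives of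
  \<open>evidence_or_mass\<close> become integrable bounds: the second picks up the square of
  \<open>p0\<close>, as needed for \<open>neg\<close>, and in the third \<open>p0\<close> cancels,
  which leaves the prior predictive mass in \<open>num\<close>. The free parameter \<eta> trades one
  against the other.\<close>

lemma posterior_mass_bound:
  fixes l :: "'a \<Rightarrow> 'b \<Rightarrow> real"
  assumes M: "prob_space M" and L: "sigma_finite_measure L"
    and l: "(\<lambda>(\<theta>, y). l \<theta> y) \<in> borel_measurable (M \<Otimes>\<^sub>M L)" "\<And>\<theta> y. l \<theta> y \<ge> 0"
      "\<And>y. y \<in> space L \<Longrightarrow> AE \<theta> in M. 0 < l \<theta> y \<and> l \<theta> y \<le> K"
    and p0: "p0 \<in> borel_measurable L" "\<And>y. p0 y > 0"
    and w: "w \<in> borel_measurable M" "\<And>\<theta>. 0 \<le> w \<theta>"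
    and W: "0 < W" "ennreal W \<le> (\<integral>\<^sup>+\<theta>. ennreal (w \<theta>) \<partial>M)"
    and A: "A \<in> sets M" and R: "R \<in> sets L" and pos: "\<delta> > 0" "\<eta> > 0"
    and neg: "(\<integral>\<^sup>+\<theta>. ennreal ((w \<theta>)\<^sup>2) * (\<integral>\<^sup>+y. ennreal ((p0 y)\<^sup>2 / l \<theta> y) \<partial>L) \<partial>M) \<le> Cn"
    and num: "(\<integral>\<^sup>+\<theta>. indicator A \<theta> * (\<integral>\<^sup>+y. indicator (space L - R) y * ennreal (l \<theta> y) \<partial>L) \<partial>M) \<le> q"
  shows "emeasure (density L (\<lambda>y. ennreal (p0 y))) {y \<in> space L. \<delta> \<le> measure (bayes M (\<lambda>\<theta>. l \<theta> y)) A}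
    \<le> emeasure (density L (\<lambda>y. ennreal (p0 y))) R + ennreal (\<eta> / W\<^sup>2) * Cn + ennreal (1 / (\<delta> * \<eta>)) * q"
    (is "emeasure ?P ?B \<le> _")
\<comment> \<open>A set that is not measurable has \<open>emeasure\<close> 0 by convention, so the
  bound is trivial for it.\<close>
proof (cases "?B \<in> sets L")
  case False
  then show ?thesis by (simp add: emeasure_notin_sets)
next
  case True
  interpret PL: pair_sigma_finite M L
    using M L by (intro pair_sigma_finite.intro) (auto simp: prob_space_imp_sigma_finite)
  note [measurable] = l(1) p0(1) w(1) A R True
  define X where "X y = (\<integral>\<^sup>+\<theta>. ennreal ((w \<theta>)\<^sup>2 / l \<theta> y) \<partial>M)" for y
  define N where "N y = (\<integral>\<^sup>+\<theta>. indicator A \<theta> * ennreal (l \<theta> y) \<partial>M)" for y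
  have X_meas [measurable]: "X \<in> borel_measurable L" unfolding X_def by measurable
  have N_meas [measurable]: "N \<in> borel_measurable L" unfolding N_def by measurable
  have lm: "(\<lambda>\<theta>. l \<theta> y) \<in> borel_measurable M" if "y \<in> space L" for y
    using measurable_Pair1[OF l(1) that] by simp
  \<comment> \<open>Markov's inequality in pointwise form: off \<open>R\<close>, one of the two
    terms already exceeds the true density.\<close>
  have pw: "indicator ?B y * ennreal (p0 y) \<le> indicator R y * ennreal (p0 y)
      + ennreal (\<eta> / W\<^sup>2) * (ennreal ((p0 y)\<^sup>2) * X y)
      + ennreal (1 / (\<delta> * \<eta>)) * (indicator (space L - R) y * N y)" if y: "y \<in> space L" for y
  proof (cases "y \<in> ?B \<and> y \<notin> R")
    case False
    then show ?thesis by (auto split: split_indicator intro: order_trans[OF _ add_increasing2])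
  next
    case True
    then have "\<delta> \<le> measure (bayes M (\<lambda>\<theta>. l \<theta> y)) A" by simp
    from evidence_or_mass[OF M lm[OF y] l(2) l(3)[OF y] w W A pos p0(2)[of y] this]
    have "1 \<le> ennreal (\<eta> / W\<^sup>2 * p0 y) * X y \<or> 1 \<le> ennreal (1 / (\<delta> * \<eta> * p0 y)) * N y"
      by (simp only: X_def N_def)
    then show ?thesis
    proof
      assume "1 \<le> ennreal (\<eta> / W\<^sup>2 * p0 y) * X y"
      then have "ennreal (p0 y) * 1 \<le> ennreal (p0 y) * (ennreal (\<eta> / W\<^sup>2 * p0 y) * X y)"
        by (intro mult_left_mono) auto
      also have "\<dots> = (ennreal (p0 y) * ennreal (\<eta> / W\<^sup>2 * p0 y)) * X y" by (simp only: mult.assoc)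
      also have "ennreal (p0 y) * ennreal (\<eta> / W\<^sup>2 * p0 y) = ennreal (\<eta> / W\<^sup>2) * ennreal ((p0 y)\<^sup>2)"
        using p0(2)[of y] pos by (simp add: ennreal_mult[symmetric] less_imp_le power2_eq_square mult_ac)
      also have "\<dots> * X y = ennreal (\<eta> / W\<^sup>2) * (ennreal ((p0 y)\<^sup>2) * X y)" by (simp only: mult.assoc)
      finally show ?thesis using True y by (simp add: add_increasing2)
    next
      assume "1 \<le> ennreal (1 / (\<delta> * \<eta> * p0 y)) * N y"
      then have "ennreal (p0 y) * 1 \<le> ennreal (p0 y) * (ennreal (1 / (\<delta> * \<eta> * p0 y)) * N y)"
        by (intro mult_left_mono) auto
      also have "\<dots> = (ennreal (p0 y) * ennreal (1 / (\<delta> * \<eta> * p0 y))) * N y" by (simp only: mult.assoc)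
      also have "ennreal (p0 y) * ennreal (1 / (\<delta> * \<eta> * p0 y)) = ennreal (1 / (\<delta> * \<eta>))"
        using p0(2)[of y] pos by (simp add: ennreal_mult[symmetric] less_imp_le)
      finally show ?thesis using True y by (simp add: add_increasing)
    qed
  qed
  have iX: "(\<integral>\<^sup>+y. ennreal ((p0 y)\<^sup>2) * X y \<partial>L) \<le> Cn"
  proof -
    have "(\<integral>\<^sup>+y. ennreal ((p0 y)\<^sup>2) * X y \<partial>L) = (\<integral>\<^sup>+y. \<integral>\<^sup>+\<theta>. ennreal ((w \<theta>)\<^sup>2) * ennreal ((p0 y)\<^sup>2 / l \<theta> y) \<partial>M \<partial>L)"
    proof (rule nn_integral_cong)
      fix y assume y: "y \<in> space L"
      note [measurable] = lm[OF y]
      have "ennreal ((p0 y)\<^sup>2) * X y = (\<integral>\<^sup>+\<theta>. ennreal ((p0 y)\<^sup>2) * ennreal ((w \<theta>)\<^sup>2 / l \<theta> y) \<partial>M)"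
        unfolding X_def by (rule nn_integral_cmult[symmetric]) measurable
      also have "\<dots> = (\<integral>\<^sup>+\<theta>. ennreal ((w \<theta>)\<^sup>2) * ennreal ((p0 y)\<^sup>2 / l \<theta> y) \<partial>M)"
        using l(2) by (intro nn_integral_cong) (simp add: ennreal_mult[symmetric])
      finally show "ennreal ((p0 y)\<^sup>2) * X y = (\<integral>\<^sup>+\<theta>. ennreal ((w \<theta>)\<^sup>2) * ennreal ((p0 y)\<^sup>2 / l \<theta> y) \<partial>M)" .
    qed
    also have "\<dots> = (\<integral>\<^sup>+\<theta>. \<integral>\<^sup>+y. ennreal ((w \<theta>)\<^sup>2) * ennreal ((p0 y)\<^sup>2 / l \<theta> y) \<partial>L \<partial>M)"
      by (rule PL.Fubini') measurable
    also have "\<dots> = (\<integral>\<^sup>+\<theta>. ennreal ((w \<theta>)\<^sup>2) * (\<integral>\<^sup>+y. ennreal ((p0 y)\<^sup>2 / l \<theta> y) \<partial>L) \<partial>M)"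
    proof (rule nn_integral_cong)
      fix \<theta> assume "\<theta> \<in> space M"
      from measurable_Pair2[OF l(1) this] have [measurable]: "(\<lambda>y. l \<theta> y) \<in> borel_measurable L" by simp
      show "(\<integral>\<^sup>+y. ennreal ((w \<theta>)\<^sup>2) * ennreal ((p0 y)\<^sup>2 / l \<theta> y) \<partial>L)
          = ennreal ((w \<theta>)\<^sup>2) * (\<integral>\<^sup>+y. ennreal ((p0 y)\<^sup>2 / l \<theta> y) \<partial>L)"
        by (rule nn_integral_cmult) measurable
    qed
    also have "\<dots> \<le> Cn" by (rule neg)
    finally show ?thesis .
  qed
  have iN: "(\<integral>\<^sup>+y. indicator (space L - R) y * N y \<partial>L) \<le> q"
  proof -
    have "(\<integral>\<^sup>+y. indicator (space L - R) y * N y \<partial>L)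
        = (\<integral>\<^sup>+y. \<integral>\<^sup>+\<theta>. indicator A \<theta> * (indicator (space L - R) y * ennreal (l \<theta> y)) \<partial>M \<partial>L)"
    proof (rule nn_integral_cong)
      fix y assume y: "y \<in> space L"
      note [measurable] = lm[OF y]
      have "indicator (space L - R) y * N y
          = (\<integral>\<^sup>+\<theta>. indicator (space L - R) y * (indicator A \<theta> * ennreal (l \<theta> y)) \<partial>M)"
        unfolding N_def by (rule nn_integral_cmult[symmetric]) measurable
      then show "indicator (space L - R) y * N y
          = (\<integral>\<^sup>+\<theta>. indicator A \<theta> * (indicator (space L - R) y * ennreal (l \<theta> y)) \<partial>M)"
        by (simp add: mult_ac)
    qed
    also have "\<dots> = (\<integral>\<^sup>+\<theta>. \<integral>\<^sup>+y. indicator A \<theta> * (indicator (space L - R) y * ennreal (l \<theta> y)) \<partial>L \<partial>M)"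
      by (rule PL.Fubini') measurable
    also have "\<dots> = (\<integral>\<^sup>+\<theta>. indicator A \<theta> * (\<integral>\<^sup>+y. indicator (space L - R) y * ennreal (l \<theta> y) \<partial>L) \<partial>M)"
    proof (rule nn_integral_cong)
      fix \<theta> assume "\<theta> \<in> space M"
      from measurable_Pair2[OF l(1) this] have [measurable]: "(\<lambda>y. l \<theta> y) \<in> borel_measurable L" by simp
      show "(\<integral>\<^sup>+y. indicator A \<theta> * (indicator (space L - R) y * ennreal (l \<theta> y)) \<partial>L)
          = indicator A \<theta> * (\<integral>\<^sup>+y. indicator (space L - R) y * ennreal (l \<theta> y) \<partial>L)"
        by (rule nn_integral_cmult) measurable
    qed
    also have "\<dots> \<le> q" by (rule num)
    finally show ?thesis .
  qed
  have "emeasure ?P ?B = (\<integral>\<^sup>+y. indicator ?B y * ennreal (p0 y) \<partial>L)"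
    by (subst emeasure_density) (simp_all add: mult.commute)
  also have "\<dots> \<le> (\<integral>\<^sup>+y. indicator R y * ennreal (p0 y)
      + ennreal (\<eta> / W\<^sup>2) * (ennreal ((p0 y)\<^sup>2) * X y)
      + ennreal (1 / (\<delta> * \<eta>)) * (indicator (space L - R) y * N y) \<partial>L)"
    by (rule nn_integral_mono) (rule pw)
  also have "\<dots> = (\<integral>\<^sup>+y. indicator R y * ennreal (p0 y) \<partial>L)
      + ennreal (\<eta> / W\<^sup>2) * (\<integral>\<^sup>+y. ennreal ((p0 y)\<^sup>2) * X y \<partial>L)
      + ennreal (1 / (\<delta> * \<eta>)) * (\<integral>\<^sup>+y. indicator (space L - R) y * N y \<partial>L)"
    by (simp add: nn_integral_add nn_integral_cmult)
  also have "(\<integral>\<^sup>+y. indicator R y * ennreal (p0 y) \<partial>L) = emeasure ?P R"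
    by (subst emeasure_density) (simp_all add: mult.commute)
  also have "emeasure ?P R + ennreal (\<eta> / W\<^sup>2) * (\<integral>\<^sup>+y. ennreal ((p0 y)\<^sup>2) * X y \<partial>L)
      + ennreal (1 / (\<delta> * \<eta>)) * (\<integral>\<^sup>+y. indicator (space L - R) y * N y \<partial>L)
    \<le> emeasure ?P R + ennreal (\<eta> / W\<^sup>2) * Cn + ennreal (1 / (\<delta> * \<eta>)) * q"
    by (intro add_mono mult_left_mono iX iN) auto
  finally show ?thesis .
qed

section \<open>Likelihood ratios and the chi-square test\<close>

lemma measurable_likelihood_joint:
  assumes "f \<in> measurable M (fun_space n)" "g \<in> measurable M (fun_space n)" "s \<in> borel_measurable M"
  shows "(\<lambda>w. likelihood n (s w) (f w) (g w)) \<in> borel_measurable M"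
  unfolding likelihood_def
proof (rule borel_measurable_prod)
  fix i assume "i \<in> {..<n}"
  then have [measurable]: "(\<lambda>w. f w i) \<in> borel_measurable M" "(\<lambda>w. g w i) \<in> borel_measurable M"
    using measurable_compose[OF assms(1) measurable_component_singleton[of i "{..<n}"]]
      measurable_compose[OF assms(2) measurable_component_singleton[of i "{..<n}"]] by auto
  note [measurable] = assms(3)
  show "(\<lambda>w. normal_density (f w i) (s w) (g w i)) \<in> borel_measurable M"
    unfolding normal_density_def by measurable
qed

text \<open>The prefactor equals 1 at s = \<sigma>, but for other \<open>s\<close> it is raised to
  the power \<open>n\<close>; this is what restricts the evidence bound to standard deviations very
  close to the true one.\<close>

lemma nn_integral_likelihood_ratio:
  assumes s: "s > 0" and \<sigma>: "\<sigma> > 0" and less: "\<sigma>\<^sup>2 < 2 * s\<^sup>2"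
  shows "(\<integral>\<^sup>+y. ennreal ((likelihood n \<sigma> f0 y)\<^sup>2 / likelihood n s f y) \<partial>lborel_n n)
    = ennreal ((s\<^sup>2 / (\<sigma> * sqrt (2 * s\<^sup>2 - \<sigma>\<^sup>2))) ^ n * exp ((\<Sum>i<n. (f i - f0 i)\<^sup>2) / (2 * s\<^sup>2 - \<sigma>\<^sup>2)))"
proof -
  have "(\<integral>\<^sup>+y. ennreal ((likelihood n \<sigma> f0 y)\<^sup>2 / likelihood n s f y) \<partial>lborel_n n)
      = (\<integral>\<^sup>+y. (\<Prod>i<n. ennreal ((normal_density (f0 i) \<sigma> (y i))\<^sup>2 / normal_density (f i) s (y i))) \<partial>lborel_n n)"
    unfolding likelihood_def
    by (intro nn_integral_cong) (simp add: prod_ennreal prod_dividef prod_power_distrib)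
  also have "\<dots> = (\<Prod>i<n. \<integral>\<^sup>+x. ennreal ((normal_density (f0 i) \<sigma> x)\<^sup>2 / normal_density (f i) s x) \<partial>lborel)"
    by (rule lborel_PiM.product_nn_integral_prod) auto
  also have "\<dots> = (\<Prod>i<n. ennreal (s\<^sup>2 / (\<sigma> * sqrt (2 * s\<^sup>2 - \<sigma>\<^sup>2)) * exp ((f i - f0 i)\<^sup>2 / (2 * s\<^sup>2 - \<sigma>\<^sup>2))))"
    by (simp only: normal_square_ratio[OF s \<sigma> less])
  also have "\<dots> = ennreal (\<Prod>i<n. s\<^sup>2 / (\<sigma> * sqrt (2 * s\<^sup>2 - \<sigma>\<^sup>2)) * exp ((f i - f0 i)\<^sup>2 / (2 * s\<^sup>2 - \<sigma>\<^sup>2)))"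
    using less \<sigma> by (intro prod_ennreal) auto
  also have "(\<Prod>i<n. s\<^sup>2 / (\<sigma> * sqrt (2 * s\<^sup>2 - \<sigma>\<^sup>2)) * exp ((f i - f0 i)\<^sup>2 / (2 * s\<^sup>2 - \<sigma>\<^sup>2)))
      = (s\<^sup>2 / (\<sigma> * sqrt (2 * s\<^sup>2 - \<sigma>\<^sup>2))) ^ n * exp ((\<Sum>i<n. (f i - f0 i)\<^sup>2) / (2 * s\<^sup>2 - \<sigma>\<^sup>2))"
    unfolding prod.distrib by (simp add: exp_sum[symmetric] sum_divide_distrib)
  finally show ?thesis .
qed

text \<open>With \<rho> = s^2 / \<sigma>^2 the squared prefactor is 1 + (\<rho> - 1)^2 / (2 \<rho> -
  1), so a deviation of order 1/n in \<rho> keeps it below 1 + 1/n and its n-th power below e <= 4.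
  For n >= 2 the window also gives \<rho> >= 3/4, whence the lower bound on 2 s^2 -
  \<sigma>^2.\<close>

lemma ratio_constant_le_2:
  fixes s \<sigma> :: real
  assumes n: "n \<ge> 2" and s: "s > 0" and \<sigma>: "\<sigma> > 0" and near: "\<bar>s\<^sup>2 / \<sigma>\<^sup>2 - 1\<bar> \<le> 1 / (2 * real n)"
  shows "2 * s\<^sup>2 - \<sigma>\<^sup>2 \<ge> \<sigma>\<^sup>2 / 2" "(s\<^sup>2 / (\<sigma> * sqrt (2 * s\<^sup>2 - \<sigma>\<^sup>2))) ^ n \<le> 2"
proof -
  define \<rho> where "\<rho> = s\<^sup>2 / \<sigma>\<^sup>2"
  have s2: "s\<^sup>2 = \<rho> * \<sigma>\<^sup>2" using \<sigma> by (simp add: \<rho>_def)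
  have near': "\<bar>\<rho> - 1\<bar> \<le> 1 / (2 * real n)" using near by (simp add: \<rho>_def)
  have "1 / (2 * real n) \<le> 1 / 4" using n by (simp add: field_simps)
  then have \<rho>: "\<rho> \<ge> 3 / 4" using near' by linarith
  have "(2 * \<rho> - 1) * \<sigma>\<^sup>2 \<ge> 1 / 2 * \<sigma>\<^sup>2" using \<rho> by (intro mult_right_mono) auto
  then show ge: "2 * s\<^sup>2 - \<sigma>\<^sup>2 \<ge> \<sigma>\<^sup>2 / 2" by (simp add: s2 algebra_simps)
  then have pos: "2 * s\<^sup>2 - \<sigma>\<^sup>2 > 0" using \<sigma> zero_less_power[OF \<sigma>, of 2] by linarith
  let ?K = "s\<^sup>2 / (\<sigma> * sqrt (2 * s\<^sup>2 - \<sigma>\<^sup>2))"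
  have "?K\<^sup>2 = (s\<^sup>2)\<^sup>2 / (\<sigma>\<^sup>2 * (2 * s\<^sup>2 - \<sigma>\<^sup>2))"
    using pos by (simp add: power_divide power_mult_distrib)
  also have "\<dots> = \<rho>\<^sup>2 / (2 * \<rho> - 1)"
  proof -
    have "(s\<^sup>2)\<^sup>2 / (\<sigma>\<^sup>2 * (2 * s\<^sup>2 - \<sigma>\<^sup>2)) = (\<rho>\<^sup>2 * (\<sigma>\<^sup>2 * \<sigma>\<^sup>2)) / ((2 * \<rho> - 1) * (\<sigma>\<^sup>2 * \<sigma>\<^sup>2))"
      unfolding s2 by (simp add: power2_eq_square algebra_simps)
    then show ?thesis using \<sigma> by simp
  qed
  also have "\<dots> \<le> 1 + 1 / real n"
  proof -
    have "(\<rho> - 1)\<^sup>2 \<le> (1 / (2 * real n))\<^sup>2" using near' by (metis abs_ge_zero power2_abs power_mono)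
    also have "\<dots> \<le> 1 / (2 * real n)"
      using n by (simp add: power2_eq_square field_simps)
    finally have "\<rho>\<^sup>2 \<le> 2 * \<rho> - 1 + 1 / (2 * real n)" by (simp add: power2_eq_square algebra_simps)
    also have "1 / (2 * real n) \<le> (2 * \<rho> - 1) * (1 / real n)"
    proof -
      have "1 / 2 * (1 / real n) \<le> (2 * \<rho> - 1) * (1 / real n)" using \<rho> by (intro mult_right_mono) auto
      then show ?thesis by simp
    qed
    finally have "\<rho>\<^sup>2 \<le> (1 + 1 / real n) * (2 * \<rho> - 1)" by (simp add: algebra_simps)
    then show ?thesis using \<rho> by (simp add: divide_le_eq)
  qed
  finally have K2: "?K\<^sup>2 \<le> 1 + 1 / real n" .
  have "(?K ^ n)\<^sup>2 = (?K\<^sup>2) ^ n" by (simp flip: power_mult add: mult.commute)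
  also have "\<dots> \<le> (1 + 1 / real n) ^ n" using K2 by (intro power_mono) auto
  also have "\<dots> \<le> exp (1 / real n) ^ n" by (intro power_mono exp_ge_add_one_self) auto
  also have "\<dots> = exp 1" using n by (simp flip: exp_of_nat_mult)
  also have "\<dots> \<le> 2\<^sup>2" using e_less_272 by simp
  finally show "?K ^ n \<le> 2" by (rule power2_le_imp_le) simp
qed

text \<open>Chernoff bound at the exponent 1 / (4 s^2), half the critical value 1 / (2 s^2), so that
  each coordinate in \<open>H\<close> contributes a factor sqrt 2. Passing from \<open>s\<close> to
  its upper bound \<open>b\<close> makes the level of the test uniform over the support of the prior
  on \<sigma>.\<close>

lemma chi_square_tail:
  assumes U: "orth_mat n U" and s: "s > 0" "s \<le> b" and H: "H \<subseteq> {..<n}" and x: "x \<ge> 0"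
  shows "emeasure (data_law n s f) {y \<in> space (data_law n s f). x \<le> (\<Sum>i\<in>H. (coef n U (\<lambda>j. y j - f j) i)\<^sup>2)}
    \<le> ennreal (exp (- x / (4 * b\<^sup>2)) * sqrt 2 ^ card H)" (is "emeasure _ ?S \<le> _")
proof (cases "?S \<in> sets (data_law n s f)")
  case False
  then show ?thesis by (simp add: emeasure_notin_sets)
next
  case True
  have fin: "finite H" using H finite_subset by blast
  let ?t = "1 / (4 * s\<^sup>2)"
  define h where "h i z = (if i \<in> H then ennreal (exp (?t * z\<^sup>2)) else 1)" for i and z :: real
  have h [measurable]: "h i \<in> borel_measurable borel" for i unfolding h_def by measurable
  have gm: "(\<lambda>z. ennreal (exp (- ?t * x)) * (\<Prod>i<n. h i (z i))) \<in> borel_measurable (fun_space n)"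
    by measurable
  have bound: "indicator ?S y \<le> ennreal (exp (- ?t * x)) * (\<Prod>i<n. h i (coef n U (\<lambda>j. y j - f j) i))" for y
  proof (cases "y \<in> ?S")
    case True
    let ?c = "coef n U (\<lambda>j. y j - f j)"
    have "(\<Prod>i<n. h i (?c i)) = (\<Prod>i\<in>H. ennreal (exp (?t * (?c i)\<^sup>2)))"
      unfolding h_def using H by (subst prod.If_cases) (auto simp: Int_absorb1 Int_absorb2 Int_commute)
    also have "\<dots> = ennreal (exp (\<Sum>i\<in>H. ?t * (?c i)\<^sup>2))"
      using fin by (simp add: prod_ennreal exp_sum)
    finally have "ennreal (exp (- ?t * x)) * (\<Prod>i<n. h i (?c i))
        = ennreal (exp (- ?t * x) * exp (?t * (\<Sum>i\<in>H. (?c i)\<^sup>2)))"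
      by (simp only: sum_distrib_left) (simp add: ennreal_mult)
    also have "exp (- ?t * x) * exp (?t * (\<Sum>i\<in>H. (?c i)\<^sup>2)) = exp (?t * ((\<Sum>i\<in>H. (?c i)\<^sup>2) - x))"
      by (simp add: right_diff_distrib diff_divide_distrib flip: exp_add)
    finally have "ennreal (exp (- ?t * x)) * (\<Prod>i<n. h i (?c i)) = ennreal (exp (?t * ((\<Sum>i\<in>H. (?c i)\<^sup>2) - x)))" .
    moreover have "1 \<le> exp (?t * ((\<Sum>i\<in>H. (?c i)\<^sup>2) - x))" using True s by simp
    ultimately show ?thesis using True by (simp add: ennreal_ge_1)
  qed simp
  have "emeasure (data_law n s f) ?S = (\<integral>\<^sup>+y. indicator ?S y \<partial>data_law n s f)" using True by simp
  also have "\<dots> \<le> (\<integral>\<^sup>+y. ennreal (exp (- ?t * x)) * (\<Prod>i<n. h i (coef n U (\<lambda>j. y j - f j) i)) \<partial>data_law n s f)"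
    by (rule nn_integral_mono) (rule bound)
  also have "\<dots> = (\<integral>\<^sup>+z. ennreal (exp (- ?t * x)) * (\<Prod>i<n. h i (z i)) \<partial>data_law n s (\<lambda>_. 0))"
    using nn_integral_data_law_coef[OF U s(1) gm] .
  also have "\<dots> = ennreal (exp (- ?t * x)) * (\<integral>\<^sup>+z. (\<Prod>i<n. h i (z i)) \<partial>data_law n s (\<lambda>_. 0))"
    by (rule nn_integral_cmult) (simp add: measurable_cong_sets[OF sets_data_law refl])
  also have "(\<integral>\<^sup>+z. (\<Prod>i<n. h i (z i)) \<partial>data_law n s (\<lambda>_. 0))
      = (\<Prod>i<n. \<integral>\<^sup>+z. ennreal (normal_density 0 s z) * h i z \<partial>lborel)"
    by (rule nn_integral_data_law_prod[OF s(1) h])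
  also have "\<dots> = (\<Prod>i<n. if i \<in> H then ennreal (sqrt 2) else 1)"
  proof (intro prod.cong refl)
    fix i
    have "2 * ?t * s\<^sup>2 = 1 / 2" using s by simp
    then show "(\<integral>\<^sup>+z. ennreal (normal_density 0 s z) * h i z \<partial>lborel) = (if i \<in> H then ennreal (sqrt 2) else 1)"
      using normal_exp_square[OF s(1), of ?t] s
      by (simp add: h_def nn_integral_normal_density real_sqrt_divide real_div_sqrt)
  qed
  also have "\<dots> = ennreal (sqrt 2 ^ card H)"
    using H by (subst prod.If_cases) (auto simp: Int_absorb1 Int_absorb2 Int_commute ennreal_power)
  also have "ennreal (exp (- ?t * x)) * ennreal (sqrt 2 ^ card H) = ennreal (exp (- ?t * x) * sqrt 2 ^ card H)"
    by (simp add: ennreal_mult)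
  also have "\<dots> \<le> ennreal (exp (- x / (4 * b\<^sup>2)) * sqrt 2 ^ card H)"
  proof (intro ennreal_leI mult_right_mono)
    have "x / (4 * b\<^sup>2) \<le> x / (4 * s\<^sup>2)"
      using s x by (intro divide_left_mono) (auto simp: power_mono)
    then show "exp (- ?t * x) \<le> exp (- x / (4 * b\<^sup>2))" by simp
  qed simp
  finally show ?thesis .
qed

lemma pair_measure_return:
  assumes P: "prob_space P" and x: "x \<in> space N"
  shows "P \<Otimes>\<^sub>M return N x = distr P (P \<Otimes>\<^sub>M N) (\<lambda>f. (f, x))"
proof (rule measure_eqI)
  show "sets (P \<Otimes>\<^sub>M return N x) = sets (distr P (P \<Otimes>\<^sub>M N) (\<lambda>f. (f, x)))"
    by (simp cong: sets_pair_measure_cong)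
  fix X assume "X \<in> sets (P \<Otimes>\<^sub>M return N x)"
  then have X [measurable]: "X \<in> sets (P \<Otimes>\<^sub>M N)" by (simp cong: sets_pair_measure_cong)
  interpret R: prob_space "return N x" by (rule prob_space_return[OF x])
  have m: "(\<lambda>f. (f, x)) \<in> measurable P (P \<Otimes>\<^sub>M N)" using x by measurable
  have "emeasure (P \<Otimes>\<^sub>M return N x) X = (\<integral>\<^sup>+f. \<integral>\<^sup>+s. indicator X (f, s) \<partial>return N x \<partial>P)"
    by (rule R.emeasure_pair_measure) (simp cong: sets_pair_measure_cong)
  also have "\<dots> = (\<integral>\<^sup>+f. indicator X (f, x) \<partial>P)"
    using x by (intro nn_integral_cong nn_integral_return) (auto intro!: borel_measurable_indicator)
  also have "\<dots> = (\<integral>\<^sup>+z. indicator X z \<partial>distr P (P \<Otimes>\<^sub>M N) (\<lambda>f. (f, x)))"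
    by (rule nn_integral_distr[symmetric, OF m]) simp
  also have "\<dots> = emeasure (distr P (P \<Otimes>\<^sub>M N) (\<lambda>f. (f, x))) X" by simp
  finally show "emeasure (P \<Otimes>\<^sub>M return N x) X = emeasure (distr P (P \<Otimes>\<^sub>M N) (\<lambda>f. (f, x))) X" .
qed

lemma measurable_likelihood_prior:
  assumes "sets P = sets (fun_space n)" "y \<in> space (fun_space n)" "sets Q = sets borel"
  shows "(\<lambda>(f, s). likelihood n s f y) \<in> borel_measurable (P \<Otimes>\<^sub>M Q)"
proof -
  have "fst \<in> measurable (P \<Otimes>\<^sub>M Q) (fun_space n)" "snd \<in> measurable (P \<Otimes>\<^sub>M Q) borel"
    using measurable_fst[of P Q] measurable_snd[of P Q] measurable_cong_sets[OF refl assms(1)]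
      measurable_cong_sets[OF refl assms(3)] by auto
  then show ?thesis
    unfolding case_prod_beta using assms(2)
    by (intro measurable_likelihood_joint) auto
qed

lemma measure_posterior_unknown_var:
  assumes "sets P = sets (fun_space n)" "A \<in> sets P"
  shows "measure (posterior_unknown_var Q n P y) A
    = measure (bayes (P \<Otimes>\<^sub>M Q) (\<lambda>(f, s). likelihood n s f y)) (fst -` A \<inter> space (P \<Otimes>\<^sub>M Q))"
proof -
  have "fst \<in> measurable (bayes (P \<Otimes>\<^sub>M Q) (\<lambda>(f, s). likelihood n s f y)) P"
    by (simp add: bayes_def)
  then show ?thesis
    unfolding posterior_unknown_var_def using assms(2) by (subst measure_distr) (simp_all add: bayes_def)
qed

text \<open>The product with a point mass is the image of the prior under f -> (f, \<sigma>). Bayes'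
  formula commutes with this image because numerator and normalising constant are both integrals of
  the likelihood along it.\<close>

lemma posterior_known_var_eq:
  assumes P: "prob_space P" "sets P = sets (fun_space n)" and y: "y \<in> space (fun_space n)"
    and A: "A \<in> sets P"
  shows "measure (posterior_known_var \<sigma> n P y) A = measure (posterior_unknown_var (return borel \<sigma>) n P y) A"
proof -
  let ?D = "P \<Otimes>\<^sub>M return borel \<sigma>" and ?l = "\<lambda>(f, s). likelihood n s f y" and ?g = "\<lambda>f. (f, \<sigma>)"
  have D: "?D = distr P (P \<Otimes>\<^sub>M borel) ?g" by (rule pair_measure_return) (auto intro: P)
  have g [measurable]: "?g \<in> measurable P (P \<Otimes>\<^sub>M borel)" by measurable
  have l [measurable]: "?l \<in> borel_measurable (P \<Otimes>\<^sub>M borel)"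
    by (rule measurable_likelihood_prior[OF P(2) y]) simp
  have lg: "(\<lambda>f. likelihood n \<sigma> f y) \<in> borel_measurable P"
    using measurable_compose[OF g l] by simp
  have Z: "(LINT \<theta>|?D. ?l \<theta>) = (LINT f|P. likelihood n \<sigma> f y)"
    unfolding D using integral_distr[OF g l] by simp
  note [measurable] = A lg
  let ?h = "\<lambda>\<theta>. ennreal (?l \<theta> / (LINT \<theta>|?D. ?l \<theta>))"
  have h: "?h \<in> borel_measurable (P \<Otimes>\<^sub>M borel)" by measurable
  have A': "fst -` A \<inter> space (P \<Otimes>\<^sub>M borel) \<in> sets (P \<Otimes>\<^sub>M borel)" by measurable
  have "emeasure (bayes ?D ?l) (fst -` A \<inter> space ?D)
      = (\<integral>\<^sup>+\<theta>. ?h \<theta> * indicator (fst -` A \<inter> space ?D) \<theta> \<partial>?D)"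
    unfolding bayes_def using h A' by (intro emeasure_density) (simp_all add: D)
  also have "\<dots> = (\<integral>\<^sup>+\<theta>. ?h \<theta> * indicator (fst -` A \<inter> space (P \<Otimes>\<^sub>M borel)) \<theta> \<partial>distr P (P \<Otimes>\<^sub>M borel) ?g)"
    by (simp add: D)
  also have "\<dots> = (\<integral>\<^sup>+f. ?h (?g f) * indicator (fst -` A \<inter> space (P \<Otimes>\<^sub>M borel)) (?g f) \<partial>P)"
    using h A' by (intro nn_integral_distr[OF g]) simp
  also have "\<dots> = (\<integral>\<^sup>+f. ennreal (likelihood n \<sigma> f y / (LINT f|P. likelihood n \<sigma> f y)) * indicator A f \<partial>P)"
    by (intro nn_integral_cong) (auto simp: Z space_pair_measure split: split_indicator)
  also have "\<dots> = emeasure (posterior_known_var \<sigma> n P y) A"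
    unfolding posterior_known_var_def bayes_def by (rule emeasure_density[symmetric]) measurable
  finally show ?thesis
    unfolding measure_posterior_unknown_var[OF P(2) A] by (simp add: measure_def)
qed

lemma measurable_coef_sum:
  "H \<subseteq> {..<n} \<Longrightarrow> (\<lambda>f. \<Sum>i\<in>H. (coef n U f i)\<^sup>2) \<in> borel_measurable (fun_space n)"
  by (intro borel_measurable_sum borel_measurable_power measurable_coef_nth) auto

lemma measurable_coef_diff_sum:
  assumes "H \<subseteq> {..<n}"
  shows "(\<lambda>f. \<Sum>i\<in>H. (coef n U (\<lambda>j. f j - g j) i)\<^sup>2) \<in> borel_measurable (fun_space n)"
proof -
  have "(\<lambda>f. \<Sum>i\<in>H. (coef n U (\<lambda>j. f j - g j) i)\<^sup>2) = (\<lambda>f. \<Sum>i\<in>H. (coef n U f i - coef n U g i)\<^sup>2)"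
    using assms by (intro ext sum.cong refl) (auto simp: coef_diff)
  moreover have "\<dots> \<in> borel_measurable (fun_space n)"
    using assms by (intro borel_measurable_sum borel_measurable_power borel_measurable_diff measurable_coef_nth) auto
  ultimately show ?thesis by simp
qed

text \<open>The nonasymptotic core. For \<open>f\<close> in \<open>A\<close>, either its high
  frequencies carry more than M' k, which is rare under the prior, or the low frequencies of f - f0
  carry at least 4 K k, and then the low frequencies of the data cannot be within K k of both f and
  f0. The inequality (u - v)^2 <= 2 u^2 + 2 v^2 is applied twice, to the high frequencies of f - f0
  and to f - f0 seen through the data; this gives the condition on \<open>M2\<close>. The three
  summands of the bound are the error of the test at the truth, the failure of the evidence, and the
  prior predictive mass of \<open>A\<close> where the test accepts.\<close>

lemma contraction_bound:
  fixes k :: real and n :: nat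
  assumes U: "orth_mat n U" and P: "prob_space P" "sets P = sets (fun_space n)" and n: "n \<ge> 2"
    and Q: "prob_space Q" "sets Q = sets borel" "AE s in Q. a \<le> s \<and> s \<le> b"
    and a: "0 < a" and \<sigma>: "0 < \<sigma>" "\<sigma> \<le> b"
    and J: "ennreal qJ \<le> emeasure Q {s. a \<le> s \<and> s \<le> b \<and> \<bar>s\<^sup>2 / \<sigma>\<^sup>2 - 1\<bar> \<le> 1 / (2 * real n)}" "qJ > 0"
    and W: "W > 0" "ennreal W \<le> (\<integral>\<^sup>+f. ennreal (exp (- (1 / \<sigma>\<^sup>2) * (\<Sum>i<n. (f i - f0 i)\<^sup>2))) \<partial>P)"
    and k: "k \<ge> 1"
    and tail0: "(\<Sum>i\<in>{i. i < n \<and> k \<le> real i}. (coef n U f0 i)\<^sup>2) \<le> B * k"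
    and tailP: "emeasure P {f \<in> space P. M' * k < (\<Sum>i\<in>{i. i < n \<and> k \<le> real i}. (coef n U f i)\<^sup>2)} \<le> ennreal t" "t \<ge> 0"
    and M2: "M2 \<ge> 2 * M' + 2 * B + 4 * K" and K: "K \<ge> 0"
    and pos: "\<delta> > 0" "\<eta> > 0"
    and A: "A = {f \<in> space (fun_space n). M2 * k \<le> (\<Sum>i<n. (f i - f0 i)\<^sup>2)}"
    and chi: "\<chi> = exp (- K * k / (4 * b\<^sup>2)) * exp k"
  shows "measure (data_law n \<sigma> f0) {y \<in> space (data_law n \<sigma> f0). \<delta> \<le> measure (posterior_unknown_var Q n P y) A}
    \<le> \<chi> + 2 * \<eta> / (qJ * W)\<^sup>2 + (t + \<chi>) / (\<delta> * \<eta>)"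
proof -
  interpret P: prob_space P by (rule P(1))
  interpret Q: prob_space Q by (rule Q(1))
  interpret PQ: pair_prob_space P Q ..
  let ?L = "lborel_n n" and ?M = "P \<Otimes>\<^sub>M Q"
  define l where "l \<theta> y = likelihood n (snd \<theta>) (fst \<theta>) y" for \<theta> :: "(nat \<Rightarrow> real) \<times> real" and y
  define H where "H = {i. i < n \<and> real i < k}"
  define T where "T = {i. i < n \<and> k \<le> real i}"
  have H: "H \<subseteq> {..<n}" and Tn: "T \<subseteq> {..<n}" and HT: "H \<inter> T = {}" "H \<union> T = {..<n}"
    by (auto simp: H_def T_def)
  have fin: "finite H" "finite T" using H Tn finite_subset by blast+
  \<comment> \<open>Rounding up costs at most 1 <= k. Since sqrt 2 <= exp (1/2), the moment factor
    of the test is then at most exp k, the second factor of \<chi>.\<close>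
  have cardH: "real (card H) \<le> 2 * k"
  proof -
    have "H \<subseteq> {..<nat \<lceil>k\<rceil>}" by (auto simp: H_def) (use le_of_int_ceiling[of k] in linarith)
    then have "card H \<le> nat \<lceil>k\<rceil>" using card_mono[of "{..<nat \<lceil>k\<rceil>}" H] by simp
    then show ?thesis using k by linarith
  qed
  have chiH: "exp (- (K * k) / (4 * b\<^sup>2)) * sqrt 2 ^ card H \<le> \<chi>"
  proof -
    have "sqrt 2 \<le> exp (1 / 2)"
    proof (rule power2_le_imp_le)
      show "(sqrt 2)\<^sup>2 \<le> (exp (1 / 2 :: real))\<^sup>2"
        using exp_ge_add_one_self[of 1] by (simp flip: exp_double)
    qed simp
    then have "sqrt 2 ^ card H \<le> exp (1 / 2) ^ card H" by (intro power_mono) auto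
    also have "\<dots> = exp (real (card H) / 2)" by (simp flip: exp_of_nat_mult)
    also have "\<dots> \<le> exp k" using cardH by simp
    finally show ?thesis unfolding chi by (simp add: mult_left_mono)
  qed
  have chi0: "\<chi> \<ge> 0" by (simp add: chi)
  have b: "b > 0" using \<sigma> by simp
  have fstM: "fst \<in> measurable ?M (fun_space n)" and sndM: "snd \<in> borel_measurable ?M"
    using measurable_fst[of P Q] measurable_snd[of P Q] measurable_cong_sets[OF refl P(2)]
      measurable_cong_sets[OF refl Q(2)] by auto
  have spP: "space P = space (fun_space n)" using P(2) by (rule sets_eq_imp_space_eq)
  have spQ: "space Q = UNIV" using sets_eq_imp_space_eq[OF Q(2)] by simp
  have AE_s: "AE \<theta> in ?M. a \<le> snd \<theta> \<and> snd \<theta> \<le> b"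
  proof (rule PQ.AE_pair_measure)
    show "{\<theta> \<in> space ?M. a \<le> snd \<theta> \<and> snd \<theta> \<le> b} \<in> sets ?M" using sndM by measurable
    show "AE f in P. AE s in Q. a \<le> snd (f, s) \<and> snd (f, s) \<le> b" using Q(3) by simp
  qed
  have l_meas: "(\<lambda>(\<theta>, y). l \<theta> y) \<in> borel_measurable (?M \<Otimes>\<^sub>M ?L)"
    unfolding l_def case_prod_beta
  proof (rule measurable_likelihood_joint)
    show "(\<lambda>w. fst (fst w)) \<in> measurable (?M \<Otimes>\<^sub>M ?L) (fun_space n)"
      by (rule measurable_compose[OF measurable_fst fstM])
    show "(\<lambda>w. snd (fst w)) \<in> borel_measurable (?M \<Otimes>\<^sub>M ?L)"
      by (rule measurable_compose[OF measurable_fst sndM])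
    show "snd \<in> measurable (?M \<Otimes>\<^sub>M ?L) (fun_space n)"
      using measurable_snd[of ?M ?L] by (simp add: measurable_to_lborel_n)
  qed
  have l_bd: "AE \<theta> in ?M. 0 < l \<theta> y \<and> l \<theta> y \<le> (1 / sqrt (2 * pi * a\<^sup>2)) ^ n" for y
    using AE_s
  proof eventually_elim
    fix \<theta> :: "(nat \<Rightarrow> real) \<times> real" assume s: "a \<le> snd \<theta> \<and> snd \<theta> \<le> b"
    have "1 / sqrt (2 * pi * (snd \<theta>)\<^sup>2) \<le> 1 / sqrt (2 * pi * a\<^sup>2)"
      using s a by (intro divide_left_mono) (auto simp: power_mono intro!: mult_pos_pos)
    then have "(1 / sqrt (2 * pi * (snd \<theta>)\<^sup>2)) ^ n * exp (- (\<Sum>i<n. (y i - fst \<theta> i)\<^sup>2) / (2 * (snd \<theta>)\<^sup>2))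
        \<le> (1 / sqrt (2 * pi * a\<^sup>2)) ^ n * 1"
      by (intro mult_mono power_mono) (auto simp: sum_nonneg)
    then show "0 < l \<theta> y \<and> l \<theta> y \<le> (1 / sqrt (2 * pi * a\<^sup>2)) ^ n"
      using s a likelihood_pos[of "snd \<theta>" n "fst \<theta>" y] by (simp add: l_def likelihood_eq)
  qed
  define Js where "Js = {s. a \<le> s \<and> s \<le> b \<and> \<bar>s\<^sup>2 / \<sigma>\<^sup>2 - 1\<bar> \<le> 1 / (2 * real n)}"
  have Js [measurable]: "Js \<in> sets Q" unfolding Q(2) Js_def by measurable
  define e where "e f = exp (- (1 / \<sigma>\<^sup>2) * (\<Sum>i<n. (f i - f0 i)\<^sup>2))" for f
  have e_fs: "e \<in> borel_measurable (fun_space n)" unfolding e_def by measurable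
  then have e_meas [measurable]: "e \<in> borel_measurable P"
    using measurable_cong_sets[OF P(2) refl] by blast
  \<comment> \<open>On \<open>Js\<close> the ratio integral is at most 2 exp(2 d / \<sigma>^2), d
    being the squared distance of f and f0; the square of \<open>e\<close> is the reciprocal of that
    exponential. Off \<open>Js\<close> the weight vanishes, so larger deviations of \<open>s\<close>
    never enter.\<close>
  define w where "w \<theta> = indicator Js (snd \<theta>) * e (fst \<theta>)" for \<theta> :: "(nat \<Rightarrow> real) \<times> real"
  have w_meas [measurable]: "w \<in> borel_measurable ?M" unfolding w_def by measurable
  have w0: "0 \<le> w \<theta>" for \<theta> by (simp add: w_def e_def)
  have W': "ennreal (qJ * W) \<le> (\<integral>\<^sup>+\<theta>. ennreal (w \<theta>) \<partial>?M)"
  proof -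
    have "(\<integral>\<^sup>+\<theta>. ennreal (w \<theta>) \<partial>?M) = (\<integral>\<^sup>+f. \<integral>\<^sup>+s. ennreal (w (f, s)) \<partial>Q \<partial>P)"
      by (rule Q.nn_integral_fst[symmetric]) measurable
    also have "\<dots> = (\<integral>\<^sup>+f. \<integral>\<^sup>+s. ennreal (e f) * indicator Js s \<partial>Q \<partial>P)"
      by (intro nn_integral_cong) (auto simp: w_def split: split_indicator)
    also have "\<dots> = (\<integral>\<^sup>+f. ennreal (e f) * emeasure Q Js \<partial>P)"
      by (intro nn_integral_cong nn_integral_cmult_indicator Js)
    also have "\<dots> = (\<integral>\<^sup>+f. ennreal (e f) \<partial>P) * emeasure Q Js"
      by (rule nn_integral_multc) measurable
    also have "\<dots> \<ge> ennreal W * ennreal qJ"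
      using W(2) J(1) by (intro mult_mono) (auto simp: e_def Js_def)
    finally show ?thesis using W(1) J(2) by (simp add: ennreal_mult mult.commute)
  qed
  have neg: "(\<integral>\<^sup>+\<theta>. ennreal ((w \<theta>)\<^sup>2) * (\<integral>\<^sup>+y. ennreal ((likelihood n \<sigma> f0 y)\<^sup>2 / l \<theta> y) \<partial>?L) \<partial>?M) \<le> 2"
  proof -
    have "ennreal ((w \<theta>)\<^sup>2) * (\<integral>\<^sup>+y. ennreal ((likelihood n \<sigma> f0 y)\<^sup>2 / l \<theta> y) \<partial>?L) \<le> 2" for \<theta>
    proof (cases "snd \<theta> \<in> Js")
      case True
      define s f where "s = snd \<theta>" and "f = fst \<theta>"
      have s: "s > 0" "\<bar>s\<^sup>2 / \<sigma>\<^sup>2 - 1\<bar> \<le> 1 / (2 * real n)" using True a by (auto simp: Js_def s_def)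
      note r = ratio_constant_le_2[OF n s(1) \<sigma>(1) s(2)]
      have \<sigma>2: "\<sigma>\<^sup>2 > 0" using \<sigma> by simp
      have less: "\<sigma>\<^sup>2 < 2 * s\<^sup>2" using r(1) \<sigma>2 by linarith
      define d where "d = (\<Sum>i<n. (f i - f0 i)\<^sup>2)"
      have d0: "d \<ge> 0" by (simp add: d_def sum_nonneg)
      have "(e f)\<^sup>2 * ((s\<^sup>2 / (\<sigma> * sqrt (2 * s\<^sup>2 - \<sigma>\<^sup>2))) ^ n * exp (d / (2 * s\<^sup>2 - \<sigma>\<^sup>2)))
          = (s\<^sup>2 / (\<sigma> * sqrt (2 * s\<^sup>2 - \<sigma>\<^sup>2))) ^ n * exp (2 * (- (1 / \<sigma>\<^sup>2) * d) + d / (2 * s\<^sup>2 - \<sigma>\<^sup>2))"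
        unfolding exp_add exp_double by (simp add: e_def d_def)
      also have "\<dots> \<le> 2 * 1"
      proof (intro mult_mono r(2))
        have "d / (2 * s\<^sup>2 - \<sigma>\<^sup>2) \<le> d / (\<sigma>\<^sup>2 / 2)"
          using r(1) \<sigma>2 d0 less by (intro divide_left_mono) auto
        then show "exp (2 * (- (1 / \<sigma>\<^sup>2) * d) + d / (2 * s\<^sup>2 - \<sigma>\<^sup>2)) \<le> 1" by (simp add: mult.commute)
      qed auto
      finally have le: "(e f)\<^sup>2 * ((s\<^sup>2 / (\<sigma> * sqrt (2 * s\<^sup>2 - \<sigma>\<^sup>2))) ^ n * exp (d / (2 * s\<^sup>2 - \<sigma>\<^sup>2))) \<le> 2" by simp
      have "ennreal ((w \<theta>)\<^sup>2) * (\<integral>\<^sup>+y. ennreal ((likelihood n \<sigma> f0 y)\<^sup>2 / l \<theta> y) \<partial>?L)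
          = ennreal ((e f)\<^sup>2) * ennreal ((s\<^sup>2 / (\<sigma> * sqrt (2 * s\<^sup>2 - \<sigma>\<^sup>2))) ^ n * exp (d / (2 * s\<^sup>2 - \<sigma>\<^sup>2)))"
        using True nn_integral_likelihood_ratio[OF s(1) \<sigma>(1) less, of n f0 f]
        by (simp add: w_def l_def d_def s_def f_def)
      also have "\<dots> = ennreal ((e f)\<^sup>2 * ((s\<^sup>2 / (\<sigma> * sqrt (2 * s\<^sup>2 - \<sigma>\<^sup>2))) ^ n * exp (d / (2 * s\<^sup>2 - \<sigma>\<^sup>2))))"
        using \<sigma> less by (intro ennreal_mult[symmetric]) auto
      also have "\<dots> \<le> ennreal 2" by (rule ennreal_leI[OF le])
      finally show ?thesis by simp
    qed (simp add: w_def)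
    then have "(\<integral>\<^sup>+\<theta>. ennreal ((w \<theta>)\<^sup>2) * (\<integral>\<^sup>+y. ennreal ((likelihood n \<sigma> f0 y)\<^sup>2 / l \<theta> y) \<partial>?L) \<partial>?M) \<le> (\<integral>\<^sup>+\<theta>. 2 \<partial>?M)"
      by (intro nn_integral_mono)
    then show ?thesis by (simp add: PQ.emeasure_space_1)
  qed
  \<comment> \<open>The test rejects the truth when the low-frequency noise, computed as if f0 were
    true, exceeds K k.\<close>
  define R where "R = {y \<in> space ?L. K * k \<le> (\<Sum>i\<in>H. (coef n U (\<lambda>j. y j - f0 j) i)\<^sup>2)}"
  have R: "R \<in> sets ?L"
    unfolding R_def using measurable_coef_diff_sum[OF H, of U f0] by (simp add: measurable_from_lborel_n[symmetric])
  define S where "S = {f \<in> space P. M' * k < (\<Sum>i\<in>T. (coef n U f i)\<^sup>2)}"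
  have S [measurable]: "S \<in> sets P"
    unfolding S_def P(2) spP using measurable_coef_sum[OF Tn, of U] by measurable
  have A_sets [measurable]: "A \<in> sets P" unfolding A P(2) by measurable
  define A' where "A' = fst -` A \<inter> space ?M"
  have A'_sets: "A' \<in> sets ?M" unfolding A'_def by measurable
  have sp_data: "space (data_law n s f) = space ?L" for s f by (simp add: space_data_law space_lborel_n)
  \<comment> \<open>For \<open>f\<close> in the exceptional set \<open>S\<close> the acceptance
    probability is bounded by 1, for all other \<open>f\<close> in \<open>A\<close> by the error of
    the test. The bound depends on \<open>s\<close> only through \<open>b\<close>.\<close>
  have out: "(\<integral>\<^sup>+y. indicator (space ?L - R) y * ennreal (l (f, s) y) \<partial>?L) \<le> indicator S f + ennreal \<chi>"
    if f: "f \<in> A" and s: "a \<le> s" "s \<le> b" for f s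
  proof -
    have s0: "s > 0" using s a by simp
    have ind: "(\<lambda>y. indicator (space ?L - R) y :: ennreal) \<in> borel_measurable (fun_space n)"
      using R unfolding measurable_from_lborel_n[symmetric] by measurable
    have "(\<integral>\<^sup>+y. indicator (space ?L - R) y * ennreal (l (f, s) y) \<partial>?L)
        = (\<integral>\<^sup>+y. indicator (space ?L - R) y \<partial>data_law n s f)"
      by (simp add: nn_integral_data_law[OF s0 ind] l_def mult.commute)
    also have "\<dots> = emeasure (data_law n s f) (space ?L - R)"
      using R by (intro nn_integral_indicator) (auto simp: sets_data_law sets_lborel_n[symmetric])
    finally have eq: "(\<integral>\<^sup>+y. indicator (space ?L - R) y * ennreal (l (f, s) y) \<partial>?L) = emeasure (data_law n s f) (space ?L - R)" .
    show ?thesis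
    proof (cases "f \<in> S")
      case True
      interpret D: prob_space "data_law n s f" by (rule prob_space_data_law[OF s0])
      show ?thesis unfolding eq using True D.measure_le_1 by (simp add: add_increasing2 D.emeasure_le_1)
    next
      case False
      have tailf: "(\<Sum>i\<in>T. (coef n U f i)\<^sup>2) \<le> M' * k"
        using False f by (simp add: S_def A spP not_less)
      have sq: "(u - v)\<^sup>2 \<le> 2 * u\<^sup>2 + 2 * v\<^sup>2" for u v :: real
        using zero_le_power2[of "u + v"] by (simp add: power2_eq_square algebra_simps)
      have "M2 * k \<le> (\<Sum>i<n. (coef n U (\<lambda>j. f j - f0 j) i)\<^sup>2)"
        using f by (simp add: A sum_coef_squares[OF U])
      also have "\<dots> = (\<Sum>i\<in>H. (coef n U (\<lambda>j. f j - f0 j) i)\<^sup>2) + (\<Sum>i\<in>T. (coef n U (\<lambda>j. f j - f0 j) i)\<^sup>2)"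
        unfolding HT(2)[symmetric] using fin HT(1) by (rule sum.union_disjoint)
      also have "(\<Sum>i\<in>T. (coef n U (\<lambda>j. f j - f0 j) i)\<^sup>2) \<le> (\<Sum>i\<in>T. 2 * (coef n U f i)\<^sup>2 + 2 * (coef n U f0 i)\<^sup>2)"
        using Tn by (intro sum_mono) (auto simp: coef_diff intro!: sq)
      also have "\<dots> \<le> 2 * (M' * k) + 2 * (B * k)"
        using tailf tail0 by (simp add: sum.distrib sum_distrib_left[symmetric] T_def)
      finally have low: "(M2 - 2 * M' - 2 * B) * k \<le> (\<Sum>i\<in>H. (coef n U (\<lambda>j. f j - f0 j) i)\<^sup>2)"
        by (simp add: algebra_simps)
      have sub: "space ?L - R \<subseteq> {y \<in> space (data_law n s f). K * k \<le> (\<Sum>i\<in>H. (coef n U (\<lambda>j. y j - f j) i)\<^sup>2)}"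
      proof
        fix y assume y: "y \<in> space ?L - R"
        have "(\<Sum>i\<in>H. (coef n U (\<lambda>j. f j - f0 j) i)\<^sup>2)
            \<le> (\<Sum>i\<in>H. 2 * (coef n U (\<lambda>j. y j - f0 j) i)\<^sup>2 + 2 * (coef n U (\<lambda>j. y j - f j) i)\<^sup>2)"
        proof (rule sum_mono)
          fix i assume "i \<in> H"
          then have "coef n U (\<lambda>j. f j - f0 j) i = coef n U (\<lambda>j. y j - f0 j) i - coef n U (\<lambda>j. y j - f j) i"
            using H by (auto simp: coef_diff)
          then show "(coef n U (\<lambda>j. f j - f0 j) i)\<^sup>2
              \<le> 2 * (coef n U (\<lambda>j. y j - f0 j) i)\<^sup>2 + 2 * (coef n U (\<lambda>j. y j - f j) i)\<^sup>2"
            by (simp add: sq)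
        qed
        also have "\<dots> = 2 * (\<Sum>i\<in>H. (coef n U (\<lambda>j. y j - f0 j) i)\<^sup>2) + 2 * (\<Sum>i\<in>H. (coef n U (\<lambda>j. y j - f j) i)\<^sup>2)"
          by (simp add: sum.distrib sum_distrib_left)
        finally have *: "(\<Sum>i\<in>H. (coef n U (\<lambda>j. f j - f0 j) i)\<^sup>2)
          \<le> 2 * (\<Sum>i\<in>H. (coef n U (\<lambda>j. y j - f0 j) i)\<^sup>2) + 2 * (\<Sum>i\<in>H. (coef n U (\<lambda>j. y j - f j) i)\<^sup>2)" .
        have "(\<Sum>i\<in>H. (coef n U (\<lambda>j. y j - f0 j) i)\<^sup>2) < K * k" using y by (auto simp: R_def)
        moreover have "(4 * K) * k \<le> (M2 - 2 * M' - 2 * B) * k" using M2 k by (intro mult_right_mono) auto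
        ultimately have "K * k \<le> (\<Sum>i\<in>H. (coef n U (\<lambda>j. y j - f j) i)\<^sup>2)" using * low by simp
        then show "y \<in> {y \<in> space (data_law n s f). K * k \<le> (\<Sum>i\<in>H. (coef n U (\<lambda>j. y j - f j) i)\<^sup>2)}"
          using y by (simp add: sp_data)
      qed
      have "emeasure (data_law n s f) (space ?L - R)
          \<le> emeasure (data_law n s f) {y \<in> space (data_law n s f). K * k \<le> (\<Sum>i\<in>H. (coef n U (\<lambda>j. y j - f j) i)\<^sup>2)}"
      proof (rule emeasure_mono[OF sub])
        show "{y \<in> space (data_law n s f). K * k \<le> (\<Sum>i\<in>H. (coef n U (\<lambda>j. y j - f j) i)\<^sup>2)} \<in> sets (data_law n s f)"
          using measurable_coef_diff_sum[OF H, of U f] measurable_cong_sets[OF sets_data_law[of n s f] refl] by measurable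
      qed
      also have "\<dots> \<le> ennreal (exp (- (K * k) / (4 * b\<^sup>2)) * sqrt 2 ^ card H)"
        using K k by (intro chi_square_tail[OF U s0 s(2) H]) auto
      also have "\<dots> \<le> ennreal \<chi>" by (rule ennreal_leI[OF chiH])
      finally show ?thesis unfolding eq by (simp add: add_increasing)
    qed
  qed
  have num: "(\<integral>\<^sup>+\<theta>. indicator A' \<theta> * (\<integral>\<^sup>+y. indicator (space ?L - R) y * ennreal (l \<theta> y) \<partial>?L) \<partial>?M) \<le> ennreal (t + \<chi>)"
  proof -
    have "(\<integral>\<^sup>+\<theta>. indicator A' \<theta> * (\<integral>\<^sup>+y. indicator (space ?L - R) y * ennreal (l \<theta> y) \<partial>?L) \<partial>?M)
        \<le> (\<integral>\<^sup>+\<theta>. indicator S (fst \<theta>) + ennreal \<chi> \<partial>?M)"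
    proof (rule nn_integral_mono_AE, use AE_s in eventually_elim)
      fix \<theta> :: "(nat \<Rightarrow> real) \<times> real" assume s: "a \<le> snd \<theta> \<and> snd \<theta> \<le> b"
      show "indicator A' \<theta> * (\<integral>\<^sup>+y. indicator (space ?L - R) y * ennreal (l \<theta> y) \<partial>?L) \<le> indicator S (fst \<theta>) + ennreal \<chi>"
        using out[of "fst \<theta>" "snd \<theta>"] s by (auto simp: A'_def split: split_indicator)
    qed
    also have "\<dots> = (\<integral>\<^sup>+\<theta>. indicator S (fst \<theta>) \<partial>?M) + ennreal \<chi>"
      by (subst nn_integral_add) (auto simp: PQ.emeasure_space_1)
    also have "(\<integral>\<^sup>+\<theta>. indicator S (fst \<theta>) \<partial>?M) = (\<integral>\<^sup>+f. \<integral>\<^sup>+s. indicator S f \<partial>Q \<partial>P)"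
      by (subst Q.nn_integral_fst[symmetric]) auto
    also have "\<dots> = emeasure P S" by (simp add: Q.emeasure_space_1)
    also have "\<dots> + ennreal \<chi> \<le> ennreal t + ennreal \<chi>"
      using tailP(1) by (intro add_right_mono) (simp add: S_def T_def)
    also have "\<dots> = ennreal (t + \<chi>)" using tailP(2) chi0 by simp
    finally show ?thesis .
  qed
  have post_eq: "measure (posterior_unknown_var Q n P y) A = measure (bayes ?M (\<lambda>\<theta>. l \<theta> y)) A'" for y
    unfolding measure_posterior_unknown_var[OF P(2) A_sets] A'_def l_def by (simp add: case_prod_beta')
  let ?B = "{y \<in> space (data_law n \<sigma> f0). \<delta> \<le> measure (posterior_unknown_var Q n P y) A}"
  have dl: "data_law n \<sigma> f0 = density ?L (\<lambda>y. ennreal (likelihood n \<sigma> f0 y))"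
    by (rule data_law_density[OF \<sigma>(1)])
  have "emeasure (data_law n \<sigma> f0) ?B
      \<le> emeasure (data_law n \<sigma> f0) R + ennreal (\<eta> / (qJ * W)\<^sup>2) * 2 + ennreal (1 / (\<delta> * \<eta>)) * ennreal (t + \<chi>)"
    unfolding sp_data post_eq unfolding dl
  proof (rule posterior_mass_bound[OF PQ.prob_space_axioms sigma_finite_lborel_n l_meas _ _ _ _ w_meas w0 _ W' A'_sets R pos neg num])
    show "0 \<le> l \<theta> y" for \<theta> y by (simp add: l_def)
    show "AE \<theta> in ?M. 0 < l \<theta> y \<and> l \<theta> y \<le> (1 / sqrt (2 * pi * a\<^sup>2)) ^ n" for y by (rule l_bd)
    show "likelihood n \<sigma> f0 \<in> borel_measurable ?L" unfolding measurable_from_lborel_n by (rule measurable_likelihood)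
    show "0 < likelihood n \<sigma> f0 y" for y by (rule likelihood_pos[OF \<sigma>(1)])
    show "0 < qJ * W" using J(2) W(1) by simp
  qed
  also have "emeasure (data_law n \<sigma> f0) R \<le> ennreal \<chi>"
  proof -
    have "emeasure (data_law n \<sigma> f0) R \<le> ennreal (exp (- (K * k) / (4 * b\<^sup>2)) * sqrt 2 ^ card H)"
      unfolding R_def sp_data[of \<sigma> f0, symmetric] using K k by (intro chi_square_tail[OF U \<sigma> H]) auto
    also have "\<dots> \<le> ennreal \<chi>" by (rule ennreal_leI[OF chiH])
    finally show ?thesis .
  qed
  also have "ennreal \<chi> + ennreal (\<eta> / (qJ * W)\<^sup>2) * 2 + ennreal (1 / (\<delta> * \<eta>)) * ennreal (t + \<chi>)
      = ennreal (\<chi> + 2 * \<eta> / (qJ * W)\<^sup>2 + (t + \<chi>) / (\<delta> * \<eta>))"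
  proof -
    have "ennreal (\<eta> / (qJ * W)\<^sup>2) * 2 = ennreal (\<eta> / (qJ * W)\<^sup>2 * 2)"
      using pos by (subst ennreal_mult) auto
    moreover have "ennreal (1 / (\<delta> * \<eta>)) * ennreal (t + \<chi>) = ennreal (1 / (\<delta> * \<eta>) * (t + \<chi>))"
      using pos tailP(2) chi0 by (intro ennreal_mult[symmetric]) auto
    ultimately show ?thesis using pos tailP(2) chi0 by (simp add: ennreal_plus[symmetric] mult.commute del: ennreal_plus)
  qed
  finally have "emeasure (data_law n \<sigma> f0) ?B \<le> ennreal (\<chi> + 2 * \<eta> / (qJ * W)\<^sup>2 + (t + \<chi>) / (\<delta> * \<eta>))"
    by (simp add: add_right_mono)
  then show ?thesis
    unfolding measure_def using pos tailP(2) chi0 by (intro enn2real_leI) auto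
qed

section \<open>Contraction rates\<close>

text \<open>What the proof uses about the law of the standard deviation: support in [a, b], and mass
  of order at least 1/n in the window where \<open>ratio_constant_le_2\<close> applies. It covers
  point masses as well as densities bounded away from zero.\<close>

definition variance_prior :: "real \<Rightarrow> real measure \<Rightarrow> real \<Rightarrow> real \<Rightarrow> real \<Rightarrow> bool" where
  "variance_prior \<sigma> Q a b q \<longleftrightarrow> prob_space Q \<and> sets Q = sets borel \<and> (AE s in Q. a \<le> s \<and> s \<le> b) \<and>
     0 < a \<and> \<sigma> \<le> b \<and> 0 < q \<and>
     (\<forall>n\<ge>2. ennreal (q / real n) \<le> emeasure Q {s. a \<le> s \<and> s \<le> b \<and> \<bar>s\<^sup>2 / \<sigma>\<^sup>2 - 1\<bar> \<le> 1 / (2 * real n)})"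

lemma variance_prior_return:
  assumes "\<sigma> > 0" shows "variance_prior \<sigma> (return borel \<sigma>) \<sigma> \<sigma> 1"
proof -
  have "{s. \<sigma> \<le> s \<and> s \<le> \<sigma> \<and> \<bar>s\<^sup>2 / \<sigma>\<^sup>2 - 1\<bar> \<le> 1 / (2 * real n)} = {\<sigma>}" for n
    using assms by auto
  then show ?thesis
    unfolding variance_prior_def using assms
    by (auto simp: prob_space_return AE_return ennreal_le_1)
qed

text \<open>By compactness the density has a positive minimum \<open>m\<close> on [a, b]; the window
  contains an interval of length proportional to 1/n that lies inside [a, b].\<close>

lemma variance_prior_density:
  fixes h :: "real \<Rightarrow> real"
  assumes ab: "0 < a" "a < b" and \<sigma>: "\<sigma> \<in> {a..b}" and cont: "continuous_on {a..b} h"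
    and pos: "\<forall>s\<in>{a..b}. h s > 0" and int: "(h has_integral 1) {a..b}"
  shows "\<exists>q. variance_prior \<sigma> (density lborel (\<lambda>s. ennreal (indicator {a..b} s * h s))) a b q"
proof -
  let ?g = "\<lambda>s. indicator {a..b} s * h s"
  let ?Q = "density lborel (\<lambda>s. ennreal (?g s))"
  have g [measurable]: "?g \<in> borel_measurable borel"
    using borel_measurable_continuous_on_indicator[OF _ cont] by simp
  have g0: "?g s \<ge> 0" for s using pos by (auto split: split_indicator simp: less_imp_le)
  have "(?g has_integral 1) UNIV"
  proof -
    have "?g = (\<lambda>s. if s \<in> {a..b} then h s else 0)" by (auto simp: indicator_def)
    then show ?thesis using int by (simp only: has_integral_restrict_UNIV)
  qed
  then have "(\<integral>\<^sup>+s. ennreal (?g s) \<partial>lborel) = 1"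
    using nn_integral_has_integral_lborel[OF g g0] by simp
  then have prob: "prob_space ?Q" by (intro prob_spaceI) (simp add: emeasure_density)
  have ae: "AE s in ?Q. a \<le> s \<and> s \<le> b"
    by (subst AE_density) (auto split: split_indicator)
  obtain s0 where "s0 \<in> {a..b}" "\<And>s. s \<in> {a..b} \<Longrightarrow> h s0 \<le> h s"
    using continuous_attains_inf[OF compact_Icc _ cont] ab by auto
  then obtain m where m: "m > 0" "\<And>s. s \<in> {a..b} \<Longrightarrow> m \<le> h s" using pos by blast
  \<comment> \<open>The factor \<sigma>^2 / (4 b) comes from |s^2 - \<sigma>^2| <= 2 b |s -
    \<sigma>|, so that the ratio deviates by at most 1 / (2 n); the factor (b - a) / 2 makes the
    interval fit into [a, b].\<close>
  define q where "q = m * min (\<sigma>\<^sup>2 / (4 * b)) ((b - a) / 2)"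
  have \<sigma>0: "\<sigma> > 0" using \<sigma> ab by simp
  have q: "q > 0" using m ab \<sigma>0 by (simp add: q_def)
  have "ennreal (q / real n) \<le> emeasure ?Q {s. a \<le> s \<and> s \<le> b \<and> \<bar>s\<^sup>2 / \<sigma>\<^sup>2 - 1\<bar> \<le> 1 / (2 * real n)}"
    (is "_ \<le> emeasure ?Q ?J") if n: "n \<ge> 2" for n :: nat
  proof -
    define e where "e = min (\<sigma>\<^sup>2 / (4 * b)) ((b - a) / 2) / real n"
    have n0: "real n \<ge> 1" using n by simp
    have e0: "e > 0" using ab \<sigma>0 n by (simp add: e_def)
    have e1: "e \<le> (\<sigma>\<^sup>2 / (4 * b)) / real n" unfolding e_def by (intro divide_right_mono min.cobounded1) auto
    have "e \<le> ((b - a) / 2) / real n" unfolding e_def by (intro divide_right_mono min.cobounded2) auto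
    also have "\<dots> \<le> (b - a) / 2 / 1" using n0 ab by (intro divide_left_mono) auto
    finally have e2: "e \<le> (b - a) / 2" by simp
    \<comment> \<open>The true \<sigma> may be an endpoint of [a, b]; the interval is placed to its
      right if there is room and to its left otherwise, which is possible because e <= (b - a) /
      2.\<close>
    define u where "u = (if \<sigma> + e \<le> b then \<sigma> else \<sigma> - e)"
    have u: "a \<le> u" "u + e \<le> b" "u \<le> \<sigma>" "\<sigma> \<le> u + e"
      using \<sigma> e2 e0 by (auto simp: u_def)
    have sub: "{u..u + e} \<subseteq> ?J"
    proof
      fix s assume s: "s \<in> {u..u + e}"
      then have ab_s: "a \<le> s" "s \<le> b" and d: "\<bar>s - \<sigma>\<bar> \<le> e" using u by auto
      have "\<bar>s\<^sup>2 / \<sigma>\<^sup>2 - 1\<bar> = \<bar>s - \<sigma>\<bar> * \<bar>s + \<sigma>\<bar> / \<sigma>\<^sup>2"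
        using \<sigma>0 by (simp add: abs_mult[symmetric] power2_eq_square field_simps)
      also have "\<dots> \<le> e * (2 * b) / \<sigma>\<^sup>2"
        using d ab_s ab \<sigma> e0 by (intro divide_right_mono mult_mono) auto
      also have "\<dots> \<le> ((\<sigma>\<^sup>2 / (4 * b)) / real n) * (2 * b) / \<sigma>\<^sup>2"
        using e1 ab by (intro divide_right_mono mult_right_mono) auto
      also have "\<dots> = 1 / (2 * real n)" using ab \<sigma>0 by (simp add: field_simps)
      finally show "s \<in> ?J" using ab_s by simp
    qed
    have J: "?J \<in> sets borel" by measurable
    have "ennreal (q / real n) = ennreal (m * e)" by (simp add: q_def e_def)
    also have "\<dots> = ennreal m * emeasure lborel {u..u + e}" using m(1) e0 by (simp add: ennreal_mult)
    also have "\<dots> = (\<integral>\<^sup>+s. ennreal m * indicator {u..u + e} s \<partial>lborel)"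
      by (simp add: nn_integral_cmult_indicator)
    also have "\<dots> \<le> (\<integral>\<^sup>+s. ennreal (?g s) * indicator {u..u + e} s \<partial>lborel)"
      using u m by (intro nn_integral_mono) (auto split: split_indicator intro!: ennreal_leI)
    also have "\<dots> = emeasure ?Q {u..u + e}" by (simp add: emeasure_density)
    also have "\<dots> \<le> emeasure ?Q ?J" using sub J by (intro emeasure_mono) auto
    finally show ?thesis .
  qed
  then show ?thesis
    unfolding variance_prior_def using prob ae ab \<sigma> q by auto
qed

lemma posterior_variance_prior:
  assumes \<sigma>: "\<sigma> > 0"
    and post: "post = posterior_known_var \<sigma> \<or>
         (\<exists>a b h. 0 < a \<and> a < b \<and> \<sigma> \<in> {a..b} \<and>
            continuous_on {a..b} h \<and> (\<forall>s\<in>{a..b}. h s > 0) \<and> (h has_integral 1) {a..b} \<and>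
            post = posterior_unknown_var (density lborel (\<lambda>s. ennreal (indicator {a..b} s * h s))))"
  obtains Q a b q where "variance_prior \<sigma> Q a b q"
    "\<And>n P y A. prob_space P \<Longrightarrow> sets P = sets (fun_space n) \<Longrightarrow> y \<in> space (fun_space n) \<Longrightarrow> A \<in> sets P \<Longrightarrow>
       measure (post n P y) A = measure (posterior_unknown_var Q n P y) A"
  using post
proof
  assume "post = posterior_known_var \<sigma>"
  then show thesis
    using that[OF variance_prior_return[OF \<sigma>]] posterior_known_var_eq by metis
next
  assume "\<exists>a b h. 0 < a \<and> a < b \<and> \<sigma> \<in> {a..b} \<and>
            continuous_on {a..b} h \<and> (\<forall>s\<in>{a..b}. h s > 0) \<and> (h has_integral 1) {a..b} \<and>
            post = posterior_unknown_var (density lborel (\<lambda>s. ennreal (indicator {a..b} s * h s)))"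
  then obtain a b h where *: "0 < a" "a < b" "\<sigma> \<in> {a..b}" "continuous_on {a..b} h"
      "\<forall>s\<in>{a..b}. h s > 0" "(h has_integral 1) {a..b}"
      and p: "post = posterior_unknown_var (density lborel (\<lambda>s. ennreal (indicator {a..b} s * h s)))"
    by blast
  obtain q where "variance_prior \<sigma> (density lborel (\<lambda>s. ennreal (indicator {a..b} s * h s))) a b q"
    using variance_prior_density[OF *] by blast
  then show thesis by (rule that) (simp add: p)
qed

text \<open>\<open>E\<close> is the exponent of the evidence, \<open>k\<close> the squared rate
  times n and also the frequency cut-off of the test. The bound n <= exp E absorbs the mass 1/n of
  the variance prior, and E <= k lets the test beat the evidence. The prior tail has to be available
  for every \<open>D\<close>, since the exponent to be beaten depends on the constant of the
  evidence bound.\<close>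

lemma contracts_at_rateI:
  fixes N :: "nat set" and E k \<epsilon> :: "nat \<Rightarrow> real" and P :: "nat \<Rightarrow> (nat \<Rightarrow> real) measure" and U :: "nat \<Rightarrow> real mat"
  defines "F \<equiv> at_top_along N"
  assumes \<sigma>: "\<sigma> > 0" and vp: "variance_prior \<sigma> Q a b q"
    and post: "\<And>n P y A. prob_space P \<Longrightarrow> sets P = sets (fun_space n) \<Longrightarrow> y \<in> space (fun_space n) \<Longrightarrow> A \<in> sets P \<Longrightarrow>
       measure (post n P y) A = measure (posterior_unknown_var Q n P y) A"
    and U: "\<forall>\<^sub>F n in F. orth_mat n (U n)"
    and P: "\<forall>\<^sub>F n in F. prob_space (P n) \<and> sets (P n) = sets (fun_space n)"
    and E: "filterlim E at_top F" "\<forall>\<^sub>F n in F. real n \<le> exp (E n)" "\<forall>\<^sub>F n in F. E n \<le> k n"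
    and \<epsilon>: "\<forall>\<^sub>F n in F. \<epsilon> n \<ge> 0 \<and> real n * (\<epsilon> n)\<^sup>2 = k n"
    and tail0: "\<forall>\<^sub>F n in F. (\<Sum>i\<in>{i. i < n \<and> k n \<le> real i}. (coef n (U n) (f0 n) i)\<^sup>2) \<le> B * k n"
    and ev: "\<forall>\<^sub>F n in F. ennreal (exp (- D * E n))
      \<le> (\<integral>\<^sup>+f. ennreal (exp (- (1 / \<sigma>\<^sup>2) * (\<Sum>i<n. (f i - f0 n i)\<^sup>2))) \<partial>P n)"
    and tailP: "\<And>D. D > 0 \<Longrightarrow> \<exists>M'. \<forall>\<^sub>F n in F. emeasure (P n)
       {f \<in> space (P n). M' * k n < (\<Sum>i\<in>{i. i < n \<and> k n \<le> real i}. (coef n (U n) f i)\<^sup>2)} \<le> ennreal (exp (- D * E n))"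
  shows "contracts_at_rate N \<sigma> f0 (\<lambda>n. post n (P n)) \<epsilon>"
proof -
  note Q = vp[unfolded variance_prior_def]
  have b: "b > 0" using Q \<sigma> by linarith
  have q: "q > 0" using Q by simp
  define D0 where "D0 = max D 0"
  \<comment> \<open>Exponent budget, in units of E: the squared evidence together with the variance
    prior costs 2 D0 + 2, so \<eta> = exp(- (2 D0 + 3) E) leaves one unit there; dividing the
    numerator by \<eta> leaves one unit again if the numerator has exponent 2 D0 + 4.\<close>
  define D' where "D' = 2 * D0 + 4"
  have D': "D' > 0" "D' \<ge> 1" by (auto simp: D'_def D0_def)
  obtain M' where M': "\<forall>\<^sub>F n in F. emeasure (P n)
       {f \<in> space (P n). M' * k n < (\<Sum>i\<in>{i. i < n \<and> k n \<le> real i}. (coef n (U n) f i)\<^sup>2)} \<le> ennreal (exp (- D' * E n))"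
    using tailP[OF D'(1)] by blast
  \<comment> \<open>The test error is exp(- K k / (4 b^2)) exp k; this \<open>K\<close> turns it
    into exp(- D' k).\<close>
  define K where "K = 4 * b\<^sup>2 * (D' + 1)"
  have K: "K \<ge> 0" using D' by (simp add: K_def)
  \<comment> \<open>The summand 1 gives M0 >= 1, hence M^2 >= M, so the squared radius dominates the
    linear condition on \<open>M2\<close>.\<close>
  define M0 where "M0 = 1 + \<bar>2 * M' + 2 * B + 4 * K\<bar>"
  have M0: "M0 > 0" by (simp add: M0_def add_pos_nonneg)
  have F_le: "eventually p F" if "eventually p sequentially" for p
    using that unfolding F_def eventually_inf_principal by (rule eventually_mono) auto
  have E1: "\<forall>\<^sub>F n in F. E n \<ge> 1" using E(1) by (simp add: filterlim_at_top)
  have main: "\<forall>\<^sub>F n in F. measure (data_law n \<sigma> (f0 n)) {y \<in> space (data_law n \<sigma> (f0 n)).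
          \<delta> \<le> measure (post n (P n) y) {f \<in> space (fun_space n). M * \<epsilon> n \<le> norm_n n (\<lambda>i. f i - f0 n i)}}
      \<le> (1 + 2 / q\<^sup>2 + 2 / \<delta>) * exp (- E n)" if M: "M \<ge> M0" and \<delta>: "\<delta> > 0" for M \<delta>
    using U P E(2,3) E1 \<epsilon> tail0 ev M' F_le[OF eventually_ge_at_top[of 2]]
  proof eventually_elim
    case (elim n)
    define e where "e = E n"
    have n0: "real n > 0" using elim by simp
    have e1: "e \<ge> 1" "e \<le> k n" "real n \<le> exp e" using elim by (auto simp: e_def)
    let ?A = "{f \<in> space (fun_space n). M * \<epsilon> n \<le> norm_n n (\<lambda>i. f i - f0 n i)}"
    have M_pos: "M > 0" using M M0 by simp
    have A_eq: "?A = {f \<in> space (fun_space n). M\<^sup>2 * k n \<le> (\<Sum>i<n. (f i - f0 n i)\<^sup>2)}"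
    proof -
      have "M * \<epsilon> n \<le> norm_n n (\<lambda>i. f i - f0 n i) \<longleftrightarrow> M\<^sup>2 * k n \<le> (\<Sum>i<n. (f i - f0 n i)\<^sup>2)" for f
      proof -
        let ?S = "\<Sum>i<n. (f i - f0 n i)\<^sup>2"
        have "norm_n n (\<lambda>i. f i - f0 n i) = sqrt (?S / real n)"
          by (simp add: norm_n_def inner_n_def power2_eq_square)
        moreover have "M * \<epsilon> n \<le> sqrt (?S / real n) \<longleftrightarrow> (M * \<epsilon> n)\<^sup>2 \<le> ?S / real n"
        proof -
          have "M * \<epsilon> n \<ge> 0" using elim M_pos by simp
          then have "sqrt ((M * \<epsilon> n)\<^sup>2) = M * \<epsilon> n" by simp
          then show ?thesis by (metis real_sqrt_le_iff)
        qed
        moreover have "(M * \<epsilon> n)\<^sup>2 \<le> ?S / real n \<longleftrightarrow> M\<^sup>2 * (real n * (\<epsilon> n)\<^sup>2) \<le> ?S"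
          using n0 by (simp add: power_mult_distrib pos_le_divide_eq mult_ac)
        ultimately show ?thesis using elim by simp
      qed
      then show ?thesis by blast
    qed
    have A_sets: "?A \<in> sets (P n)"
      using elim unfolding A_eq by simp measurable
    have M2: "M\<^sup>2 \<ge> 2 * M' + 2 * B + 4 * K"
    proof -
      have "2 * M' + 2 * B + 4 * K \<le> M0" "1 \<le> M0" by (auto simp: M0_def)
      moreover have "M \<le> M\<^sup>2" using M \<open>1 \<le> M0\<close> by (simp add: power2_eq_square)
      ultimately show ?thesis using M by linarith
    qed
    define \<chi> where "\<chi> = exp (- K * k n / (4 * b\<^sup>2)) * exp (k n)"
    define \<eta> where "\<eta> = exp (- (2 * D0 + 3) * e)"
    have chi: "\<chi> \<le> exp (- D' * e)"
    proof -
      have "- K * k n / (4 * b\<^sup>2) = - (D' + 1) * k n" using b by (simp add: K_def) (simp add: algebra_simps)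
      then have "\<chi> = exp (- (D' * k n))"
        by (simp add: \<chi>_def exp_add[symmetric] algebra_simps)
      then show ?thesis using e1 D' by simp
    qed
    have W: "exp (- D0 * e) \<le> exp (- D * e)" using e1 by (simp add: D0_def mult_right_mono)
    have "measure (data_law n \<sigma> (f0 n)) {y \<in> space (data_law n \<sigma> (f0 n)). \<delta> \<le> measure (posterior_unknown_var Q n (P n) y) ?A}
      \<le> \<chi> + 2 * \<eta> / (q / real n * exp (- D0 * e))\<^sup>2 + (exp (- D' * e) + \<chi>) / (\<delta> * \<eta>)"
    proof (rule contraction_bound[where k = "k n" and U = "U n" and a = a and b = b and B = B and M' = M' and K = K and ?M2.0 = "M\<^sup>2"])
      show "ennreal (exp (- D0 * e)) \<le> (\<integral>\<^sup>+f. ennreal (exp (- (1 / \<sigma>\<^sup>2) * (\<Sum>i<n. (f i - f0 n i)\<^sup>2))) \<partial>P n)"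
        using order_trans[OF ennreal_leI[OF W] elim(8)[folded e_def]] .
    qed (use elim Q \<sigma> q n0 e1 K \<delta> M2 A_eq in \<open>simp_all add: \<chi>_def \<eta>_def e_def\<close>)
    also have "\<dots> \<le> exp (- e) + 2 / q\<^sup>2 * exp (- e) + 2 / \<delta> * exp (- e)"
    proof (intro add_mono)
      have "exp (- D' * e) \<le> exp (- e)" using D' e1 by simp
      then show "\<chi> \<le> exp (- e)" using chi by linarith
      \<comment> \<open>The polynomial loss 1/n from the variance prior is exchanged for one more
        unit in the exponent.\<close>
      have "q * exp (- (D0 + 1) * e) \<le> q / real n * exp (- D0 * e)"
      proof -
        have "exp (- e) \<le> 1 / real n" using e1(3) n0 by (simp add: exp_minus field_simps)
        then have "q * (exp (- e) * exp (- D0 * e)) \<le> q * (1 / real n * exp (- D0 * e))"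
          using q by (intro mult_left_mono mult_right_mono) auto
        moreover have "exp (- e) * exp (- D0 * e) = exp (- (D0 + 1) * e)"
          unfolding exp_add[symmetric] by (simp add: algebra_simps)
        ultimately show ?thesis by (simp only: times_divide_eq_left times_divide_eq_right mult_1_left)
      qed
      then have "(q * exp (- (D0 + 1) * e))\<^sup>2 \<le> (q / real n * exp (- D0 * e))\<^sup>2"
        using q by (intro power_mono) auto
      then have "2 * \<eta> / (q / real n * exp (- D0 * e))\<^sup>2 \<le> 2 * \<eta> / (q * exp (- (D0 + 1) * e))\<^sup>2"
        using q n0 by (intro divide_left_mono) (auto simp: \<eta>_def intro!: mult_pos_pos)
      also have "\<dots> = 2 / q\<^sup>2 * (\<eta> / exp (2 * (- (D0 + 1) * e)))"
        by (simp only: power_mult_distrib exp_double) simp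
      also have "\<eta> / exp (2 * (- (D0 + 1) * e)) = exp (- e)"
        by (simp add: \<eta>_def exp_diff[symmetric] algebra_simps)
      finally show "2 * \<eta> / (q / real n * exp (- D0 * e))\<^sup>2 \<le> 2 / q\<^sup>2 * exp (- e)" .
      have "(exp (- D' * e) + \<chi>) / (\<delta> * \<eta>) \<le> (2 * exp (- D' * e)) / (\<delta> * \<eta>)"
        using chi \<delta> by (intro divide_right_mono) (auto simp: \<eta>_def)
      also have "\<dots> = 2 / \<delta> * (exp (- D' * e) / \<eta>)" by simp
      also have "exp (- D' * e) / \<eta> = exp (- e)"
        by (simp add: \<eta>_def D'_def exp_diff[symmetric] algebra_simps)
      finally show "(exp (- D' * e) + \<chi>) / (\<delta> * \<eta>) \<le> 2 / \<delta> * exp (- e)" .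
    qed
    also have "\<dots> = (1 + 2 / q\<^sup>2 + 2 / \<delta>) * exp (- E n)" by (simp add: e_def algebra_simps)
    finally have "measure (data_law n \<sigma> (f0 n)) {y \<in> space (data_law n \<sigma> (f0 n)). \<delta> \<le> measure (posterior_unknown_var Q n (P n) y) ?A}
      \<le> (1 + 2 / q\<^sup>2 + 2 / \<delta>) * exp (- E n)" .
    moreover have "{y \<in> space (data_law n \<sigma> (f0 n)). \<delta> \<le> measure (post n (P n) y) ?A}
        = {y \<in> space (data_law n \<sigma> (f0 n)). \<delta> \<le> measure (posterior_unknown_var Q n (P n) y) ?A}"
    proof (intro Collect_cong conj_cong refl)
      fix y assume "y \<in> space (data_law n \<sigma> (f0 n))"
      then have "y \<in> space (fun_space n)" by (simp add: space_data_law space_PiM)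
      then show "(\<delta> \<le> measure (post n (P n) y) ?A) = (\<delta> \<le> measure (posterior_unknown_var Q n (P n) y) ?A)"
        using post[of "P n" n y ?A] elim A_sets by simp
    qed
    ultimately show ?case by simp
  qed
  have lim: "((\<lambda>n. (1 + 2 / q\<^sup>2 + 2 / \<delta>) * exp (- E n)) \<longlongrightarrow> 0) F" for \<delta>
  proof -
    have "filterlim (\<lambda>n. - E n) at_bot F" using E(1) by (simp add: filterlim_uminus_at_bot)
    then have "((\<lambda>n. exp (- E n)) \<longlongrightarrow> 0) F" by (rule filterlim_compose[OF exp_at_bot])
    then show ?thesis by (rule tendsto_mult_right_zero)
  qed
  show ?thesis
    unfolding contracts_at_rate_def F_def[symmetric]
  proof (intro exI[of _ M0] conjI allI impI M0)
    fix M \<delta> :: real assume "M \<ge> M0" "\<delta> > 0"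
    from tendsto_sandwich[OF _ main[OF this] tendsto_const lim]
    show "((\<lambda>n. measure (data_law n \<sigma> (f0 n)) {y \<in> space (data_law n \<sigma> (f0 n)).
          \<delta> \<le> measure (post n (P n) y) {f \<in> space (fun_space n). M * \<epsilon> n \<le> norm_n n (\<lambda>i. f i - f0 n i)}}) \<longlongrightarrow> 0) F"
      by simp
  qed
qed

section \<open>Evidence and tails of Gaussian scale mixtures\<close>

lemma emeasure_exp1_law_gt:
  assumes "a \<ge> 0" shows "emeasure exp1_law {a<..} = ennreal (exp (- a))"
proof -
  interpret prob_space exp1_law by (rule prob_space_exp1_law)
  have "distributed exp1_law lborel (\<lambda>x. x) (\<lambda>x. ennreal (exponential_density 1 x))"
    unfolding distributed_def
    by (auto simp: exp1_law_def distr_id2 intro!: measure_eqI)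
  from exponential_distributedD_gt[OF this assms] have "measure exp1_law {a<..} = exp (- a)"
    by (simp add: greaterThan_def)
  then show ?thesis by (simp add: emeasure_eq_measure)
qed

lemma AE_exp1_law_pos: "AE c in exp1_law. c > 0"
  unfolding exp1_law_def
  by (subst AE_density) (use AE_lborel_singleton[of 0] in \<open>auto elim!: eventually_mono simp: exponential_density_def\<close>)

text \<open>On an interval of length at least 1 the density stays above exp(- 2 I). Asking the scale
  \<open>c\<close> to be of order I thus costs an exponent linear in I, no more than the evidence
  exponent allows.\<close>

lemma emeasure_exp1_law_Icc:
  assumes "I \<ge> 1" shows "ennreal (exp (- (2 * I))) \<le> emeasure exp1_law {I..2 * I}"
proof -
  have "ennreal (exp (- (2 * I))) \<le> ennreal (exp (- (2 * I))) * emeasure lborel {I..2 * I}"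
    using assms by (simp add: ennreal_mult[symmetric])
  also have "\<dots> = (\<integral>\<^sup>+c. ennreal (exp (- (2 * I))) * indicator {I..2 * I} c \<partial>lborel)"
    by (simp add: nn_integral_cmult_indicator)
  also have "\<dots> \<le> (\<integral>\<^sup>+c. ennreal (exponential_density 1 c) * indicator {I..2 * I} c \<partial>lborel)"
    using assms by (intro nn_integral_mono)
      (auto simp: exponential_density_def split: split_indicator intro!: ennreal_leI)
  also have "\<dots> = emeasure exp1_law {I..2 * I}"
    unfolding exp1_law_def by (rule emeasure_density[symmetric]) auto
  finally show ?thesis .
qed

text \<open>Prior and squared distance are both diagonal in the eigenbasis, so given
  \<open>c\<close> the integral is a product of the one-dimensional integrals of
  \<open>std_normal_exp_shifted_square\<close>. The extra 2 I is the price of restricting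
  \<open>c\<close> to [I, 2 I].\<close>

lemma scale_mixture_evidence:
  assumes U: "orth_mat n U" and v: "\<And>i. (\<lambda>c. v c i) \<in> borel_measurable borel"
    and \<tau>: "\<tau> > 0" and I: "I \<ge> 1"
    and v0: "\<And>c i. I \<le> c \<Longrightarrow> c \<le> 2 * I \<Longrightarrow> i < n \<Longrightarrow> v c i \<ge> 0"
    and R: "\<And>c. I \<le> c \<Longrightarrow> c \<le> 2 * I \<Longrightarrow>
      (\<Sum>i<n. \<tau> * (coef n U f0 i)\<^sup>2 / (1 + 2 * \<tau> * v c i) + ln (1 + 2 * \<tau> * v c i) / 2) \<le> R"
  shows "ennreal (exp (- (2 * I + R))) \<le>
    (\<integral>\<^sup>+f. ennreal (exp (- \<tau> * (\<Sum>i<n. (f i - f0 i)\<^sup>2))) \<partial>(exp1_law \<bind> (\<lambda>c. gaussian n (diagonalized n U (v c)))))"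
proof -
  let ?g = "coef n U f0" and ?D = "data_law n 1 (\<lambda>_. 0)"
  let ?h = "\<lambda>f. ennreal (exp (- \<tau> * (\<Sum>i<n. (f i - f0 i)\<^sup>2)))"
  have h: "?h \<in> borel_measurable (fun_space n)" by measurable
  have rot: "(\<Sum>i<n. (apply_mat n U x i - f0 i)\<^sup>2) = (\<Sum>i<n. (x i - ?g i)\<^sup>2)" for x
  proof -
    have "(\<Sum>i<n. (apply_mat n U x i - f0 i)\<^sup>2) = (\<Sum>i<n. (coef n U (\<lambda>j. apply_mat n U x j - f0 j) i)\<^sup>2)"
      by (simp add: sum_coef_squares[OF U])
    also have "\<dots> = (\<Sum>i<n. (x i - ?g i)\<^sup>2)"
      by (intro sum.cong refl) (simp add: coef_diff coef_apply_mat[OF U])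
    finally show ?thesis .
  qed
  have inner: "ennreal (exp (- R)) \<le> (\<integral>\<^sup>+z. ?h (apply_mat n U (\<lambda>i\<in>{..<n}. sqrt (v c i) * z i)) \<partial>?D)"
    if c: "I \<le> c" "c \<le> 2 * I" for c
  proof -
    have one: "1 + 2 * \<tau> * v c i > 0" if "i < n" for i
      using v0[OF c that] \<tau> by (simp add: add_pos_nonneg)
    have "(\<integral>\<^sup>+z. ?h (apply_mat n U (\<lambda>i\<in>{..<n}. sqrt (v c i) * z i)) \<partial>?D)
        = (\<integral>\<^sup>+z. (\<Prod>i<n. ennreal (exp (- \<tau> * (sqrt (v c i) * z i - ?g i)\<^sup>2))) \<partial>?D)"
      unfolding rot by (intro nn_integral_cong) (simp add: prod_ennreal exp_sum[symmetric] sum_distrib_left sum_negf)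
    also have "\<dots> = (\<Prod>i<n. \<integral>\<^sup>+x. ennreal (std_normal_density x) * ennreal (exp (- \<tau> * (sqrt (v c i) * x - ?g i)\<^sup>2)) \<partial>lborel)"
      by (rule nn_integral_data_law_prod) auto
    also have "\<dots> = (\<Prod>i<n. ennreal (exp (- (\<tau> * (?g i)\<^sup>2 / (1 + 2 * \<tau> * v c i) + ln (1 + 2 * \<tau> * v c i) / 2))))"
    proof (intro prod.cong refl)
      fix i assume "i \<in> {..<n}"
      then have i: "i < n" by simp
      have s: "(sqrt (v c i))\<^sup>2 = v c i" using v0[OF c i] by simp
      have "sqrt (1 + 2 * \<tau> * v c i) = exp (ln (1 + 2 * \<tau> * v c i) / 2)"
        using one[OF i] by (simp add: powr_half_sqrt[symmetric] powr_def)
      then have "exp (- \<tau> * (?g i)\<^sup>2 / (1 + 2 * \<tau> * v c i)) / sqrt (1 + 2 * \<tau> * v c i)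
          = exp (- \<tau> * (?g i)\<^sup>2 / (1 + 2 * \<tau> * v c i) - ln (1 + 2 * \<tau> * v c i) / 2)"
        by (simp only: exp_diff)
      then show "(\<integral>\<^sup>+x. ennreal (std_normal_density x) * ennreal (exp (- \<tau> * (sqrt (v c i) * x - ?g i)\<^sup>2)) \<partial>lborel)
          = ennreal (exp (- (\<tau> * (?g i)\<^sup>2 / (1 + 2 * \<tau> * v c i) + ln (1 + 2 * \<tau> * v c i) / 2)))"
        using std_normal_exp_shifted_square[of \<tau> "sqrt (v c i)" "?g i"] \<tau> by (simp add: s)
    qed
    also have "\<dots> = ennreal (exp (- (\<Sum>i<n. \<tau> * (?g i)\<^sup>2 / (1 + 2 * \<tau> * v c i) + ln (1 + 2 * \<tau> * v c i) / 2)))"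
      by (simp add: prod_ennreal exp_sum[symmetric] sum_negf sum_subtractf sum.distrib)
    also have "\<dots> \<ge> ennreal (exp (- R))" using R[OF c] by (intro ennreal_leI) simp
    finally show ?thesis .
  qed
  have "ennreal (exp (- (2 * I + R))) = ennreal (exp (- R)) * ennreal (exp (- (2 * I)))"
    by (simp add: ennreal_mult[symmetric] exp_add[symmetric])
  also have "\<dots> \<le> ennreal (exp (- R)) * emeasure exp1_law {I..2 * I}"
    by (intro mult_left_mono emeasure_exp1_law_Icc I) auto
  also have "\<dots> = (\<integral>\<^sup>+c. ennreal (exp (- R)) * indicator {I..2 * I} c \<partial>exp1_law)"
    by (simp add: nn_integral_cmult_indicator)
  also have "\<dots> \<le> (\<integral>\<^sup>+c. \<integral>\<^sup>+z. ?h (apply_mat n U (\<lambda>i\<in>{..<n}. sqrt (v c i) * z i)) \<partial>?D \<partial>exp1_law)"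
    using inner by (intro nn_integral_mono) (auto split: split_indicator)
  also have "\<dots> = (\<integral>\<^sup>+f. ?h f \<partial>(exp1_law \<bind> (\<lambda>c. gaussian n (diagonalized n U (v c)))))"
    by (rule nn_integral_scale_mixture[OF U v h, symmetric])
  finally show ?thesis .
qed

text \<open>Follows from (1 + 2 x)(1 - x) >= 1 on [0, 1/2]. It replaces the chi-square Laplace
  transform by an exponential linear in the variance, so that a product over coordinates sees only
  the sum of the variances.\<close>

lemma inverse_sqrt_le_exp:
  fixes x :: real
  assumes "0 \<le> x" "x \<le> 1 / 2"
  shows "1 / sqrt (1 - x) \<le> exp x"
proof -
  have "exp (- (2 * x)) \<le> 1 - x"
  proof -
    have "exp (2 * x) * (1 - x) \<ge> (1 + 2 * x) * (1 - x)"
      using assms exp_ge_add_one_self[of "2 * x"] by (intro mult_right_mono) auto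
    moreover have "(1 + 2 * x) * (1 - x) \<ge> 1"
    proof -
      have "x * (1 - 2 * x) \<ge> 0" using assms by (intro mult_nonneg_nonneg) auto
      then show ?thesis by (simp add: algebra_simps)
    qed
    ultimately have "1 \<le> exp (2 * x) * (1 - x)" by linarith
    then show ?thesis by (simp add: exp_minus field_simps)
  qed
  then have "(exp (- x))\<^sup>2 \<le> (sqrt (1 - x))\<^sup>2"
    using assms by (simp flip: exp_double)
  then have "exp (- x) \<le> sqrt (1 - x)" by (rule power2_le_imp_le) (use assms in simp)
  then show ?thesis using assms by (simp add: exp_minus field_simps)
qed

text \<open>Scales above \<open>c0\<close> have mass exp(- c0). For the others the energy in
  \<open>T\<close> is a weighted sum of squared standard normals, with weights at most
  \<open>b\<close> and total weight at most \<open>V\<close>, and a Chernoff bound at 1 / (4 b)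
  applies. Variances outside \<open>T\<close> are not touched: low frequencies, where the prior may
  be very spread out, are the business of the test.\<close>

lemma scale_mixture_tail:
  assumes U: "orth_mat n U" and v: "\<And>i. (\<lambda>c. v c i) \<in> borel_measurable borel"
    and T: "T \<subseteq> {..<n}" and c0: "c0 \<ge> 0" and b: "b > 0"
    and vb: "\<And>c i. 0 < c \<Longrightarrow> c \<le> c0 \<Longrightarrow> i \<in> T \<Longrightarrow> 0 \<le> v c i \<and> v c i \<le> b"
    and V: "\<And>c. 0 < c \<Longrightarrow> c \<le> c0 \<Longrightarrow> (\<Sum>i\<in>T. v c i) \<le> V"
  defines "P \<equiv> exp1_law \<bind> (\<lambda>c. gaussian n (diagonalized n U (v c)))"
  shows "emeasure P {f \<in> space P. x < (\<Sum>i\<in>T. (coef n U f i)\<^sup>2)} \<le> ennreal (exp (- c0) + exp ((2 * V - x) / (4 * b)))"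
    (is "emeasure P ?S \<le> _")
proof -
  let ?D = "data_law n 1 (\<lambda>_. 0)" and ?t = "1 / (4 * b)"
  interpret E: prob_space exp1_law by (rule prob_space_exp1_law)
  interpret D: prob_space ?D by (rule prob_space_data_law) simp
  have fin: "finite T" using T finite_subset by blast
  have setsP: "sets P = sets (fun_space n)" unfolding P_def by (rule sets_scale_mixture[OF U v])
  have spP: "space P = space (fun_space n)" by (rule sets_eq_imp_space_eq[OF setsP])
  have S: "?S \<in> sets (fun_space n)"
    unfolding spP using measurable_coef_sum[OF T, of U] by measurable
  let ?f = "\<lambda>c z. apply_mat n U (\<lambda>i\<in>{..<n}. sqrt (v c i) * z i)"
  have inner: "(\<integral>\<^sup>+z. indicator ?S (?f c z) \<partial>?D) \<le> ennreal (exp ((2 * V - x) / (4 * b)))"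
    if c: "0 < c" "c \<le> c0" for c
  proof -
    define h where "h i z = (if i \<in> T then ennreal (exp (?t * v c i * z\<^sup>2)) else 1)" for i and z :: real
    have h [measurable]: "h i \<in> borel_measurable borel" for i unfolding h_def by measurable
    have bound: "indicator ?S (?f c z) \<le> ennreal (exp (- ?t * x)) * (\<Prod>i<n. h i (z i))" for z
    proof (cases "?f c z \<in> ?S")
      case True
      have "(\<Prod>i<n. h i (z i)) = (\<Prod>i\<in>T. ennreal (exp (?t * v c i * (z i)\<^sup>2)))"
        unfolding h_def using T by (subst prod.If_cases) (auto simp: Int_absorb1 Int_absorb2 Int_commute)
      also have "\<dots> = ennreal (exp (?t * (\<Sum>i\<in>T. v c i * (z i)\<^sup>2)))"
        using fin by (simp add: prod_ennreal exp_sum[symmetric] sum_distrib_left mult.assoc)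
      finally have "ennreal (exp (- ?t * x)) * (\<Prod>i<n. h i (z i))
          = ennreal (exp (- ?t * x + ?t * (\<Sum>i\<in>T. v c i * (z i)\<^sup>2)))"
        unfolding exp_add by (simp only: ennreal_mult exp_ge_zero)
      moreover have "(\<Sum>i\<in>T. (coef n U (?f c z) i)\<^sup>2) = (\<Sum>i\<in>T. v c i * (z i)\<^sup>2)"
        using T vb[OF c] by (intro sum.cong refl) (auto simp: coef_apply_mat[OF U] power_mult_distrib)
      then have "x < (\<Sum>i\<in>T. v c i * (z i)\<^sup>2)" using True by simp
      then have "- ?t * x + ?t * (\<Sum>i\<in>T. v c i * (z i)\<^sup>2) \<ge> 0"
        using b by (simp add: divide_right_mono)
      ultimately show ?thesis using True by (simp add: ennreal_ge_1)
    qed simp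
    have "(\<integral>\<^sup>+z. (\<Prod>i<n. h i (z i)) \<partial>?D) = (\<Prod>i<n. \<integral>\<^sup>+z. ennreal (std_normal_density z) * h i z \<partial>lborel)"
      by (rule nn_integral_data_law_prod) auto
    also have "\<dots> \<le> (\<Prod>i<n. if i \<in> T then ennreal (exp (2 * ?t * v c i)) else 1)"
    proof (intro prod_mono_ennreal)
      fix i assume "i \<in> {..<n}"
      show "(\<integral>\<^sup>+z. ennreal (std_normal_density z) * h i z \<partial>lborel) \<le> (if i \<in> T then ennreal (exp (2 * ?t * v c i)) else 1)"
      proof (cases "i \<in> T")
        case True
        \<comment> \<open>The uniform bound \<open>b\<close> keeps the argument in [0, 1/2], the
          range of \<open>inverse_sqrt_le_exp\<close>.\<close>
        have le: "0 \<le> 2 * ?t * v c i" "2 * ?t * v c i \<le> 1 / 2"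
          using vb[OF c True] b by (simp_all add: field_simps)
        have "(\<integral>\<^sup>+z. ennreal (std_normal_density z) * h i z \<partial>lborel) = ennreal (1 / sqrt (1 - 2 * (?t * v c i) * 1\<^sup>2))"
          unfolding h_def using True le by (simp only: if_True, intro normal_exp_square) auto
        also have "\<dots> \<le> ennreal (exp (2 * ?t * v c i))"
          using inverse_sqrt_le_exp[OF le] by (intro ennreal_leI) (simp add: mult.assoc)
        finally show ?thesis using True by simp
      qed (simp add: h_def nn_integral_normal_density)
    qed
    also have "\<dots> = ennreal (exp (2 * ?t * (\<Sum>i\<in>T. v c i)))"
    proof -
      have "(\<Prod>i<n. if i \<in> T then ennreal (exp (2 * ?t * v c i)) else 1) = (\<Prod>i\<in>T. ennreal (exp (2 * ?t * v c i)))"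
        using T by (subst prod.If_cases) (auto simp: Int_absorb1 Int_absorb2 Int_commute)
      also have "\<dots> = ennreal (exp (2 * ?t * (\<Sum>i\<in>T. v c i)))"
        using fin by (simp only: prod_ennreal exp_ge_zero exp_sum[symmetric] sum_distrib_left)
      finally show ?thesis .
    qed
    also have "\<dots> \<le> ennreal (exp (2 * ?t * V))"
      using V[OF c] b by (intro ennreal_leI) (simp add: divide_right_mono)
    finally have prod_le: "(\<integral>\<^sup>+z. (\<Prod>i<n. h i (z i)) \<partial>?D) \<le> ennreal (exp (2 * ?t * V))" .
    have "(\<integral>\<^sup>+z. indicator ?S (?f c z) \<partial>?D) \<le> (\<integral>\<^sup>+z. ennreal (exp (- ?t * x)) * (\<Prod>i<n. h i (z i)) \<partial>?D)"
      by (intro nn_integral_mono bound)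
    also have "\<dots> = ennreal (exp (- ?t * x)) * (\<integral>\<^sup>+z. (\<Prod>i<n. h i (z i)) \<partial>?D)"
      by (rule nn_integral_cmult) (simp add: measurable_cong_sets[OF sets_data_law refl])
    also have "\<dots> \<le> ennreal (exp (- ?t * x)) * ennreal (exp (2 * ?t * V))"
      by (intro mult_left_mono prod_le) simp
    also have "ennreal (exp (- ?t * x)) * ennreal (exp (2 * ?t * V)) = ennreal (exp ((2 * V - x) / (4 * b)))"
    proof -
      have "(2 * V - x) / (4 * b) = - ?t * x + 2 * ?t * V" by (simp add: diff_divide_distrib)
      then show ?thesis by (simp only: exp_add ennreal_mult exp_ge_zero)
    qed
    finally show ?thesis .
  qed
  have le1: "(\<integral>\<^sup>+z. indicator ?S (?f c z) \<partial>?D) \<le> 1" for c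
  proof -
    have "(\<integral>\<^sup>+z. indicator ?S (?f c z) \<partial>?D) \<le> (\<integral>\<^sup>+z. 1 \<partial>?D)"
      by (intro nn_integral_mono) (simp split: split_indicator)
    then show ?thesis by (simp add: D.emeasure_space_1)
  qed
  have "emeasure P ?S = (\<integral>\<^sup>+f. indicator ?S f \<partial>P)" using S setsP by simp
  also have "\<dots> = (\<integral>\<^sup>+c. \<integral>\<^sup>+z. indicator ?S (?f c z) \<partial>?D \<partial>exp1_law)"
    unfolding P_def by (rule nn_integral_scale_mixture[OF U v]) (use S P_def in \<open>auto intro!: borel_measurable_indicator\<close>)
  also have "\<dots> \<le> (\<integral>\<^sup>+c. indicator {c0<..} c + ennreal (exp ((2 * V - x) / (4 * b))) \<partial>exp1_law)"
  proof (rule nn_integral_mono_AE, use AE_exp1_law_pos in eventually_elim)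
    fix c :: real assume "c > 0"
    then show "(\<integral>\<^sup>+z. indicator ?S (?f c z) \<partial>?D) \<le> indicator {c0<..} c + ennreal (exp ((2 * V - x) / (4 * b)))"
      using inner[of c] le1[of c] by (cases "c \<le> c0") (auto simp: add_increasing2)
  qed
  also have "\<dots> = emeasure exp1_law {c0<..} + ennreal (exp ((2 * V - x) / (4 * b)))"
    by (subst nn_integral_add) (auto simp: E.emeasure_space_1[simplified])
  also have "\<dots> = ennreal (exp (- c0) + exp ((2 * V - x) / (4 * b)))"
    by (simp add: emeasure_exp1_law_gt[OF c0])
  finally show ?thesis .
qed

section \<open>Elementary sums over frequencies\<close>

text \<open>For m >= 1 this is m^m / m! <= e^m, a crude Stirling bound obtained from m ln(1 + 1/m)
  <= 1. It makes the logarithms of the variances up to frequency I add up to O(I) instead of I ln n;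
  this is why the power prior attains its rate without a logarithmic factor.\<close>

lemma sum_ln_ratio_le: "(\<Sum>i=1..m. ln (real m / real i)) \<le> real m"
proof (induction m)
  case (Suc m)
  show ?case
  proof (cases "m = 0")
    case False
    have "(\<Sum>i=1..Suc m. ln (real (Suc m) / real i)) = (\<Sum>i=1..m. ln (real (Suc m) / real i))" by simp
    also have "\<dots> = (\<Sum>i=1..m. ln (real m / real i) + ln (real (Suc m) / real m))"
    proof (rule sum.cong[OF refl])
      fix i assume "i \<in> {1..m}"
      then have "real (Suc m) / real i = real m / real i * (real (Suc m) / real m)" using False by simp
      then show "ln (real (Suc m) / real i) = ln (real m / real i) + ln (real (Suc m) / real m)"
        using \<open>i \<in> {1..m}\<close> False by (simp only: ln_mult) (auto simp: ln_mult)
    qed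
    also have "\<dots> = (\<Sum>i=1..m. ln (real m / real i)) + real m * ln (1 + 1 / real m)"
      using False by (simp add: sum.distrib add_divide_distrib add.commute)
    also have "real m * ln (1 + 1 / real m) \<le> real m * (1 / real m)"
      by (intro mult_left_mono ln_add_one_self_le_self) auto
    also have "\<dots> = 1" using False by simp
    finally show ?thesis using Suc by simp
  qed simp
qed simp

text \<open>The mean value theorem in place of a comparison with the integral of x^(-q); the right
  side is made to telescope.\<close>

lemma powr_diff_ge:
  fixes q :: real
  assumes q: "q > 1" and i: "i \<ge> (2 :: nat)"
  shows "real i powr (- q) \<le> (real (i - 1) powr (1 - q) - real i powr (1 - q)) / (q - 1)"
proof -
  have lt: "real (i - 1) < real i" using i by simp
  have "\<exists>z>real (i - 1). z < real i \<and> real i powr (1 - q) - real (i - 1) powr (1 - q)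
      = (real i - real (i - 1)) * ((1 - q) * z powr (1 - q - 1))"
  proof (rule MVT2[OF lt])
    fix x :: real assume "real (i - 1) \<le> x"
    moreover have "0 < real (i - 1)" using i by simp
    ultimately have "x > 0" by linarith
    then show "DERIV (\<lambda>x. x powr (1 - q)) x :> (1 - q) * x powr (1 - q - 1)"
      by (rule has_real_derivative_powr)
  qed
  then obtain z where z: "real (i - 1) < z" "z < real i"
    and eq: "real i powr (1 - q) - real (i - 1) powr (1 - q) = (real i - real (i - 1)) * ((1 - q) * z powr (1 - q - 1))"
    by blast
  have exponent: "1 - q - 1 = - q" by simp
  have step: "real i - real (i - 1) = 1" using i by simp
  have "real i powr (1 - q) - real (i - 1) powr (1 - q) = 1 * ((1 - q) * z powr (- q))"
    using eq unfolding exponent step .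
  moreover have "(q - 1) * z powr (- q) = - (1 * ((1 - q) * z powr (- q)))" by (simp add: left_diff_distrib)
  ultimately have "real (i - 1) powr (1 - q) - real i powr (1 - q) = (q - 1) * z powr (- q)" by linarith
  moreover have "real i powr (- q) \<le> z powr (- q)"
    using z q by (intro powr_mono2') auto
  ultimately show ?thesis using q by (simp add: pos_le_divide_eq mult.commute)
qed

lemma sum_powr_tail_le:
  fixes q :: real
  assumes q: "q > 1" and m: "m \<ge> (1 :: nat)"
  shows "(\<Sum>i\<in>{m<..M}. real i powr (- q)) \<le> real m powr (1 - q) / (q - 1)"
proof (cases "m \<le> M")
  case True
  then have "(\<Sum>i\<in>{m<..M}. real i powr (- q)) \<le> (real m powr (1 - q) - real M powr (1 - q)) / (q - 1)"
  proof (induction M rule: dec_induct)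
    case (step M)
    have "{m<..Suc M} = insert (Suc M) {m<..M}" using step by auto
    then show ?case
      using step powr_diff_ge[OF q, of "Suc M"] m by (simp add: diff_divide_distrib)
  qed simp
  also have "\<dots> \<le> real m powr (1 - q) / (q - 1)" using q by (intro divide_right_mono) auto
  finally show ?thesis .
qed (use q in simp)

text \<open>As I is real, the first index is its ceiling; that single term is at most 1 <= I and
  accounts for the summand 1 in the constant.\<close>

lemma sum_ratio_powr_tail_le:
  fixes q I :: real
  assumes q: "q > 1" and I: "I \<ge> 1"
  shows "(\<Sum>i\<in>{i. i < n \<and> I \<le> real i}. (I / real i) powr q) \<le> (1 + 1 / (q - 1)) * I"
proof -
  define m where "m = nat \<lceil>I\<rceil>"
  have m: "m \<ge> 1" "I \<le> real m" using I by (auto simp: m_def) linarith+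
  have sub: "{i. i < n \<and> I \<le> real i} \<subseteq> insert m {m<..n}"
  proof
    fix i assume "i \<in> {i. i < n \<and> I \<le> real i}"
    then have "i < n" "I \<le> real i" by auto
    then have "m \<le> i" unfolding m_def by linarith
    then show "i \<in> insert m {m<..n}" using \<open>i < n\<close> by auto
  qed
  have "(\<Sum>i\<in>{i. i < n \<and> I \<le> real i}. (I / real i) powr q) \<le> (\<Sum>i\<in>insert m {m<..n}. (I / real i) powr q)"
    using sub by (intro sum_mono2) auto
  also have "\<dots> = (I / real m) powr q + (\<Sum>i\<in>{m<..n}. I powr q * real i powr (- q))"
    using I by (simp add: powr_divide powr_minus field_simps)
  also have "(I / real m) powr q \<le> 1"
    using I m q by (intro powr_le1) auto
  also have "(\<Sum>i\<in>{m<..n}. I powr q * real i powr (- q)) \<le> I powr q * (real m powr (1 - q) / (q - 1))"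
    unfolding sum_distrib_left[symmetric] by (intro mult_left_mono sum_powr_tail_le q m) auto
  also have "\<dots> \<le> I powr q * (I powr (1 - q) / (q - 1))"
    using I m q by (intro mult_left_mono divide_right_mono powr_mono2') auto
  also have "\<dots> = I / (q - 1)" using I by (simp flip: powr_add)
  finally show ?thesis using I by (simp add: algebra_simps)
qed

section \<open>Spectrum of the Laplacian\<close>

lemma laplacian_carrier [simp]: "laplacian n G \<in> carrier_mat n n"
  by (auto simp: laplacian_def degree_mat_def adjacency_mat_def mat_diag_def)

lemma index_laplacian:
  "i < n \<Longrightarrow> j < n \<Longrightarrow> laplacian n G $$ (i, j) =
    (if i = j then real (out_degree (with_proj G) i) else 0) - (if (i, j) \<in> parcs G then 1 else 0)"
  by (simp add: laplacian_def degree_mat_def adjacency_mat_def mat_diag_def)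

lemma parcs_sym:
  assumes "pair_graph G" shows "(i, j) \<in> parcs G \<longleftrightarrow> (j, i) \<in> parcs G"
proof -
  interpret pair_graph G by fact
  have "sym (parcs G)" using sym_arcs by (simp add: symmetric_def)
  then show ?thesis by (auto dest: symD)
qed

lemma laplacian_symmetric:
  assumes "pair_graph G" shows "transpose_mat (laplacian n G) = laplacian n G"
proof -
  have dims: "dim_row (laplacian n G) = n" "dim_col (laplacian n G) = n"
    using laplacian_carrier[of n G] by (auto simp del: laplacian_carrier)
  show ?thesis
    by (rule eq_matI) (auto simp: dims index_laplacian parcs_sym[OF assms])
qed

lemma out_degree_eq_sum:
  fixes G :: "nat pair_pre_digraph"
  assumes "pair_graph G" "pverts G = {..<n}"
  shows "real (out_degree (with_proj G) i) = (\<Sum>j<n. if (i, j) \<in> parcs G then 1 else 0)"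
proof -
  interpret pair_graph G by fact
  have "out_arcs (with_proj G) i = (\<lambda>j. (i, j)) ` {j. j < n \<and> (i, j) \<in> parcs G}"
    using arc_snd_in_verts assms(2) by (force simp: out_arcs_def)
  then have "card (out_arcs (with_proj G) i) = card {j. j < n \<and> (i, j) \<in> parcs G}"
    by (simp add: card_image inj_on_def)
  moreover have "{j. j < n \<and> (i, j) \<in> parcs G} = {..<n} \<inter> {j. (i, j) \<in> parcs G}" by auto
  moreover have "(\<Sum>j<n. if (i, j) \<in> parcs G then 1 else 0 :: real) = real (card ({..<n} \<inter> {j. (i, j) \<in> parcs G}))"
    by (subst sum.If_cases) auto
  ultimately show ?thesis by (simp only: out_degree_def)
qed

text \<open>The Dirichlet form: twice the quadratic form is the sum of (f i - f j)^2 over ordered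
  adjacent pairs, because the row sums of the adjacency matrix are the degrees.\<close>

lemma laplacian_quadratic_form_nonneg:
  assumes "pair_graph G" "pverts G = {..<n}"
  shows "0 \<le> (\<Sum>i<n. f i * apply_mat n (laplacian n G) f i)"
proof -
  define a where "a i j = (if (i, j) \<in> parcs G then 1 else 0 :: real)" for i j
  have sym: "a i j = a j i" for i j using parcs_sym[OF assms(1), of i j] by (simp add: a_def)
  have "(\<Sum>i<n. f i * apply_mat n (laplacian n G) f i)
      = (\<Sum>i<n. f i * (\<Sum>j<n. (if i = j then real (out_degree (with_proj G) i) else 0) * f j - a i j * f j))"
    by (intro sum.cong refl) (simp add: apply_mat_nth index_laplacian a_def left_diff_distrib)
  also have "\<dots> = (\<Sum>i<n. (\<Sum>j<n. a i j * (f i)\<^sup>2) - (\<Sum>j<n. a i j * (f i * f j)))"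
  proof (intro sum.cong refl)
    fix i assume i: "i \<in> {..<n}"
    have "(\<Sum>j<n. (if i = j then real (out_degree (with_proj G) i) else 0) * f j) = real (out_degree (with_proj G) i) * f i"
      using i by (simp add: if_distrib[of "\<lambda>x. x * _"] cong: if_cong)
    also have "\<dots> = (\<Sum>j<n. a i j) * f i" unfolding out_degree_eq_sum[OF assms] a_def ..
    finally show "f i * (\<Sum>j<n. (if i = j then real (out_degree (with_proj G) i) else 0) * f j - a i j * f j)
        = (\<Sum>j<n. a i j * (f i)\<^sup>2) - (\<Sum>j<n. a i j * (f i * f j))"
      by (simp add: sum_subtractf right_diff_distrib sum_distrib_left sum_distrib_right power2_eq_square mult_ac)
  qed
  also have "\<dots> = (\<Sum>i<n. \<Sum>j<n. a i j * (f i)\<^sup>2) - (\<Sum>i<n. \<Sum>j<n. a i j * (f i * f j))"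
    by (simp add: sum_subtractf)
  finally have eq: "(\<Sum>i<n. f i * apply_mat n (laplacian n G) f i)
    = (\<Sum>i<n. \<Sum>j<n. a i j * (f i)\<^sup>2) - (\<Sum>i<n. \<Sum>j<n. a i j * (f i * f j))" .
  have swap: "(\<Sum>i<n. \<Sum>j<n. a i j * (f i)\<^sup>2) = (\<Sum>i<n. \<Sum>j<n. a i j * (f j)\<^sup>2)"
    by (subst sum.swap) (simp add: sym)
  have "0 \<le> (\<Sum>i<n. \<Sum>j<n. a i j * (f i - f j)\<^sup>2)"
    by (intro sum_nonneg) (simp add: a_def)
  also have "\<dots> = (\<Sum>i<n. \<Sum>j<n. a i j * (f i)\<^sup>2 + a i j * (f j)\<^sup>2 - 2 * (a i j * (f i * f j)))"
    by (intro sum.cong refl) (simp add: power2_eq_square algebra_simps)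
  also have "\<dots> = (\<Sum>i<n. \<Sum>j<n. a i j * (f i)\<^sup>2) + (\<Sum>i<n. \<Sum>j<n. a i j * (f j)\<^sup>2) - 2 * (\<Sum>i<n. \<Sum>j<n. a i j * (f i * f j))"
    by (simp only: sum_subtractf sum.distrib sum_distrib_left)
  finally show ?thesis using eq swap by linarith
qed

lemma coef_nth:
  assumes "orth_mat n U" "k < n" shows "coef n U f k = (\<Sum>i<n. U $$ (i, k) * f i)"
  using orth_matD(1)[OF assms(1)] assms(2) by (simp add: coef_def apply_mat_nth)

lemma quadratic_form_diagonalized:
  assumes U: "orth_mat n U"
  shows "(\<Sum>i<n. f i * apply_mat n (diagonalized n U d) f i) = (\<Sum>k<n. d k * (coef n U f k)\<^sup>2)"
proof -
  have "(\<Sum>i<n. f i * apply_mat n (diagonalized n U d) f i)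
      = (\<Sum>i<n. \<Sum>k<n. (d k * coef n U f k) * (U $$ (i, k) * f i))"
    unfolding apply_mat_diagonalized[OF U]
    by (intro sum.cong refl) (simp add: apply_mat_nth sum_distrib_left mult_ac)
  also have "\<dots> = (\<Sum>k<n. \<Sum>i<n. (d k * coef n U f k) * (U $$ (i, k) * f i))"
    by (rule sum.swap)
  also have "\<dots> = (\<Sum>k<n. d k * (coef n U f k)\<^sup>2)"
  proof (rule sum.cong[OF refl])
    fix k assume "k \<in> {..<n}"
    then have "(\<Sum>i<n. U $$ (i, k) * f i) = coef n U f k" using coef_nth[OF U] by simp
    then show "(\<Sum>i<n. (d k * coef n U f k) * (U $$ (i, k) * f i)) = d k * (coef n U f k)\<^sup>2"
      by (simp add: sum_distrib_left[symmetric] power2_eq_square)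
  qed
  finally show ?thesis .
qed

text \<open>Nonnegativity of the k-th eigenvalue comes from evaluating the Dirichlet form at column
  \<open>k\<close> of \<open>U\<close>, whose only nonzero coefficient is the k-th one.\<close>

lemma laplacian_diagonalization:
  assumes G: "pair_graph G" "pverts G = {..<n}"
  obtains U where "orth_mat n U" "laplacian n G = diagonalized n U (laplacian_eigenvalue n G)"
    "\<And>i j. i \<le> j \<Longrightarrow> j < n \<Longrightarrow> laplacian_eigenvalue n G i \<le> laplacian_eigenvalue n G j"
    "\<And>i. i < n \<Longrightarrow> 0 \<le> laplacian_eigenvalue n G i"
proof -
  let ?lam = "laplacian_eigenvalue n G"
  have lam: "?lam = (\<lambda>i. eigenvalue_list (laplacian n G) ! i)"
    by (rule ext) (rule laplacian_eigenvalue_def)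
  obtain U where U: "orth_mat n U" and L: "laplacian n G = diagonalized n U ?lam"
    and len: "length (eigenvalue_list (laplacian n G)) = n" and srt: "sorted (eigenvalue_list (laplacian n G))"
    using ex_sorted_diagonalization[OF laplacian_carrier laplacian_symmetric[OF G(1)]] unfolding lam by blast
  have mono: "?lam i \<le> ?lam j" if "i \<le> j" "j < n" for i j
    unfolding lam using srt len that by (intro sorted_nth_mono) auto
  have nonneg: "0 \<le> ?lam k" if k: "k < n" for k
  proof -
    define f where "f i = U $$ (i, k)" for i
    have "0 \<le> (\<Sum>i<n. f i * apply_mat n (laplacian n G) f i)"
      by (rule laplacian_quadratic_form_nonneg[OF G])
    also have "\<dots> = (\<Sum>m<n. ?lam m * (coef n U f m)\<^sup>2)"
      unfolding L by (rule quadratic_form_diagonalized[OF U])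
    also have "\<dots> = (\<Sum>m<n. if m = k then ?lam m else 0)"
      using k by (intro sum.cong refl) (simp add: coef_nth[OF U] f_def orth_mat_cols[OF U])
    finally show ?thesis using k by simp
  qed
  show thesis by (rule that[OF U L mono nonneg])
qed

text \<open>The factor n on the right is the normalisation of \<open>inner_n\<close>, since the
  coefficients belong to the Euclidean product.\<close>

lemma sobolev_ball_coef:
  assumes U: "orth_mat n U" and L: "laplacian n G = diagonalized n U lam" and n: "n > 0"
    and f: "f \<in> sobolev_ball n G r \<beta> C"
  shows "(\<Sum>i<n. (1 + (real n powr (2 / r) * lam i) powr \<beta>) * (coef n U f i)\<^sup>2) \<le> real n * C\<^sup>2"
proof -
  have "1\<^sub>m n + mat_powr ((real n powr (2 / r)) \<cdot>\<^sub>m laplacian n G) \<beta>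
      = diagonalized n U (\<lambda>i. 1 + (real n powr (2 / r) * lam i) powr \<beta>)"
    unfolding L by (simp add: smult_diagonalized[OF U] spectral_fun_diagonalized[OF U]
        one_diagonalized[OF U] add_diagonalized[OF U])
  then have "(\<Sum>i<n. (1 + (real n powr (2 / r) * lam i) powr \<beta>) * (coef n U f i)\<^sup>2) / real n \<le> C\<^sup>2"
    using f by (simp add: sobolev_ball_def inner_n_def quadratic_form_diagonalized[OF U])
  then show ?thesis using n by (simp add: pos_divide_le_eq mult.commute)
qed

lemma power_cov_diagonalized:
  assumes U: "orth_mat n U" and L: "laplacian n G = diagonalized n U lam"
  shows "power_cov n G r \<alpha> c = diagonalized n U
    (\<lambda>i. inverse (((real n / c) powr (2 / r) * (lam i + 1 / (real n)\<^sup>2)) powr (\<alpha> + r / 2)))"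
  unfolding power_cov_def L
  by (simp add: smult_diagonalized[OF U] spectral_fun_diagonalized[OF U]
      one_diagonalized[OF U] add_diagonalized[OF U])

lemma exponential_cov_diagonalized:
  assumes U: "orth_mat n U" and L: "laplacian n G = diagonalized n U lam"
  shows "exponential_cov n G r c = diagonalized n U (\<lambda>i. real n * exp (- ((real n / c) powr (2 / r)) * lam i))"
  unfolding exponential_cov_def L
  by (simp add: smult_diagonalized[OF U] spectral_fun_diagonalized[OF U])

text \<open>The geometry condition stops at frequency \<kappa>0 n. Monotonicity of the sorted
  eigenvalues extends the lower bound to all larger indices: an index beyond the range is compared
  with the last one inside, which is smaller by a bounded factor only.\<close>

lemma eigenvalue_lower_bound:
  assumes r: "r \<ge> 1" and gs: "graph_sequence N G" and geo: "geometry_condition N G r"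
  obtains i1 c where "i1 \<ge> (1 :: nat)" "c > 0"
    "\<forall>\<^sub>F n in at_top_along N. \<forall>i. i1 \<le> i \<and> i < n \<longrightarrow>
       c * (real i / real n) powr (2 / r) \<le> laplacian_eigenvalue n (G n) i"
proof -
  obtain i0 \<kappa>0 C1 C2 where *: "0 < \<kappa>0" "\<kappa>0 \<le> 1" "0 < C1" "0 < C2"
    and ev: "\<forall>\<^sub>F n in at_top_along N. \<forall>i::nat.
           i0 \<le> i \<and> real i \<le> \<kappa>0 * real n \<and> i \<le> n - 1 \<longrightarrow>
             C1 * (real i / real n) powr (2 / r) \<le> laplacian_eigenvalue n (G n) i \<and>
             laplacian_eigenvalue n (G n) i \<le> C2 * (real i / real n) powr (2 / r)"
    using geo unfolding geometry_condition_def by blast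
  define i1 where "i1 = max i0 1"
  have le: "at_top_along N \<le> sequentially" by simp
  \<comment> \<open>This makes the rounded-down \<kappa>0 n at least \<open>i0\<close> and at least
    half of \<kappa>0 n.\<close>
  have large: "\<forall>\<^sub>F n in at_top_along N. real (Suc i1) + 1 \<le> \<kappa>0 * real n"
  proof (rule filter_leD[OF le])
    have "\<forall>\<^sub>F n in sequentially. (real (Suc i1) + 1) / \<kappa>0 \<le> real n"
      using filterlim_real_sequentially by (simp add: filterlim_at_top)
    then show "\<forall>\<^sub>F n in sequentially. real (Suc i1) + 1 \<le> \<kappa>0 * real n"
      by eventually_elim (use * in \<open>simp add: pos_divide_le_eq mult.commute\<close>)
  qed
  have inN: "\<forall>\<^sub>F n in at_top_along N. n \<in> N"
    by (simp add: eventually_inf_principal)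
  have "\<forall>\<^sub>F n in at_top_along N. \<forall>i. i1 \<le> i \<and> i < n \<longrightarrow>
       C1 * (\<kappa>0 / 2) powr (2 / r) * (real i / real n) powr (2 / r) \<le> laplacian_eigenvalue n (G n) i"
    using ev large inN
  proof eventually_elim
    case (elim n)
    have G: "pair_graph (G n)" "pverts (G n) = {..<n}"
      using gs elim(3) unfolding graph_sequence_def by auto
    have mono: "laplacian_eigenvalue n (G n) i \<le> laplacian_eigenvalue n (G n) j" if "i \<le> j" "j < n" for i j
      by (rule laplacian_diagonalization[OF G]) (use that in blast)
    show ?case
    proof (intro allI impI)
      fix i assume i: "i1 \<le> i \<and> i < n"
      \<comment> \<open>The comparison index; it satisfies j >= (\<kappa>0 / 2) i, which explains
        the factor (\<kappa>0 / 2)^(2/r) in the constant.\<close>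
      define j where "j = min i (nat \<lfloor>\<kappa>0 * real n\<rfloor>)"
      have n0: "real n > 0" using i by simp
      have fl: "real (nat \<lfloor>\<kappa>0 * real n\<rfloor>) \<le> \<kappa>0 * real n" "\<kappa>0 * real n - 1 \<le> real (nat \<lfloor>\<kappa>0 * real n\<rfloor>)"
        using * n0 by (auto simp: le_floor_iff)
      have kap: "\<kappa>0 * real i \<le> \<kappa>0 * real n" using i * by simp
      have "real i0 \<le> real i1" by (simp add: i1_def)
      then have "real i0 \<le> real (nat \<lfloor>\<kappa>0 * real n\<rfloor>)"
        using fl(2) elim(2) unfolding of_nat_Suc by linarith
      then have j_ge: "i0 \<le> j" using i by (simp add: j_def i1_def)
      have "real j \<le> real (nat \<lfloor>\<kappa>0 * real n\<rfloor>)" by (simp add: j_def)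
      then have j_le: "real j \<le> \<kappa>0 * real n" using fl(1) by (rule order_trans)
      have j_i: "j \<le> i" by (simp add: j_def)
      then have j_n: "j \<le> n - 1" using i by linarith
      have j2: "\<kappa>0 / 2 * real i \<le> real j"
      proof (cases "j = i")
        case True
        then show ?thesis using * mult_right_mono[of "\<kappa>0 / 2" 1 "real i"] by simp
      next
        case False
        then have "real j = real (nat \<lfloor>\<kappa>0 * real n\<rfloor>)" by (simp add: j_def min_def split: if_splits)
        then have "\<kappa>0 * real n - 1 \<le> real j" using fl by simp
        then show ?thesis using elim(2) kap by simp
      qed
      have "C1 * (\<kappa>0 / 2) powr (2 / r) * (real i / real n) powr (2 / r) = C1 * (\<kappa>0 / 2 * real i / real n) powr (2 / r)"
        using * n0 by (simp add: powr_mult powr_divide)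
      also have "\<dots> \<le> C1 * (real j / real n) powr (2 / r)"
        using * j2 n0 r by (intro mult_left_mono powr_mono2 divide_right_mono) auto
      also have "\<dots> \<le> laplacian_eigenvalue n (G n) j" using elim(1) j_ge j_le j_n by blast
      also have "\<dots> \<le> laplacian_eigenvalue n (G n) i" using j_i i by (intro mono) auto
      finally show "C1 * (\<kappa>0 / 2) powr (2 / r) * (real i / real n) powr (2 / r) \<le> laplacian_eigenvalue n (G n) i" .
    qed
  qed
  moreover have "i1 \<ge> 1" "C1 * (\<kappa>0 / 2) powr (2 / r) > 0" using * by (auto simp: i1_def)
  ultimately show thesis using that by blast
qed

section \<open>The two priors\<close>

text \<open>Here \<open>a i\<close> stands for n^(2/r) times an eigenvalue. Where a <= I^(2/r) the
  prior variance must be large enough, which is \<open>small\<close>; where a > I^(2/r) the Sobolev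
  weight alone satisfies a^\<beta> I^(-2\<beta>/r) >= 1 and the trivial bound \<tau> g^2 is
  affordable. In both cases one extracts the factor I^(-2\<beta>/r), which the Sobolev bound n C^2
  turns into I.\<close>

lemma bias_sum_le:
  fixes a g v :: "nat \<Rightarrow> real"
  assumes \<beta>: "\<beta> > 0" and I: "I \<ge> 1" and r: "r > 0" and nI: "real n * I powr (- 2 * \<beta> / r) = I"
    and S: "(\<Sum>i<n. (1 + a i powr \<beta>) * (g i)\<^sup>2) \<le> real n * C\<^sup>2"
    and \<tau>: "\<tau> > 0" and Kv: "Kv \<ge> 0" and v0: "\<And>i. i < n \<Longrightarrow> v i \<ge> 0"
    and small: "\<And>i. i < n \<Longrightarrow> a i \<le> I powr (2 / r) \<Longrightarrow>
      v i > 0 \<and> 1 / v i \<le> Kv * (1 + a i powr \<beta>) * I powr (- 2 * \<beta> / r)"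
  shows "(\<Sum>i<n. \<tau> * (g i)\<^sup>2 / (1 + 2 * \<tau> * v i)) \<le> (Kv / 2 + \<tau>) * C\<^sup>2 * I"
proof -
  let ?J = "I powr (- 2 * \<beta> / r)"
  have J0: "?J > 0" using I by simp
  have "(\<Sum>i<n. \<tau> * (g i)\<^sup>2 / (1 + 2 * \<tau> * v i)) \<le> (\<Sum>i<n. (Kv / 2 + \<tau>) * ?J * ((1 + a i powr \<beta>) * (g i)\<^sup>2))"
  proof (rule sum_mono)
    fix i assume "i \<in> {..<n}"
    then have i: "i < n" by simp
    let ?X = "(1 + a i powr \<beta>) * ?J"
    have X0: "?X \<ge> 0" using J0 by (simp add: add_nonneg_nonneg)
    have "\<tau> / (1 + 2 * \<tau> * v i) \<le> (Kv / 2 + \<tau>) * ?X"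
    proof (cases "a i \<le> I powr (2 / r)")
      case True
      from small[OF i this] have v: "v i > 0" "1 / v i \<le> Kv * ?X" by (auto simp: mult.assoc)
      have "\<tau> / (1 + 2 * \<tau> * v i) \<le> \<tau> / (2 * \<tau> * v i)"
        using v \<tau> by (intro divide_left_mono) (auto intro!: mult_pos_pos add_pos_pos)
      also have "\<dots> = 1 / v i / 2" using \<tau> by simp
      also have "\<dots> \<le> Kv / 2 * ?X" using v(2) by simp
      also have "\<dots> \<le> (Kv / 2 + \<tau>) * ?X" using X0 \<tau> by (intro mult_right_mono) auto
      finally show ?thesis .
    next
      case False
      have "1 \<le> 1 + 2 * \<tau> * v i" using v0[OF i] \<tau> by simp
      then have "\<tau> / (1 + 2 * \<tau> * v i) \<le> \<tau> / 1" using \<tau> by (intro divide_left_mono) auto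
      also have "\<tau> / 1 \<le> \<tau> * ?X"
      proof -
        have "1 = (I powr (2 / r)) powr \<beta> * ?J" using I by (simp add: powr_powr flip: powr_add)
        also have "\<dots> \<le> a i powr \<beta> * ?J" using False \<beta> J0 by (intro mult_right_mono powr_mono2) auto
        also have "\<dots> \<le> ?X" using J0 by (intro mult_right_mono) auto
        finally show ?thesis using \<tau> by simp
      qed
      also have "\<dots> \<le> (Kv / 2 + \<tau>) * ?X" using X0 Kv by (intro mult_right_mono) auto
      finally show ?thesis .
    qed
    then have "\<tau> / (1 + 2 * \<tau> * v i) * (g i)\<^sup>2 \<le> (Kv / 2 + \<tau>) * ?X * (g i)\<^sup>2"
      by (rule mult_right_mono) simp
    then show "\<tau> * (g i)\<^sup>2 / (1 + 2 * \<tau> * v i) \<le> (Kv / 2 + \<tau>) * ?J * ((1 + a i powr \<beta>) * (g i)\<^sup>2)"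
      by (simp add: mult_ac)
  qed
  also have "\<dots> = (Kv / 2 + \<tau>) * ?J * (\<Sum>i<n. (1 + a i powr \<beta>) * (g i)\<^sup>2)"
    by (simp only: sum_distrib_left)
  also have "\<dots> \<le> (Kv / 2 + \<tau>) * ?J * (real n * C\<^sup>2)"
    using S Kv \<tau> J0 by (intro mult_left_mono) auto
  also have "\<dots> = (Kv / 2 + \<tau>) * C\<^sup>2 * (real n * ?J)" by (simp add: mult_ac)
  finally show ?thesis unfolding nI .
qed

text \<open>On \<open>T\<close> the Sobolev weight is at least c^\<beta> I^(2\<beta>/r); dividing n
  C^2 by it leaves a multiple of n I^(-2\<beta>/r) = I.\<close>

lemma coef_tail_le:
  fixes a g :: "nat \<Rightarrow> real"
  assumes \<beta>: "\<beta> > 0" and I: "I \<ge> 1" and r: "r > 0" and nI: "real n * I powr (- 2 * \<beta> / r) = I"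
    and S: "(\<Sum>i<n. (1 + a i powr \<beta>) * (g i)\<^sup>2) \<le> real n * C\<^sup>2"
    and T: "T \<subseteq> {..<n}" and c: "c > 0" and big: "\<And>i. i \<in> T \<Longrightarrow> c * I powr (2 / r) \<le> a i"
  shows "(\<Sum>i\<in>T. (g i)\<^sup>2) \<le> c powr (- \<beta>) * C\<^sup>2 * I"
proof -
  let ?J = "I powr (- 2 * \<beta> / r)"
  have J0: "?J > 0" using I by simp
  have "(\<Sum>i\<in>T. (g i)\<^sup>2) \<le> (\<Sum>i\<in>T. c powr (- \<beta>) * ?J * ((1 + a i powr \<beta>) * (g i)\<^sup>2))"
  proof (rule sum_mono)
    fix i assume i: "i \<in> T"
    have "1 = c powr (- \<beta>) * ?J * (c * I powr (2 / r)) powr \<beta>"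
      using I c by (simp add: powr_mult powr_powr powr_minus field_simps flip: powr_add)
    also have "\<dots> \<le> c powr (- \<beta>) * ?J * a i powr \<beta>"
      using big[OF i] c I \<beta> by (intro mult_left_mono powr_mono2) auto
    also have "\<dots> \<le> c powr (- \<beta>) * ?J * (1 + a i powr \<beta>)" by (intro mult_left_mono) auto
    finally have "1 * (g i)\<^sup>2 \<le> c powr (- \<beta>) * ?J * (1 + a i powr \<beta>) * (g i)\<^sup>2"
      by (rule mult_right_mono) simp
    then show "(g i)\<^sup>2 \<le> c powr (- \<beta>) * ?J * ((1 + a i powr \<beta>) * (g i)\<^sup>2)" by (simp add: mult.assoc)
  qed
  also have "\<dots> \<le> (\<Sum>i<n. c powr (- \<beta>) * ?J * ((1 + a i powr \<beta>) * (g i)\<^sup>2))"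
    using T by (intro sum_mono2) (auto simp: add_nonneg_nonneg)
  also have "\<dots> = c powr (- \<beta>) * ?J * (\<Sum>i<n. (1 + a i powr \<beta>) * (g i)\<^sup>2)"
    by (simp only: sum_distrib_left)
  also have "\<dots> \<le> c powr (- \<beta>) * ?J * (real n * C\<^sup>2)" using S by (intro mult_left_mono) auto
  also have "\<dots> = c powr (- \<beta>) * C\<^sup>2 * (real n * ?J)" by (simp add: mult_ac)
  finally show ?thesis unfolding nI .
qed

text \<open>Three ranges. Below \<open>i1\<close> nothing is known about the eigenvalues, and each
  term gets the crude bound \<open>low\<close>. Between \<open>i1\<close> and I the logarithm of the
  power bound is summed by \<open>sum_ln_ratio_le\<close>. Beyond I, ln(1 + w) <= w and q > 1 make
  the tail summable.\<close>

lemma log_sum_le: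
  fixes w :: "nat \<Rightarrow> real"
  assumes q: "q > 1" and A: "A \<ge> 0" and I: "I \<ge> 1" and Z: "Z \<ge> 0" and i1: "i1 \<ge> (1 :: nat)"
    and w0: "\<And>i. i < n \<Longrightarrow> w i \<ge> 0"
    and w: "\<And>i. i1 \<le> i \<Longrightarrow> i < n \<Longrightarrow> w i \<le> A * (I / real i) powr q"
    and low: "\<And>i. i < i1 \<Longrightarrow> i < n \<Longrightarrow> ln (1 + w i) \<le> Z * I"
  shows "(\<Sum>i<n. ln (1 + w i)) \<le> (real i1 * Z + 2 * (ln (1 + A) + q) + A * (1 + 1 / (q - 1))) * I"
proof -
  define X Y T where "X = {i. i < n \<and> i < i1}" and "Y = {i. i < n \<and> i1 \<le> i \<and> real i < I}"
    and "T = {i. i < n \<and> i1 \<le> i \<and> I \<le> real i}"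
  have fin: "finite X" "finite Y" "finite T" by (auto simp: X_def Y_def T_def)
  have part: "{..<n} = X \<union> (Y \<union> T)" "X \<inter> (Y \<union> T) = {}" "Y \<inter> T = {}" by (auto simp: X_def Y_def T_def)
  have "(\<Sum>i<n. ln (1 + w i)) = (\<Sum>i\<in>X. ln (1 + w i)) + ((\<Sum>i\<in>Y. ln (1 + w i)) + (\<Sum>i\<in>T. ln (1 + w i)))"
    unfolding part(1) using fin part(2,3) by (simp add: sum.union_disjoint)
  moreover have "(\<Sum>i\<in>X. ln (1 + w i)) \<le> real i1 * (Z * I)"
  proof -
    have "(\<Sum>i\<in>X. ln (1 + w i)) \<le> real (card X) * (Z * I)"
      using low by (intro sum_bounded_above) (auto simp: X_def)
    also have "card X \<le> i1" using card_mono[of "{..<i1}" X] by (auto simp: X_def)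
    then have "real (card X) * (Z * I) \<le> real i1 * (Z * I)" using Z I by (intro mult_right_mono) auto
    finally show ?thesis .
  qed
  moreover have "(\<Sum>i\<in>Y. ln (1 + w i)) \<le> 2 * (ln (1 + A) + q) * I"
  proof -
    \<comment> \<open>Rounding I up to an integer costs at most a factor 2, the 2 in front of ln(1 +
      A) + q.\<close>
    define m where "m = nat \<lceil>I\<rceil>"
    have m: "I \<le> real m" "real m \<le> 2 * I" using I unfolding m_def by linarith+
    have pt: "ln (1 + w i) \<le> ln (1 + A) + q * ln (real m / real i)" if i: "i \<in> Y" for i
    proof -
      have i': "i < n" "i1 \<le> i" "real i < I" "i \<ge> 1" using i i1 by (auto simp: Y_def)
      have x1: "1 \<le> real m / real i" using i' m by (simp add: pos_le_divide_eq)
      have "(I / real i) powr q \<le> (real m / real i) powr q"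
        using i' m I q by (intro powr_mono2 divide_right_mono) auto
      then have "w i \<le> A * (real m / real i) powr q"
        using w[OF i'(2,1)] A by (meson mult_left_mono order_trans)
      moreover have "1 \<le> (real m / real i) powr q" using x1 q by (simp add: ge_one_powr_ge_zero)
      ultimately have "1 + w i \<le> (1 + A) * (real m / real i) powr q" by (simp add: algebra_simps)
      then have "ln (1 + w i) \<le> ln ((1 + A) * (real m / real i) powr q)"
        using w0[OF i'(1)] by (intro ln_mono) auto
      also have "\<dots> = ln (1 + A) + ln ((real m / real i) powr q)"
      proof (rule ln_mult_pos)
        show "0 < 1 + A" using A by simp
        show "0 < (real m / real i) powr q" using \<open>1 \<le> (real m / real i) powr q\<close> by linarith
      qed
      also have "\<dots> = ln (1 + A) + q * ln (real m / real i)" by (simp add: ln_powr)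
      finally show ?thesis .
    qed
    have "(\<Sum>i\<in>Y. ln (1 + w i)) \<le> (\<Sum>i\<in>Y. ln (1 + A) + q * ln (real m / real i))"
      by (rule sum_mono) (rule pt)
    also have "\<dots> \<le> (\<Sum>i=1..m. ln (1 + A) + q * ln (real m / real i))"
    proof (rule sum_mono2)
      show "Y \<subseteq> {1..m}" using i1 m by (auto simp: Y_def)
      fix i assume "i \<in> {1..m} - Y"
      then show "0 \<le> ln (1 + A) + q * ln (real m / real i)"
        using A q by (intro add_nonneg_nonneg mult_nonneg_nonneg ln_ge_zero) auto
    qed simp
    also have "\<dots> = real m * ln (1 + A) + q * (\<Sum>i=1..m. ln (real m / real i))"
      by (simp add: sum.distrib sum_distrib_left)
    also have "\<dots> \<le> real m * ln (1 + A) + q * real m"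
      using q by (intro add_left_mono mult_left_mono sum_ln_ratio_le) auto
    also have "\<dots> = (ln (1 + A) + q) * real m" by (simp add: algebra_simps)
    also have "\<dots> \<le> (ln (1 + A) + q) * (2 * I)" using m A q by (intro mult_left_mono) (auto intro: add_nonneg_nonneg)
    finally show ?thesis by (simp add: mult_ac)
  qed
  moreover have "(\<Sum>i\<in>T. ln (1 + w i)) \<le> A * (1 + 1 / (q - 1)) * I"
  proof -
    have "(\<Sum>i\<in>T. ln (1 + w i)) \<le> (\<Sum>i\<in>T. A * (I / real i) powr q)"
    proof (rule sum_mono)
      fix i assume "i \<in> T"
      then have i: "i < n" "i1 \<le> i" by (auto simp: T_def)
      have "ln (1 + w i) \<le> w i" using w0[OF i(1)] by (rule ln_add_one_self_le_self)
      then show "ln (1 + w i) \<le> A * (I / real i) powr q" using w[OF i(2,1)] by linarith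
    qed
    also have "\<dots> = A * (\<Sum>i\<in>T. (I / real i) powr q)" by (simp only: sum_distrib_left)
    also have "\<dots> \<le> A * (\<Sum>i\<in>{i. i < n \<and> I \<le> real i}. (I / real i) powr q)"
      using A by (intro mult_left_mono sum_mono2) (auto simp: T_def)
    also have "\<dots> \<le> A * ((1 + 1 / (q - 1)) * I)"
      using A by (intro mult_left_mono sum_ratio_powr_tail_le q I) auto
    finally show ?thesis by (simp add: mult.assoc)
  qed
  ultimately show ?thesis by (simp add: algebra_simps)
qed

text \<open>The second bound holds at every frequency and rests on the shift n^(-2) alone; it serves
  the low indices whose eigenvalues are unknown. The third is the decay in \<open>i\<close> used for
  logarithms and tails. The fourth is the condition \<open>small\<close> of
  \<open>bias_sum_le\<close>: the prior is spread out enough to reach a function of smoothness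
  \<beta>.\<close>

lemma power_variance_bounds:
  fixes lam c p r :: real and n :: nat
  defines "v \<equiv> inverse (((real n / c) powr (2 / r) * (lam + 1 / (real n)\<^sup>2)) powr p)"
  assumes r: "r \<ge> 1" and p: "p > 0" and n: "n > 0" and c: "c > 0" and lam: "lam \<ge> 0"
  shows "v > 0"
    and "c \<le> 2 * real n \<Longrightarrow> v \<le> (4 * (real n)\<^sup>2) powr p"
    and "i > (0 :: nat) \<Longrightarrow> c1 > 0 \<Longrightarrow> c1 * (real i / real n) powr (2 / r) \<le> lam \<Longrightarrow>
      v \<le> c1 powr (- p) * (c / real i) powr (2 * p / r)"
    and "1 \<le> I \<Longrightarrow> I \<le> c \<Longrightarrow> 0 < \<beta> \<Longrightarrow> \<beta> \<le> p \<Longrightarrow> real n powr (2 / r) * lam \<le> I powr (2 / r) \<Longrightarrow>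
      1 / v \<le> 2 powr p * (1 + (real n powr (2 / r) * lam) powr \<beta>) * I powr (- 2 * \<beta> / r)"
proof -
  let ?B = "(real n / c) powr (2 / r) * (lam + 1 / (real n)\<^sup>2)"
  have n0: "real n > 0" using n by simp
  have B0: "?B > 0" using n0 c lam by (intro mult_pos_pos add_nonneg_pos) auto
  have "?B powr p > 0" using B0 by (metis less_irrefl powr_gt_zero)
  then show "v > 0" unfolding v_def by (rule positive_imp_inverse_positive)
  have v_le: "v \<le> b powr (- p)" if "0 < b" "b \<le> ?B" for b
    unfolding v_def powr_minus[symmetric] using that p by (intro powr_mono2') auto
  show "v \<le> (4 * (real n)\<^sup>2) powr p" if c2: "c \<le> 2 * real n"
  proof -
    \<comment> \<open>From c <= 2 n the base n / c is at least 1/2, and r >= 1 bounds the exponent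
      2/r by 2.\<close>
    have "1 / 4 = (1 / 2 :: real) powr 2" by (simp add: power2_eq_square)
    also have "\<dots> \<le> (1 / 2) powr (2 / r)" using r by (intro powr_mono') (auto simp: field_simps)
    also have "\<dots> \<le> (real n / c) powr (2 / r)" using c c2 r by (intro powr_mono2) (auto simp: field_simps)
    finally have "1 / 4 * (1 / (real n)\<^sup>2) \<le> ?B" using lam n0 by (intro mult_mono) auto
    then have "v \<le> (1 / (4 * (real n)\<^sup>2)) powr (- p)" using n0 by (intro v_le) auto
    then show ?thesis using n0 by (simp add: powr_divide powr_minus)
  qed
  show "v \<le> c1 powr (- p) * (c / real i) powr (2 * p / r)"
    if i: "i > (0 :: nat)" and c1: "c1 > 0" and le: "c1 * (real i / real n) powr (2 / r) \<le> lam"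
  proof -
    have "c1 * (real i / c) powr (2 / r) = (real n / c) powr (2 / r) * (c1 * (real i / real n) powr (2 / r))"
      using c n0 i by (simp add: powr_divide)
    also have "\<dots> \<le> ?B" using le n0 by (intro mult_left_mono add_increasing2) auto
    finally have "v \<le> (c1 * (real i / c) powr (2 / r)) powr (- p)" using c1 i c by (intro v_le) auto
    also have "\<dots> = c1 powr (- p) * (real i / c) powr (- (2 * p / r))"
      using c1 i c by (simp add: powr_mult powr_powr)
    also have "(real i / c) powr (- (2 * p / r)) = (c / real i) powr (2 * p / r)"
      using i c by (simp add: powr_divide powr_minus field_simps)
    finally show ?thesis .
  qed
  show "1 / v \<le> 2 powr p * (1 + (real n powr (2 / r) * lam) powr \<beta>) * I powr (- 2 * \<beta> / r)"
    if I: "1 \<le> I" "I \<le> c" and \<beta>: "0 < \<beta>" "\<beta> \<le> p" and small: "real n powr (2 / r) * lam \<le> I powr (2 / r)"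
  proof -
    define a where "a = real n powr (2 / r) * lam"
    define x where "x = (a + 1) * I powr (- (2 / r))"
    have a0: "a \<ge> 0" using lam by (simp add: a_def)
    have x0: "x > 0" using a0 I by (simp add: x_def)
    have "?B \<le> (real n / I) powr (2 / r) * (lam + 1 / (real n)\<^sup>2)"
      using I n0 lam r by (intro mult_right_mono powr_mono2 divide_left_mono) auto
    also have "\<dots> = (a + real n powr (2 / r) / (real n)\<^sup>2) * I powr (- (2 / r))"
      using I n0 by (simp add: a_def powr_divide powr_minus field_simps)
    also have "\<dots> \<le> x"
    proof -
      \<comment> \<open>For r >= 1 the shift n^(-2), after scaling by n^(2/r), is at most 1, so it
        merges with the 1 in the Sobolev weight.\<close>
      have "real n powr (2 / r) \<le> real n powr 2" using n r by (intro powr_mono) (auto simp: field_simps)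
      then have "real n powr (2 / r) / (real n)\<^sup>2 \<le> 1" using n0 by simp
      then show ?thesis unfolding x_def by (intro mult_right_mono) auto
    qed
    finally have Bx: "?B \<le> x" .
    have x2: "x \<le> 2"
    proof -
      have "1 \<le> I powr (2 / r)" using I r by (simp add: ge_one_powr_ge_zero)
      then have "a + 1 \<le> 2 * I powr (2 / r)" using small by (simp add: a_def)
      then have "x \<le> 2 * I powr (2 / r) * I powr (- (2 / r))" unfolding x_def by (intro mult_right_mono) auto
      also have "\<dots> = 2" using I by (simp add: mult.assoc flip: powr_add)
      finally show ?thesis .
    qed
    have "1 / inverse y = y" for y :: real by (simp add: divide_inverse)
    then have "1 / v = ?B powr p" unfolding v_def .
    also have "\<dots> \<le> x powr p" using Bx B0 p by (intro powr_mono2) auto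
    \<comment> \<open>The condition \<beta> <= \<alpha> + r/2 enters here: the surplus power p -
      \<beta> is nonnegative, so it may be bounded through x <= 2.\<close>
    also have "\<dots> = x powr \<beta> * x powr (p - \<beta>)" using x0 by (simp flip: powr_add)
    also have "\<dots> \<le> x powr \<beta> * 2 powr (p - \<beta>)" using x0 x2 \<beta> by (intro mult_left_mono powr_mono2) auto
    also have "x powr \<beta> = (a + 1) powr \<beta> * I powr (- 2 * \<beta> / r)"
      using a0 I by (simp add: x_def powr_mult powr_powr)
    also have "(a + 1) powr \<beta> * I powr (- 2 * \<beta> / r) * 2 powr (p - \<beta>)
        \<le> (2 powr \<beta> * (1 + a powr \<beta>)) * I powr (- 2 * \<beta> / r) * 2 powr (p - \<beta>)"
    proof (intro mult_right_mono)
      have "(a + 1) powr \<beta> \<le> (2 * max a 1) powr \<beta>" using a0 \<beta> by (intro powr_mono2) auto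
      also have "\<dots> = 2 powr \<beta> * (max a 1) powr \<beta>" using a0 by (simp add: powr_mult)
      also have "\<dots> \<le> 2 powr \<beta> * (1 + a powr \<beta>)" by (intro mult_left_mono) (auto simp: max_def)
      finally show "(a + 1) powr \<beta> \<le> 2 powr \<beta> * (1 + a powr \<beta>)" .
    qed auto
    also have "\<dots> = (2 powr \<beta> * 2 powr (p - \<beta>)) * (1 + a powr \<beta>) * I powr (- 2 * \<beta> / r)" by (simp add: mult_ac)
    also have "2 powr \<beta> * 2 powr (p - \<beta>) = (2 :: real) powr p" by (simp flip: powr_add)
    finally show ?thesis by (simp add: a_def)
  qed
qed

text \<open>The third bound describes the cut-off: once i / c exceeds \<open>d\<close>, the exponent
  is at least 2 ln n and reduces the prefactor n to 1/n. The fourth says that for frequencies in the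
  smooth range the exponent is at most 1, so the variance is still of order n.\<close>

lemma exponential_variance_bounds:
  fixes lam c r :: real and n :: nat
  defines "v \<equiv> real n * exp (- ((real n / c) powr (2 / r)) * lam)"
  assumes r: "r \<ge> 1" and n: "n > 0" and c: "c > 0" and lam: "lam \<ge> 0"
  shows "v > 0" and "v \<le> real n"
    and "i > (0 :: nat) \<Longrightarrow> c1 > 0 \<Longrightarrow> c1 * (real i / real n) powr (2 / r) \<le> lam \<Longrightarrow>
      0 < d \<Longrightarrow> c * d \<le> real i \<Longrightarrow> 2 * ln (real n) \<le> c1 * d powr (2 / r) \<Longrightarrow> v \<le> 1 / real n"
    and "1 \<le> I \<Longrightarrow> I \<le> c \<Longrightarrow> real n powr (2 / r) * lam \<le> I powr (2 / r) \<Longrightarrow> 1 / v \<le> exp 1 / real n"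
proof -
  have n0: "real n > 0" using n by simp
  show "v > 0" using n0 by (simp add: v_def)
  show "v \<le> real n" using n0 lam by (simp add: v_def mult_le_cancel_left1)
  show "v \<le> 1 / real n" if i: "i > (0 :: nat)" and c1: "c1 > 0" and le: "c1 * (real i / real n) powr (2 / r) \<le> lam"
    and d: "0 < d" "c * d \<le> real i" "2 * ln (real n) \<le> c1 * d powr (2 / r)"
  proof -
    have "2 * ln (real n) \<le> c1 * d powr (2 / r)" by (rule d)
    also have "\<dots> \<le> c1 * (real i / c) powr (2 / r)"
      using d c c1 r by (intro mult_left_mono powr_mono2) (auto simp: field_simps)
    also have "\<dots> = (real n / c) powr (2 / r) * (c1 * (real i / real n) powr (2 / r))"
      using c n0 i by (simp add: powr_divide)
    also have "\<dots> \<le> (real n / c) powr (2 / r) * lam" using le by (intro mult_left_mono) auto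
    finally have "v \<le> real n * exp (- (2 * ln (real n)))" using n0 by (simp add: v_def)
    also have "\<dots> = real n * (1 / (real n * real n))"
      using n0 by (simp add: exp_minus exp_double power2_eq_square field_simps)
    finally show ?thesis using n0 by simp
  qed
  show "1 / v \<le> exp 1 / real n" if I: "1 \<le> I" "I \<le> c" and small: "real n powr (2 / r) * lam \<le> I powr (2 / r)"
  proof -
    have "(real n / c) powr (2 / r) * lam \<le> (real n / I) powr (2 / r) * lam"
      using I n0 lam r by (intro mult_right_mono powr_mono2 divide_left_mono) auto
    also have "\<dots> = real n powr (2 / r) * lam / I powr (2 / r)" using I by (simp add: powr_divide)
    also have "\<dots> \<le> 1" using small I by (simp add: divide_le_eq)
    finally have "exp ((real n / c) powr (2 / r) * lam) \<le> exp 1" by simp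
    then have "exp ((real n / c) powr (2 / r) * lam) / real n \<le> exp 1 / real n"
      using n0 by (intro divide_right_mono) auto
    then show ?thesis by (simp add: v_def exp_minus field_simps)
  qed
qed

section \<open>Limits along the index set and the effective dimension\<close>

lemma eventually_at_top_along: "eventually P sequentially \<Longrightarrow> eventually P (at_top_along N)"
  by (rule filter_leD[OF inf_le1])

lemma spectral_sequence:
  assumes "graph_sequence N G"
  obtains U where "\<And>n. n \<in> N \<Longrightarrow> orth_mat n (U n)"
    "\<And>n. n \<in> N \<Longrightarrow> laplacian n (G n) = diagonalized n (U n) (laplacian_eigenvalue n (G n))"
    "\<And>n i. n \<in> N \<Longrightarrow> i < n \<Longrightarrow> 0 \<le> laplacian_eigenvalue n (G n) i"
proof -
  have "\<exists>U. orth_mat n U \<and> laplacian n (G n) = diagonalized n U (laplacian_eigenvalue n (G n))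
      \<and> (\<forall>i<n. 0 \<le> laplacian_eigenvalue n (G n) i)" if "n \<in> N" for n
  proof -
    have "pair_graph (G n)" "pverts (G n) = {..<n}" using assms that by (auto simp: graph_sequence_def)
    then show ?thesis by (rule laplacian_diagonalization) blast
  qed
  then obtain U where "\<forall>n\<in>N. orth_mat n (U n) \<and> laplacian n (G n) = diagonalized n (U n) (laplacian_eigenvalue n (G n))
      \<and> (\<forall>i<n. 0 \<le> laplacian_eigenvalue n (G n) i)" by metis
  then show thesis using that by blast
qed

text \<open>The solution I of n I^(-2\<beta>/r) = I: the number of coefficients at which squared
  bias and accumulated noise balance. It equals n times the square of n^(-\<beta>/(r +
  2\<beta>)).\<close>

definition effective_dim :: "real \<Rightarrow> real \<Rightarrow> nat \<Rightarrow> real" where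
  "effective_dim r \<beta> n = real n powr (r / (r + 2 * \<beta>))"

context
  fixes r \<beta> :: real
  assumes r: "r \<ge> 1" and \<beta>: "\<beta> > 0"
begin

lemma effective_dim_ge_1: "n \<ge> 1 \<Longrightarrow> effective_dim r \<beta> n \<ge> 1"
  unfolding effective_dim_def using r \<beta> by (intro ge_one_powr_ge_zero) auto

lemma effective_dim_le: "n \<ge> 1 \<Longrightarrow> effective_dim r \<beta> n \<le> real n"
  unfolding effective_dim_def using r \<beta> powr_mono[of "r / (r + 2 * \<beta>)" 1 "real n"] by simp

lemma effective_dim_bias:
  assumes "n \<ge> 1" shows "real n * effective_dim r \<beta> n powr (- 2 * \<beta> / r) = effective_dim r \<beta> n"
proof -
  have "real n * effective_dim r \<beta> n powr (- 2 * \<beta> / r) = real n powr (1 + r / (r + 2 * \<beta>) * (- 2 * \<beta> / r))"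
    unfolding effective_dim_def powr_powr using assms by (simp add: powr_add powr_mult_base)
  also have "1 + r / (r + 2 * \<beta>) * (- 2 * \<beta> / r) = r / (r + 2 * \<beta>)"
    using r \<beta> by (simp add: field_simps)
  finally show ?thesis by (simp add: effective_dim_def)
qed

lemma effective_dim_rate:
  assumes "n \<ge> 1" shows "real n * (real n powr (- \<beta> / (r + 2 * \<beta>)))\<^sup>2 = effective_dim r \<beta> n"
proof -
  have "real n * (real n powr (- \<beta> / (r + 2 * \<beta>)))\<^sup>2 = real n powr (1 + 2 * (- \<beta> / (r + 2 * \<beta>)))"
    using assms by (simp add: powr_add powr_mult_base power2_eq_square flip: powr_add)
  also have "1 + 2 * (- \<beta> / (r + 2 * \<beta>)) = r / (r + 2 * \<beta>)"
    using r \<beta> by (simp add: field_simps)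
  finally show ?thesis by (simp add: effective_dim_def)
qed

text \<open>Valid from n = 1 on, from ln x <= x - 1; this turns the logarithmic contribution of the
  first \<open>i1\<close> coordinates into a multiple of I.\<close>

lemma ln_le_effective_dim:
  assumes "n \<ge> 1" shows "r / (r + 2 * \<beta>) * ln (real n) \<le> effective_dim r \<beta> n"
proof -
  have "r / (r + 2 * \<beta>) * ln (real n) = ln (effective_dim r \<beta> n)"
    by (simp add: effective_dim_def ln_powr)
  also have "\<dots> \<le> effective_dim r \<beta> n - 1"
    using effective_dim_ge_1[OF assms] by (intro ln_le_minus_one) simp
  finally show ?thesis by simp
qed

lemma filterlim_effective_dim: "filterlim (effective_dim r \<beta>) at_top sequentially"
proof -
  have s: "r / (r + 2 * \<beta>) > 0" using r \<beta> by simp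
  have "filterlim (\<lambda>x::real. x powr (r / (r + 2 * \<beta>))) at_top at_top"
    unfolding filterlim_at_top
  proof
    fix Z :: real
    show "\<forall>\<^sub>F x in at_top. Z \<le> x powr (r / (r + 2 * \<beta>))"
      using eventually_ge_at_top[of "\<bar>Z\<bar> powr (1 / (r / (r + 2 * \<beta>)))"]
    proof eventually_elim
      case (elim x)
      have "(\<bar>Z\<bar> powr (1 / (r / (r + 2 * \<beta>)))) powr (r / (r + 2 * \<beta>)) \<le> x powr (r / (r + 2 * \<beta>))"
        using elim s by (intro powr_mono2) auto
      moreover have "(\<bar>Z\<bar> powr (1 / (r / (r + 2 * \<beta>)))) powr (r / (r + 2 * \<beta>)) = \<bar>Z\<bar>"
        unfolding powr_powr using s by (cases "Z = 0") auto
      ultimately show ?case by linarith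
    qed
  qed
  then have "filterlim (\<lambda>n. real n powr (r / (r + 2 * \<beta>))) at_top sequentially"
    by (rule filterlim_compose) (rule filterlim_real_sequentially)
  then show ?thesis unfolding effective_dim_def .
qed

lemma eventually_ln_le_effective_dim: "\<forall>\<^sub>F n in sequentially. ln (real n) \<le> effective_dim r \<beta> n"
proof -
  have s: "r / (r + 2 * \<beta>) > 0" using r \<beta> by simp
  have "((\<lambda>n. ln (real n) / real n powr (r / (r + 2 * \<beta>))) \<longlongrightarrow> 0) sequentially"
    by (rule lim_ln_over_power[OF s])
  then have "\<forall>\<^sub>F n in sequentially. ln (real n) / real n powr (r / (r + 2 * \<beta>)) < 1"
    by (rule order_tendstoD) simp
  then show ?thesis
    using eventually_ge_at_top[of 1]
    by eventually_elim (simp add: effective_dim_def divide_less_eq)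
qed

text \<open>Once \<open>i1\<close> is below I, every index beyond \<open>k\<close> has n^(2/r) times
  its eigenvalue at least c1 I^(2/r); the cut in the index becomes the cut in the eigenvalue that
  \<open>coef_tail_le\<close> asks for.\<close>

lemma low_coef_tail:
  assumes n: "n \<ge> 1" and i1: "real i1 \<le> effective_dim r \<beta> n" and k: "effective_dim r \<beta> n \<le> k"
    and S: "(\<Sum>i<n. (1 + (real n powr (2 / r) * lam i) powr \<beta>) * (g i)\<^sup>2) \<le> real n * C\<^sup>2"
    and c1: "c1 > 0" and low: "\<forall>i. i1 \<le> i \<and> i < n \<longrightarrow> c1 * (real i / real n) powr (2 / r) \<le> lam i"
  shows "(\<Sum>i\<in>{i. i < n \<and> k \<le> real i}. (g i)\<^sup>2) \<le> c1 powr (- \<beta>) * C\<^sup>2 * k"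
proof -
  let ?I = "effective_dim r \<beta> n"
  have I1: "?I \<ge> 1" by (rule effective_dim_ge_1[OF n])
  have "(\<Sum>i\<in>{i. i < n \<and> k \<le> real i}. (g i)\<^sup>2) \<le> c1 powr (- \<beta>) * C\<^sup>2 * ?I"
  proof (rule coef_tail_le[OF \<beta> I1 _ effective_dim_bias[OF n] S _ c1])
    fix i assume i: "i \<in> {i. i < n \<and> k \<le> real i}"
    then have "real i1 \<le> real i" and iI: "?I \<le> real i" using i1 k by auto
    then have "c1 * (real i / real n) powr (2 / r) \<le> lam i" using low i by auto
    then have "real n powr (2 / r) * (c1 * (real i / real n) powr (2 / r)) \<le> real n powr (2 / r) * lam i"
      by (rule mult_left_mono) simp
    moreover have "real n powr (2 / r) * (c1 * (real i / real n) powr (2 / r)) = c1 * real i powr (2 / r)"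
      using n by (simp add: powr_divide)
    moreover have "c1 * ?I powr (2 / r) \<le> c1 * real i powr (2 / r)"
      using c1 iI I1 r by (intro mult_left_mono powr_mono2) auto
    ultimately show "c1 * ?I powr (2 / r) \<le> real n powr (2 / r) * lam i" by linarith
  qed (use r in auto)
  also have "\<dots> \<le> c1 powr (- \<beta>) * C\<^sup>2 * k" using k by (intro mult_left_mono) auto
  finally show ?thesis .
qed

end

text \<open>Truncation and Chernoff bound give two equal terms; one additional unit in the exponent
  pays for the factor 2.\<close>

lemma two_exp_le:
  fixes D E :: real
  assumes "E \<ge> 1" shows "exp (- ((D + 1) * E)) + exp (- ((D + 1) * E)) \<le> exp (- D * E)"
proof -
  have "2 \<le> exp E" using exp_ge_add_one_self[of E] assms by linarith
  then have "2 * exp (- ((D + 1) * E)) \<le> exp E * exp (- ((D + 1) * E))" by (intro mult_right_mono) auto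
  also have "\<dots> = exp (- D * E)" by (simp add: exp_add[symmetric] algebra_simps)
  finally show ?thesis by simp
qed

text \<open>Here E and k both equal I, since bias, log-determinant, prior on \<open>c\<close> and
  prior tail are all linear in I.\<close>

lemma power_prior_contracts:
  fixes N :: "nat set" and r \<beta> C \<sigma> \<alpha> :: real
  assumes r: "r \<ge> 1" and gs: "graph_sequence N G" and geo: "geometry_condition N G r"
    and \<beta>: "\<beta> > 0" and f0: "\<And>n. n \<in> N \<Longrightarrow> f0 n \<in> sobolev_ball n (G n) r \<beta> C"
    and \<sigma>: "\<sigma> > 0" and vp: "variance_prior \<sigma> Q a b q0"
    and post: "\<And>n P y A. prob_space P \<Longrightarrow> sets P = sets (fun_space n) \<Longrightarrow> y \<in> space (fun_space n) \<Longrightarrow> A \<in> sets P \<Longrightarrow>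
       measure (post n P y) A = measure (posterior_unknown_var Q n P y) A"
    and \<alpha>: "\<alpha> > 0" and \<beta>\<alpha>: "\<beta> \<le> \<alpha> + r / 2"
  shows "contracts_at_rate N \<sigma> f0 (\<lambda>n. post n (power_prior n (G n) r \<alpha>)) (\<lambda>n. real n powr (- \<beta> / (r + 2 * \<beta>)))"
proof -
  obtain U where U: "\<And>n. n \<in> N \<Longrightarrow> orth_mat n (U n)"
    and L: "\<And>n. n \<in> N \<Longrightarrow> laplacian n (G n) = diagonalized n (U n) (laplacian_eigenvalue n (G n))"
    and lam0: "\<And>n i. n \<in> N \<Longrightarrow> i < n \<Longrightarrow> 0 \<le> laplacian_eigenvalue n (G n) i"
    using spectral_sequence[OF gs] by blast
  obtain i1 c1 where i1: "i1 \<ge> (1 :: nat)" and c1: "c1 > 0"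
    and low: "\<forall>\<^sub>F n in at_top_along N. \<forall>i. i1 \<le> i \<and> i < n \<longrightarrow>
       c1 * (real i / real n) powr (2 / r) \<le> laplacian_eigenvalue n (G n) i"
    using eigenvalue_lower_bound[OF r gs geo] by blast
  define lam where "lam n = laplacian_eigenvalue n (G n)" for n
  define I where "I n = effective_dim r \<beta> n" for n
  define p where "p = \<alpha> + r / 2"
  define q where "q = 2 * p / r"
  have p: "p > 0" "\<beta> \<le> p" using \<alpha> r \<beta>\<alpha> by (auto simp: p_def)
  \<comment> \<open>In fact q = 1 + 2 \<alpha> / r: a positive \<alpha> is what makes the prior
    variances summable beyond frequency I.\<close>
  have q: "q > 1" using \<alpha> r by (simp add: q_def p_def field_simps)
  define v where "v n c i = inverse (((real n / c) powr (2 / r) * (lam n i + 1 / (real n)\<^sup>2)) powr p)" for n c i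
  have v_meas: "(\<lambda>c. v n c i) \<in> borel_measurable borel" for n i unfolding v_def by measurable
  have prior: "power_prior n (G n) r \<alpha> = exp1_law \<bind> (\<lambda>c. gaussian n (diagonalized n (U n) (v n c)))" if "n \<in> N" for n
    unfolding power_prior_def power_cov_diagonalized[OF U[OF that] L[OF that]] v_def p_def lam_def ..
  define good where "good n \<longleftrightarrow> n \<in> N \<and> n \<ge> 1 \<and> real i1 \<le> I n \<and> ln (real n) \<le> I n \<and>
    (\<forall>i. i1 \<le> i \<and> i < n \<longrightarrow> c1 * (real i / real n) powr (2 / r) \<le> lam n i)" for n
  have good: "\<forall>\<^sub>F n in at_top_along N. good n"
  proof -
    have "\<forall>\<^sub>F n in at_top_along N. n \<in> N" by (simp add: eventually_inf_principal)
    moreover have "\<forall>\<^sub>F n in at_top_along N. n \<ge> 1" by (rule eventually_at_top_along[OF eventually_ge_at_top])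
    moreover have "\<forall>\<^sub>F n in at_top_along N. real i1 \<le> I n"
      using filterlim_effective_dim[OF r \<beta>] unfolding I_def
      by (intro eventually_at_top_along) (simp add: filterlim_at_top)
    moreover have "\<forall>\<^sub>F n in at_top_along N. ln (real n) \<le> I n"
      unfolding I_def by (rule eventually_at_top_along[OF eventually_ln_le_effective_dim[OF r \<beta>]])
    ultimately show ?thesis using low unfolding good_def lam_def by eventually_elim blast
  qed
  have base: "n \<in> N" "n \<ge> 1" "real i1 \<le> I n" "ln (real n) \<le> I n" "I n \<ge> 1" "I n \<le> real n"
      "\<forall>i. i1 \<le> i \<and> i < n \<longrightarrow> c1 * (real i / real n) powr (2 / r) \<le> lam n i"
      "real n * I n powr (- 2 * \<beta> / r) = I n" if "good n" for n
    using that effective_dim_ge_1[OF r \<beta>, of n] effective_dim_le[OF r \<beta>, of n] effective_dim_bias[OF r \<beta>, of n]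
    by (auto simp: good_def I_def)
  have lam0': "0 \<le> lam n i" if "good n" "i < n" for n i
    using lam0[OF base(1)[OF that(1)] that(2)] by (simp add: lam_def)
  have S: "(\<Sum>i<n. (1 + (real n powr (2 / r) * lam n i) powr \<beta>) * (coef n (U n) (f0 n) i)\<^sup>2) \<le> real n * C\<^sup>2"
    if "good n" for n
    unfolding lam_def using base(1,2)[OF that]
    by (intro sobolev_ball_coef[OF U L _ f0]) auto
  have vb: "v n c i \<ge> 0" if "good n" "c > 0" "i < n" for n c i
    using power_variance_bounds(1)[OF r p(1) _ that(2) lam0'[OF that(1,3)], of n] base(2)[OF that(1)]
    by (simp add: v_def less_imp_le)
  have v_high: "v n c i \<le> c1 powr (- p) * (c / real i) powr q" if "good n" "c > 0" "i1 \<le> i" "i < n" for n c i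
    unfolding v_def q_def using base(2,7)[OF that(1)] that i1 c1
    by (intro power_variance_bounds(3)[OF r p(1) _ that(2) lam0'[OF that(1,4)]]) auto
  define \<tau> where "\<tau> = 1 / \<sigma>\<^sup>2"
  have \<tau>: "\<tau> > 0" using \<sigma> by (simp add: \<tau>_def)
  define s where "s = r / (r + 2 * \<beta>)"
  have s: "s > 0" using r \<beta> by (simp add: s_def)
  \<comment> \<open>Bounds ln(1 + 2 \<tau> v) / I for the first \<open>i1\<close> coordinates: there
    v <= (4 n^2)^p, its logarithm is a constant plus 2 p ln n, and s ln n <= I.\<close>
  define Z where "Z = ln (1 + 2 * \<tau> * 4 powr p) + 2 * p / s"
  have Z: "Z \<ge> 0" using \<tau> p s by (simp add: Z_def)
  \<comment> \<open>The decay constant of 2 \<tau> v when c <= 2 I, hence the factor 2^q.\<close>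
  define A where "A = 2 * \<tau> * (c1 powr (- p) * 2 powr q)"
  have A: "A \<ge> 0" using \<tau> by (simp add: A_def)
  define H where "H = real i1 * Z + 2 * (ln (1 + A) + q) + A * (1 + 1 / (q - 1))"
  define R0 where "R0 = (2 powr p / 2 + \<tau>) * C\<^sup>2 + H / 2"
  have evid: "ennreal (exp (- (2 + R0) * I n)) \<le>
      (\<integral>\<^sup>+f. ennreal (exp (- (1 / \<sigma>\<^sup>2) * (\<Sum>i<n. (f i - f0 n i)\<^sup>2))) \<partial>power_prior n (G n) r \<alpha>)" if g: "good n" for n
  proof -
    note b = base[OF g]
    have n0: "n > 0" "real n \<ge> 1" using b(2) by auto
    have "ennreal (exp (- (2 * I n + R0 * I n))) \<le>
      (\<integral>\<^sup>+f. ennreal (exp (- \<tau> * (\<Sum>i<n. (f i - f0 n i)\<^sup>2))) \<partial>power_prior n (G n) r \<alpha>)"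
      unfolding prior[OF b(1)]
    proof (rule scale_mixture_evidence[OF U[OF b(1)] v_meas \<tau> b(5)])
      fix c i assume "I n \<le> c" "c \<le> 2 * I n" "i < n"
      then show "0 \<le> v n c i" using vb[OF g, of c i] b(5) by simp
    next
      fix c assume c: "I n \<le> c" "c \<le> 2 * I n"
      have c0: "c > 0" using c b(5) by simp
      have bias: "(\<Sum>i<n. \<tau> * (coef n (U n) (f0 n) i)\<^sup>2 / (1 + 2 * \<tau> * v n c i)) \<le> (2 powr p / 2 + \<tau>) * C\<^sup>2 * I n"
      proof (rule bias_sum_le[OF \<beta> b(5) _ b(8) S[OF g] \<tau>])
        fix i assume i: "i < n"
        show "0 \<le> v n c i" by (rule vb[OF g c0 i])
        assume "real n powr (2 / r) * lam n i \<le> I n powr (2 / r)"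
        then show "v n c i > 0 \<and> 1 / v n c i \<le> 2 powr p * (1 + (real n powr (2 / r) * lam n i) powr \<beta>) * I n powr (- 2 * \<beta> / r)"
          using power_variance_bounds(1)[OF r p(1) n0(1) c0 lam0'[OF g i]]
            power_variance_bounds(4)[OF r p(1) n0(1) c0 lam0'[OF g i] b(5) c(1) \<beta> p(2)]
          by (simp add: v_def)
      qed (use r in auto)
      have logs: "(\<Sum>i<n. ln (1 + 2 * \<tau> * v n c i))
          \<le> H * I n"
        unfolding H_def
      proof (rule log_sum_le[OF q A b(5) Z i1])
        fix i assume i: "i < n"
        show "0 \<le> 2 * \<tau> * v n c i" using vb[OF g c0 i] \<tau> by simp
      next
        fix i assume i: "i1 \<le> i" "i < n"
        have i0: "real i > 0" using i i1 by simp
        have "v n c i \<le> c1 powr (- p) * (c / real i) powr q" by (rule v_high[OF g c0 i])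
        also have "\<dots> \<le> c1 powr (- p) * (2 * (I n / real i)) powr q"
          using c c0 i0 q by (intro mult_left_mono powr_mono2) (auto simp: divide_right_mono)
        also have "\<dots> = c1 powr (- p) * 2 powr q * (I n / real i) powr q"
          unfolding mult.assoc using i0 b(5) by (subst powr_mult) auto
        finally have "2 * \<tau> * v n c i \<le> 2 * \<tau> * (c1 powr (- p) * 2 powr q * (I n / real i) powr q)"
          using \<tau> by (intro mult_left_mono) auto
        then show "2 * \<tau> * v n c i \<le> A * (I n / real i) powr q" by (simp add: A_def mult.assoc)
      next
        fix i assume i: "i < i1" "i < n"
        have "c \<le> 2 * real n" using c b(6) by simp
        then have "v n c i \<le> (4 * (real n)\<^sup>2) powr p"
          unfolding v_def by (rule power_variance_bounds(2)[OF r p(1) n0(1) c0 lam0'[OF g i(2)]])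
        also have "(4 * (real n)\<^sup>2) powr p = 4 powr p * real n powr (2 * p)"
          using n0 by (simp add: powr_mult powr_powr flip: powr_numeral)
        finally have "2 * \<tau> * v n c i \<le> 2 * \<tau> * (4 powr p * real n powr (2 * p))"
          using \<tau> by (intro mult_left_mono) auto
        moreover have "1 \<le> real n powr (2 * p)" using n0 p by (intro ge_one_powr_ge_zero) auto
        ultimately have "1 + 2 * \<tau> * v n c i \<le> (1 + 2 * \<tau> * 4 powr p) * real n powr (2 * p)"
          by (simp add: distrib_right mult.assoc)
        then have "ln (1 + 2 * \<tau> * v n c i) \<le> ln ((1 + 2 * \<tau> * 4 powr p) * real n powr (2 * p))"
          using vb[OF g c0 i(2)] \<tau> by (intro ln_mono) (auto intro: add_pos_nonneg)
        also have "\<dots> = ln (1 + 2 * \<tau> * 4 powr p) + ln (real n powr (2 * p))"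
          using \<tau> n0 by (intro ln_mult_pos) (auto intro: add_pos_nonneg)
        also have "\<dots> = ln (1 + 2 * \<tau> * 4 powr p) + 2 * p * ln (real n)" by (simp add: ln_powr)
        also have "\<dots> \<le> ln (1 + 2 * \<tau> * 4 powr p) * I n + 2 * p * (I n / s)"
        proof (intro add_mono mult_left_mono)
          have "ln (1 + 2 * \<tau> * 4 powr p) * 1 \<le> ln (1 + 2 * \<tau> * 4 powr p) * I n"
            using b(5) \<tau> by (intro mult_left_mono) auto
          then show "ln (1 + 2 * \<tau> * 4 powr p) \<le> ln (1 + 2 * \<tau> * 4 powr p) * I n" by simp
          have "s * ln (real n) \<le> I n"
            unfolding s_def I_def by (rule ln_le_effective_dim[OF r \<beta> b(2)])
          then show "ln (real n) \<le> I n / s" using s by (simp add: pos_le_divide_eq mult.commute)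
        qed (use p in auto)
        also have "\<dots> = Z * I n" by (simp add: Z_def distrib_right)
        finally show "ln (1 + 2 * \<tau> * v n c i) \<le> Z * I n" .
      qed
      have "(\<Sum>i<n. \<tau> * (coef n (U n) (f0 n) i)\<^sup>2 / (1 + 2 * \<tau> * v n c i) + ln (1 + 2 * \<tau> * v n c i) / 2)
          = (\<Sum>i<n. \<tau> * (coef n (U n) (f0 n) i)\<^sup>2 / (1 + 2 * \<tau> * v n c i)) + (\<Sum>i<n. ln (1 + 2 * \<tau> * v n c i)) / 2"
        by (simp add: sum.distrib sum_divide_distrib)
      also have "\<dots> \<le> (2 powr p / 2 + \<tau>) * C\<^sup>2 * I n
          + H * I n / 2"
        by (intro add_mono bias divide_right_mono logs) simp
      also have "\<dots> = R0 * I n" unfolding R0_def by (simp only: distrib_right)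
      finally show "(\<Sum>i<n. \<tau> * (coef n (U n) (f0 n) i)\<^sup>2 / (1 + 2 * \<tau> * v n c i) + ln (1 + 2 * \<tau> * v n c i) / 2) \<le> R0 * I n" .
    qed
    moreover have "- (2 * I n + R0 * I n) = - (2 + R0) * I n" by (simp add: algebra_simps)
    ultimately show ?thesis by (simp only: \<tau>_def)
  qed
  have tails: "\<exists>M'. \<forall>\<^sub>F n in at_top_along N. emeasure (power_prior n (G n) r \<alpha>)
       {f \<in> space (power_prior n (G n) r \<alpha>). M' * I n < (\<Sum>i\<in>{i. i < n \<and> I n \<le> real i}. (coef n (U n) f i)\<^sup>2)}
       \<le> ennreal (exp (- D * I n))" if D: "D > 0" for D
  proof -
    \<comment> \<open>The same decay constant for the truncation c <= (D + 1) I; as I / i <= 1 on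
      the tail, it also bounds each variance there.\<close>
    define AD where "AD = c1 powr (- p) * (D + 1) powr q"
    have AD: "AD > 0" using c1 D by (simp add: AD_def)
    define K where "K = 1 + 1 / (q - 1)"
    \<comment> \<open>Solves (2 V - M' I) / (4 AD) = - (D + 1) I for V = AD K I, so that the
      Chernoff term matches the mass of the truncated scales.\<close>
    define M' where "M' = 4 * AD * (D + 1) + 2 * AD * K"
    have "emeasure (power_prior n (G n) r \<alpha>)
       {f \<in> space (power_prior n (G n) r \<alpha>). M' * I n < (\<Sum>i\<in>{i. i < n \<and> I n \<le> real i}. (coef n (U n) f i)\<^sup>2)}
       \<le> ennreal (exp (- D * I n))" if g: "good n" for n
    proof -
      note b = base[OF g]
      let ?T = "{i. i < n \<and> I n \<le> real i}"
      have vT: "v n c i \<le> AD * (I n / real i) powr q" if "0 < c" "c \<le> (D + 1) * I n" "i \<in> ?T" for c i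
      proof -
        have i: "i1 \<le> i" "i < n" "real i > 0" using that b(3,5) by auto
        have "v n c i \<le> c1 powr (- p) * (c / real i) powr q" by (rule v_high[OF g that(1) i(1,2)])
        also have "\<dots> \<le> c1 powr (- p) * ((D + 1) * (I n / real i)) powr q"
          using that i q by (intro mult_left_mono powr_mono2) (auto simp: divide_right_mono)
        also have "\<dots> = AD * (I n / real i) powr q"
          unfolding AD_def mult.assoc using D i b(5) by (subst powr_mult) auto
        finally show ?thesis .
      qed
      have "emeasure (power_prior n (G n) r \<alpha>)
          {f \<in> space (power_prior n (G n) r \<alpha>). M' * I n < (\<Sum>i\<in>?T. (coef n (U n) f i)\<^sup>2)}
        \<le> ennreal (exp (- ((D + 1) * I n)) + exp ((2 * (AD * (K * I n)) - M' * I n) / (4 * AD)))"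
        unfolding prior[OF b(1)]
      proof (rule scale_mixture_tail[OF U[OF b(1)] v_meas])
        show "?T \<subseteq> {..<n}" by auto
        show "0 \<le> (D + 1) * I n" using D b(5) by simp
        show "AD > 0" by (rule AD)
        fix c assume c: "0 < c" "c \<le> (D + 1) * I n"
        show "0 \<le> v n c i \<and> v n c i \<le> AD" if i: "i \<in> ?T" for i
        proof
          show "0 \<le> v n c i" using vb[OF g c(1)] i by simp
          have "(I n / real i) powr q \<le> 1" using i b(5) q by (intro powr_le1) auto
          then have "AD * (I n / real i) powr q \<le> AD * 1" using AD by (intro mult_left_mono) auto
          then show "v n c i \<le> AD" using vT[OF c i] by simp
        qed
        have "(\<Sum>i\<in>?T. v n c i) \<le> (\<Sum>i\<in>?T. AD * (I n / real i) powr q)"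
          by (rule sum_mono) (rule vT[OF c])
        also have "\<dots> = AD * (\<Sum>i\<in>?T. (I n / real i) powr q)" by (simp only: sum_distrib_left)
        also have "\<dots> \<le> AD * (K * I n)"
          unfolding K_def using AD by (intro mult_left_mono sum_ratio_powr_tail_le q b(5)) auto
        finally show "(\<Sum>i\<in>?T. v n c i) \<le> AD * (K * I n)" .
      qed
      also have "(2 * (AD * (K * I n)) - M' * I n) / (4 * AD) = - ((D + 1) * I n)"
        using AD by (simp add: M'_def field_simps)
      also have "ennreal (exp (- ((D + 1) * I n)) + exp (- ((D + 1) * I n))) \<le> ennreal (exp (- D * I n))"
        by (intro ennreal_leI two_exp_le b(5))
      finally show ?thesis .
    qed
    then show ?thesis using good by (intro exI[of _ M']) (auto elim: eventually_mono)
  qed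
  show ?thesis
  proof (rule contracts_at_rateI[where U = U and E = I and k = I and D = "2 + R0" and B = "c1 powr (- \<beta>) * C\<^sup>2", OF \<sigma> vp post])
    show "\<forall>\<^sub>F n in at_top_along N. orth_mat n (U n)"
      using good by eventually_elim (rule U[OF base(1)])
    show "\<forall>\<^sub>F n in at_top_along N. prob_space (power_prior n (G n) r \<alpha>) \<and> sets (power_prior n (G n) r \<alpha>) = sets (fun_space n)"
      using good
    proof eventually_elim
      case (elim n)
      have "n \<in> N" by (rule base(1)[OF elim])
      then show ?case
        using prob_space_scale_mixture[OF U v_meas] sets_scale_mixture[OF U v_meas] by (simp add: prior)
    qed
    show "filterlim I at_top (at_top_along N)"
      using filterlim_effective_dim[OF r \<beta>] unfolding I_def
      by (rule filterlim_mono) auto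
    show "\<forall>\<^sub>F n in at_top_along N. real n \<le> exp (I n)"
      using good
    proof eventually_elim
      case (elim n)
      have "exp (ln (real n)) \<le> exp (I n)" using base(4)[OF elim] by simp
      then show ?case using base(2)[OF elim] by simp
    qed
    show "\<forall>\<^sub>F n in at_top_along N. real n powr (- \<beta> / (r + 2 * \<beta>)) \<ge> 0 \<and> real n * (real n powr (- \<beta> / (r + 2 * \<beta>)))\<^sup>2 = I n"
      using good by eventually_elim (use effective_dim_rate[OF r \<beta>] base(2) in \<open>auto simp: I_def\<close>)
    show "\<forall>\<^sub>F n in at_top_along N. (\<Sum>i\<in>{i. i < n \<and> I n \<le> real i}. (coef n (U n) (f0 n) i)\<^sup>2) \<le> c1 powr (- \<beta>) * C\<^sup>2 * I n"
      using good
    proof eventually_elim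
      case (elim n)
      show ?case
        using low_coef_tail[OF r \<beta> base(2)[OF elim], of i1 "I n" "lam n"] base[OF elim] S[OF elim] c1
        by (simp add: I_def)
    qed
    show "\<forall>\<^sub>F n in at_top_along N. ennreal (exp (- (2 + R0) * I n)) \<le>
      (\<integral>\<^sup>+f. ennreal (exp (- (1 / \<sigma>\<^sup>2) * (\<Sum>i<n. (f i - f0 n i)\<^sup>2))) \<partial>power_prior n (G n) r \<alpha>)"
      using good by eventually_elim (rule evid)
  qed (use tails in auto)
qed


text \<open>The power of ln n on the right is t * 2/r > 1, so it beats ln n whatever the constants.
  With the exponent s = r/2 + 1 used below it is 1 + 2/r.\<close>

lemma eventually_log_growth:
  fixes c d t r :: real
  assumes c: "c > 0" and d: "d > 0" and r: "r > 0" and t: "t * (2 / r) > 1"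
  shows "\<forall>\<^sub>F n in sequentially. 2 * ln (real n) \<le> c * (ln (real n) powr t / d) powr (2 / r)"
proof -
  define e where "e = t * (2 / r) - 1"
  define c' where "c' = c * d powr (- (2 / r))"
  have e: "e > 0" and c': "c' > 0" using t c d by (auto simp: e_def c'_def)
  have "filterlim (\<lambda>n. ln (real n)) at_top sequentially"
    by (rule filterlim_compose[OF ln_at_top filterlim_real_sequentially])
  then have "\<forall>\<^sub>F n in sequentially. max 1 ((2 / c') powr (1 / e)) \<le> ln (real n)"
    unfolding filterlim_at_top by blast
  then show ?thesis
  proof eventually_elim
    case (elim n)
    define l where "l = ln (real n)"
    have l: "l \<ge> 1" "(2 / c') powr (1 / e) \<le> l" using elim by (auto simp: l_def)
    have "2 / c' = ((2 / c') powr (1 / e)) powr e" using e c' by (simp add: powr_powr)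
    also have "\<dots> \<le> l powr e" using l e by (intro powr_mono2) auto
    finally have "2 \<le> c' * l powr e" using c' by (simp add: pos_divide_le_eq mult.commute)
    then have "2 * l \<le> c' * l powr e * l" using l by (intro mult_right_mono) auto
    also have "c' * l powr e * l = c' * l powr (e + 1)" using l by (simp add: powr_add)
    also have "\<dots> = c * (l powr t / d) powr (2 / r)"
      unfolding c'_def e_def using l d by (simp add: powr_divide powr_powr powr_minus field_simps)
    finally show ?case by (simp add: l_def)
  qed
qed

text \<open>Given \<open>c\<close>, the variances stay of order at most n and fall below 1/n once i
  exceeds c (ln n)^s up to a constant. For c of order I this leaves about I (ln n)^s coordinates,
  each costing a multiple of ln n in the evidence, so E = I (ln n)^(s + 1). Truncating
  \<open>c\<close> at a multiple of E moves the cut-off of the prior to about E (ln n)^s, which is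
  covered by k = E (ln n)^(s + 1).\<close>

lemma exponential_prior_contracts:
  fixes N :: "nat set" and r \<beta> C \<sigma> :: real
  assumes r: "r \<ge> 1" and gs: "graph_sequence N G" and geo: "geometry_condition N G r"
    and \<beta>: "\<beta> > 0" and f0: "\<And>n. n \<in> N \<Longrightarrow> f0 n \<in> sobolev_ball n (G n) r \<beta> C"
    and \<sigma>: "\<sigma> > 0" and vp: "variance_prior \<sigma> Q a b q0"
    and post: "\<And>n P y A. prob_space P \<Longrightarrow> sets P = sets (fun_space n) \<Longrightarrow> y \<in> space (fun_space n) \<Longrightarrow> A \<in> sets P \<Longrightarrow>
       measure (post n P y) A = measure (posterior_unknown_var Q n P y) A"
  shows "contracts_at_rate N \<sigma> f0 (\<lambda>n. post n (exponential_prior n (G n) r))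
    (\<lambda>n. real n powr (- \<beta> / (r + 2 * \<beta>)) * ln (real n) powr (r / 2 + 2))"
proof -
  obtain U where U: "\<And>n. n \<in> N \<Longrightarrow> orth_mat n (U n)"
    and L: "\<And>n. n \<in> N \<Longrightarrow> laplacian n (G n) = diagonalized n (U n) (laplacian_eigenvalue n (G n))"
    and lam0: "\<And>n i. n \<in> N \<Longrightarrow> i < n \<Longrightarrow> 0 \<le> laplacian_eigenvalue n (G n) i"
    using spectral_sequence[OF gs] by blast
  obtain i1 c1 where i1: "i1 \<ge> (1 :: nat)" and c1: "c1 > 0"
    and low: "\<forall>\<^sub>F n in at_top_along N. \<forall>i. i1 \<le> i \<and> i < n \<longrightarrow>
       c1 * (real i / real n) powr (2 / r) \<le> laplacian_eigenvalue n (G n) i"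
    using eigenvalue_lower_bound[OF r gs geo] by blast
  define lam where "lam n = laplacian_eigenvalue n (G n)" for n
  define I where "I n = effective_dim r \<beta> n" for n
  \<comment> \<open>The exponent r/2 would be the borderline for (ln n)^(2 s / r) against ln n; the
    extra 1 absorbs all constants.\<close>
  define s where "s = r / 2 + 1"
  define l where "l n = ln (real n)" for n
  define E where "E n = I n * l n powr (s + 1)" for n
  define k where "k n = I n * l n powr (2 * s + 2)" for n
  define \<tau> where "\<tau> = 1 / \<sigma>\<^sup>2"
  have \<tau>: "\<tau> > 0" using \<sigma> by (simp add: \<tau>_def)
  define v where "v n c i = real n * exp (- ((real n / c) powr (2 / r)) * lam n i)" for n c i
  have v_meas: "(\<lambda>c. v n c i) \<in> borel_measurable borel" for n i unfolding v_def by measurable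
  have prior: "exponential_prior n (G n) r = exp1_law \<bind> (\<lambda>c. gaussian n (diagonalized n (U n) (v n c)))" if "n \<in> N" for n
    unfolding exponential_prior_def exponential_cov_diagonalized[OF U[OF that] L[OF that]] v_def lam_def ..
  define good where "good n \<longleftrightarrow> n \<in> N \<and> n \<ge> 1 \<and> l n \<ge> 1 \<and> real i1 \<le> I n \<and> l n \<le> I n \<and> 1 + 2 * \<tau> \<le> real n \<and>
    (\<forall>i. i1 \<le> i \<and> i < n \<longrightarrow> c1 * (real i / real n) powr (2 / r) \<le> lam n i) \<and>
    2 * l n \<le> c1 * (l n powr s / 2) powr (2 / r)" for n
  have good: "\<forall>\<^sub>F n in at_top_along N. good n"
  proof -
    have "\<forall>\<^sub>F n in at_top_along N. n \<in> N" by (simp add: eventually_inf_principal)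
    moreover have "\<forall>\<^sub>F n in at_top_along N. n \<ge> 1" by (rule eventually_at_top_along[OF eventually_ge_at_top])
    moreover have "\<forall>\<^sub>F n in at_top_along N. l n \<ge> 1"
      using filterlim_compose[OF ln_at_top filterlim_real_sequentially] unfolding l_def
      by (intro eventually_at_top_along) (simp add: filterlim_at_top)
    moreover have "\<forall>\<^sub>F n in at_top_along N. real i1 \<le> I n"
      using filterlim_effective_dim[OF r \<beta>] unfolding I_def
      by (intro eventually_at_top_along) (simp add: filterlim_at_top)
    moreover have "\<forall>\<^sub>F n in at_top_along N. l n \<le> I n"
      unfolding I_def l_def by (rule eventually_at_top_along[OF eventually_ln_le_effective_dim[OF r \<beta>]])
    moreover have "\<forall>\<^sub>F n in at_top_along N. 1 + 2 * \<tau> \<le> real n"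
      using filterlim_real_sequentially by (intro eventually_at_top_along) (simp add: filterlim_at_top)
    moreover have "\<forall>\<^sub>F n in at_top_along N. 2 * l n \<le> c1 * (l n powr s / 2) powr (2 / r)"
      unfolding l_def using r c1
      by (intro eventually_at_top_along eventually_log_growth) (auto simp: s_def field_simps)
    ultimately show ?thesis using low unfolding good_def lam_def by eventually_elim blast
  qed
  have base: "n \<in> N" "n \<ge> 1" "real i1 \<le> I n" "l n \<le> I n" "I n \<ge> 1" "l n \<ge> 1"
      "\<forall>i. i1 \<le> i \<and> i < n \<longrightarrow> c1 * (real i / real n) powr (2 / r) \<le> lam n i"
      "real n * I n powr (- 2 * \<beta> / r) = I n" "1 + 2 * \<tau> \<le> real n" "2 * l n \<le> c1 * (l n powr s / 2) powr (2 / r)" if "good n" for n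
    using that effective_dim_ge_1[OF r \<beta>, of n] effective_dim_bias[OF r \<beta>, of n]
    by (auto simp: good_def I_def)
  have s: "s > 0" using r by (simp add: s_def)
  have I_E: "I n \<le> E n" and E_k: "E n \<le> k n" if g: "good n" for n
  proof -
    note b = base[OF g]
    have "I n * 1 \<le> E n" unfolding E_def using b s by (intro mult_left_mono ge_one_powr_ge_zero) auto
    then show "I n \<le> E n" by simp
    show "E n \<le> k n" unfolding E_def k_def using b s by (intro mult_left_mono powr_mono) auto
  qed
  have lam0': "0 \<le> lam n i" if "good n" "i < n" for n i
    using lam0[OF base(1)[OF that(1)] that(2)] by (simp add: lam_def)
  have S: "(\<Sum>i<n. (1 + (real n powr (2 / r) * lam n i) powr \<beta>) * (coef n (U n) (f0 n) i)\<^sup>2) \<le> real n * C\<^sup>2"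
    if "good n" for n
    unfolding lam_def using base(1,2)[OF that]
    by (intro sobolev_ball_coef[OF U L _ f0]) auto
  have vb: "0 < v n c i" "v n c i \<le> real n" if "good n" "c > 0" "i < n" for n c i
    using exponential_variance_bounds(1,2)[OF r _ that(2) lam0'[OF that(1,3)], of n] base(2)[OF that(1)]
    by (simp_all add: v_def)
  have v_high: "v n c i \<le> 1 / real n"
    if "good n" "c > 0" "I n \<le> real i" "i < n" "d > 0" "c * d \<le> real i" "2 * l n \<le> c1 * d powr (2 / r)" for n c i d
  proof -
    have i: "i1 \<le> i" using base(3)[OF that(1)] that(3) by linarith
    show ?thesis
      unfolding v_def using base(2,7)[OF that(1)] that i i1 c1
      by (intro exponential_variance_bounds(3)[OF r _ that(2) lam0'[OF that(1,4)], of _ i c1 d]) (auto simp: l_def)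
  qed
  define R0 where "R0 = (exp 1 / 2 + \<tau>) * C\<^sup>2 + (2 + \<tau>)"
  have evid: "ennreal (exp (- (2 + R0) * E n)) \<le>
      (\<integral>\<^sup>+f. ennreal (exp (- (1 / \<sigma>\<^sup>2) * (\<Sum>i<n. (f i - f0 n i)\<^sup>2))) \<partial>exponential_prior n (G n) r)" if g: "good n" for n
  proof -
    note b = base[OF g]
    have n0: "n > 0" "real n \<ge> 1" using b(2) by auto
    have "ennreal (exp (- (2 * I n + R0 * E n))) \<le>
      (\<integral>\<^sup>+f. ennreal (exp (- \<tau> * (\<Sum>i<n. (f i - f0 n i)\<^sup>2))) \<partial>exponential_prior n (G n) r)"
      unfolding prior[OF b(1)]
    proof (rule scale_mixture_evidence[OF U[OF b(1)] v_meas \<tau> b(5)])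
      fix c i assume "I n \<le> c" "c \<le> 2 * I n" "i < n"
      then show "0 \<le> v n c i" using vb(1)[OF g, of c i] b(5) by simp
    next
      fix c assume c: "I n \<le> c" "c \<le> 2 * I n"
      have c0: "c > 0" using c b(5) by simp
      have bias: "(\<Sum>i<n. \<tau> * (coef n (U n) (f0 n) i)\<^sup>2 / (1 + 2 * \<tau> * v n c i)) \<le> (exp 1 / 2 + \<tau>) * C\<^sup>2 * I n"
      proof (rule bias_sum_le[OF \<beta> b(5) _ b(8) S[OF g] \<tau>])
        fix i assume i: "i < n"
        show "0 \<le> v n c i" using vb(1)[OF g c0 i] by simp
        assume sm: "real n powr (2 / r) * lam n i \<le> I n powr (2 / r)"
        have "1 / v n c i \<le> exp 1 * (1 / real n)"
          using exponential_variance_bounds(4)[OF r n0(1) c0 lam0'[OF g i] b(5) c(1) sm] by (simp add: v_def)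
        \<comment> \<open>The variance of order n gives 1 / v of order 1/n, which is below I / n =
          I^(-2\<beta>/r) for every \<beta>; hence no upper limit on the smoothness.\<close>
        also have "\<dots> \<le> exp 1 * ((1 + (real n powr (2 / r) * lam n i) powr \<beta>) * I n powr (- 2 * \<beta> / r))"
        proof (rule mult_left_mono)
          have "1 / real n \<le> I n / real n" using b(5) n0 by (intro divide_right_mono) auto
          also have "I n / real n = I n powr (- 2 * \<beta> / r)" using b(8) n0 by (simp add: divide_eq_eq mult.commute)
          also have "\<dots> = 1 * I n powr (- 2 * \<beta> / r)" by simp
          also have "\<dots> \<le> (1 + (real n powr (2 / r) * lam n i) powr \<beta>) * I n powr (- 2 * \<beta> / r)"
            by (intro mult_right_mono) auto
          finally show "1 / real n \<le> (1 + (real n powr (2 / r) * lam n i) powr \<beta>) * I n powr (- 2 * \<beta> / r)" .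
        qed simp
        finally show "v n c i > 0 \<and> 1 / v n c i \<le> exp 1 * (1 + (real n powr (2 / r) * lam n i) powr \<beta>) * I n powr (- 2 * \<beta> / r)"
          using vb(1)[OF g c0 i] by (simp add: mult.assoc)
      qed (use r in auto)
      \<comment> \<open>The frequency beyond which the prior is negligible for all \<open>c\<close>
        in [I, 2 I]; it governs the evidence, while the cut-off \<open>k\<close> of the test has to
        cope with much larger scales.\<close>
      define k1 where "k1 = I n * l n powr s"
      have k1: "I n \<le> k1" "1 \<le> k1"
      proof -
        have "I n * 1 \<le> k1" unfolding k1_def using b s by (intro mult_left_mono ge_one_powr_ge_zero) auto
        then show "I n \<le> k1" by simp
        then show "1 \<le> k1" using b(5) by simp
      qed
      define X Y where "X = {i. i < n \<and> real i < k1}" and "Y = {i. i < n \<and> k1 \<le> real i}"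
      have part: "{..<n} = X \<union> Y" "X \<inter> Y = {}" "finite X" "finite Y" by (auto simp: X_def Y_def)
      have logX: "(\<Sum>i\<in>X. ln (1 + 2 * \<tau> * v n c i)) \<le> 4 * E n"
      proof -
        have "(\<Sum>i\<in>X. ln (1 + 2 * \<tau> * v n c i)) \<le> real (card X) * (2 * l n)"
        proof (rule sum_bounded_above)
          fix i assume "i \<in> X"
          then have i: "i < n" by (simp add: X_def)
          have "1 + 2 * \<tau> * v n c i \<le> 1 * real n + 2 * \<tau> * real n"
            using vb(2)[OF g c0 i] \<tau> n0 by (intro add_mono mult_left_mono) auto
          also have "\<dots> = (1 + 2 * \<tau>) * real n" by (simp add: distrib_right)
          also have "\<dots> \<le> real n * real n" using b(9) by (intro mult_right_mono) auto
          finally have "ln (1 + 2 * \<tau> * v n c i) \<le> ln (real n * real n)"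
            using vb(1)[OF g c0 i] \<tau> by (intro ln_mono) (auto intro!: add_pos_pos mult_pos_pos)
          also have "\<dots> = 2 * l n" using n0 by (simp add: ln_mult_pos l_def)
          finally show "ln (1 + 2 * \<tau> * v n c i) \<le> 2 * l n" .
        qed
        also have "real (card X) \<le> 2 * k1"
        proof -
          have "X \<subseteq> {..<nat \<lceil>k1\<rceil>}" by (auto simp: X_def) (use le_of_int_ceiling[of k1] in linarith)
          then have "card X \<le> nat \<lceil>k1\<rceil>" using card_mono[of "{..<nat \<lceil>k1\<rceil>}" X] by simp
          then show ?thesis using k1(2) by linarith
        qed
        then have "real (card X) * (2 * l n) \<le> 2 * k1 * (2 * l n)" using b(6) by (intro mult_right_mono) auto
        also have "\<dots> = 4 * E n" using b(6) by (simp add: k1_def E_def powr_add)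
        finally show ?thesis .
      qed
      have logY: "(\<Sum>i\<in>Y. ln (1 + 2 * \<tau> * v n c i)) \<le> 2 * \<tau> * E n"
      proof -
        have "(\<Sum>i\<in>Y. ln (1 + 2 * \<tau> * v n c i)) \<le> real (card Y) * (2 * \<tau> * (1 / real n))"
        proof (rule sum_bounded_above)
          fix i assume "i \<in> Y"
          then have i: "i < n" "k1 \<le> real i" by (auto simp: Y_def)
          \<comment> \<open>The half in d = (ln n)^s / 2 compensates c <= 2 I.\<close>
          have "c * (l n powr s / 2) \<le> 2 * I n * (l n powr s / 2)" using c(2) by (intro mult_right_mono) auto
          also have "\<dots> \<le> real i" using i by (simp add: k1_def)
          finally have "v n c i \<le> 1 / real n"
            using k1 i b(6,10) by (intro v_high[OF g c0, of i "l n powr s / 2"]) auto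
          then have "2 * \<tau> * v n c i \<le> 2 * \<tau> * (1 / real n)" using \<tau> by (intro mult_left_mono) auto
          moreover have "ln (1 + 2 * \<tau> * v n c i) \<le> 2 * \<tau> * v n c i"
            using vb(1)[OF g c0 i(1)] \<tau> by (intro ln_add_one_self_le_self) auto
          ultimately show "ln (1 + 2 * \<tau> * v n c i) \<le> 2 * \<tau> * (1 / real n)" by linarith
        qed
        also have "card Y \<le> n" using card_mono[of "{..<n}" Y] by (auto simp: Y_def)
        then have "real (card Y) * (2 * \<tau> * (1 / real n)) \<le> real n * (2 * \<tau> * (1 / real n))"
          using \<tau> by (intro mult_right_mono) auto
        also have "\<dots> = 2 * \<tau> * 1" using n0 by simp
        also have "\<dots> \<le> 2 * \<tau> * E n" using I_E[OF g] b(5) \<tau> by (intro mult_left_mono) auto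
        finally show ?thesis .
      qed
      have "(\<Sum>i<n. \<tau> * (coef n (U n) (f0 n) i)\<^sup>2 / (1 + 2 * \<tau> * v n c i) + ln (1 + 2 * \<tau> * v n c i) / 2)
          = (\<Sum>i<n. \<tau> * (coef n (U n) (f0 n) i)\<^sup>2 / (1 + 2 * \<tau> * v n c i))
            + ((\<Sum>i\<in>X. ln (1 + 2 * \<tau> * v n c i)) + (\<Sum>i\<in>Y. ln (1 + 2 * \<tau> * v n c i))) / 2"
        unfolding sum.distrib sum.union_disjoint[OF part(3,4,2), symmetric] part(1)[symmetric]
        by (simp add: sum_divide_distrib)
      also have "\<dots> \<le> (exp 1 / 2 + \<tau>) * C\<^sup>2 * I n + (4 * E n + 2 * \<tau> * E n) / 2"
        by (intro add_mono bias divide_right_mono logX logY) simp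
      also have "\<dots> \<le> (exp 1 / 2 + \<tau>) * C\<^sup>2 * E n + (4 * E n + 2 * \<tau> * E n) / 2"
        using I_E[OF g] \<tau> by (intro add_right_mono mult_left_mono) auto
      also have "(4 * E n + 2 * \<tau> * E n) / 2 = (2 + \<tau>) * E n" by (simp add: field_simps)
      also have "(exp 1 / 2 + \<tau>) * C\<^sup>2 * E n + (2 + \<tau>) * E n = R0 * E n"
        unfolding R0_def by (simp only: distrib_right)
      finally show "(\<Sum>i<n. \<tau> * (coef n (U n) (f0 n) i)\<^sup>2 / (1 + 2 * \<tau> * v n c i) + ln (1 + 2 * \<tau> * v n c i) / 2) \<le> R0 * E n" .
    qed
    moreover have "ennreal (exp (- (2 + R0) * E n)) \<le> ennreal (exp (- (2 * I n + R0 * E n)))"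
      using I_E[OF g] by (intro ennreal_leI) (simp add: algebra_simps)
    ultimately show ?thesis unfolding \<tau>_def by (rule order_trans[rotated])
  qed
  have tails: "\<exists>M'. \<forall>\<^sub>F n in at_top_along N. emeasure (exponential_prior n (G n) r)
       {f \<in> space (exponential_prior n (G n) r). M' * k n < (\<Sum>i\<in>{i. i < n \<and> k n \<le> real i}. (coef n (U n) f i)\<^sup>2)}
       \<le> ennreal (exp (- D * E n))" if D: "D > 0" for D
  proof -
    \<comment> \<open>Variances and their sum are at most 1 on the tail, so the Chernoff exponent is
      (2 - M' k) / 4 = 1/2 - (D + 1) k - k/2, and k >= 1 makes it at most - (D + 1) k.\<close>
    define M' where "M' = 4 * (D + 1) + 2"
    have "\<forall>\<^sub>F n in at_top_along N. 2 * l n \<le> c1 * (l n powr (s + 1) / (D + 1)) powr (2 / r)"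
      unfolding l_def using r c1 D
      by (intro eventually_at_top_along eventually_log_growth) (auto simp: s_def field_simps)
    with good have "\<forall>\<^sub>F n in at_top_along N. emeasure (exponential_prior n (G n) r)
       {f \<in> space (exponential_prior n (G n) r). M' * k n < (\<Sum>i\<in>{i. i < n \<and> k n \<le> real i}. (coef n (U n) f i)\<^sup>2)}
       \<le> ennreal (exp (- D * E n))"
    proof eventually_elim
      case (elim n)
      note g = elim(1)
      note b = base[OF g]
      let ?T = "{i. i < n \<and> k n \<le> real i}"
      have E1: "E n \<ge> 1" and Ik: "I n \<le> k n" using I_E[OF g] E_k[OF g] b(5) by auto
      have vT: "v n c i \<le> 1 / real n" if c: "0 < c" "c \<le> (D + 1) * E n" and i: "i \<in> ?T" for c i
      proof -
        \<comment> \<open>The quotient by D + 1 cancels the truncation level (D + 1) E, and E (ln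
          n)^(s + 1) is exactly \<open>k n\<close>.\<close>
        have "c * (l n powr (s + 1) / (D + 1)) \<le> (D + 1) * E n * (l n powr (s + 1) / (D + 1))"
          using c(2) D by (intro mult_right_mono) auto
        also have "\<dots> = I n * (l n powr (s + 1) * l n powr (s + 1))" using D by (simp add: E_def)
        also have "l n powr (s + 1) * l n powr (s + 1) = l n powr (2 * s + 2)"
          by (simp flip: powr_add)
        also have "I n * l n powr (2 * s + 2) \<le> real i" using i by (simp add: k_def)
        finally show ?thesis
          using i Ik b(6) D elim(2) by (intro v_high[OF g c(1), of i "l n powr (s + 1) / (D + 1)"]) auto
      qed
      have "emeasure (exponential_prior n (G n) r)
          {f \<in> space (exponential_prior n (G n) r). M' * k n < (\<Sum>i\<in>?T. (coef n (U n) f i)\<^sup>2)}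
        \<le> ennreal (exp (- ((D + 1) * E n)) + exp ((2 * 1 - M' * k n) / (4 * 1)))"
        unfolding prior[OF b(1)]
      proof (rule scale_mixture_tail[OF U[OF b(1)] v_meas])
        show "?T \<subseteq> {..<n}" by auto
        show "0 \<le> (D + 1) * E n" using D E1 by simp
        show "(0 :: real) < 1" by simp
        fix c assume c: "0 < c" "c \<le> (D + 1) * E n"
        have n1: "1 / real n \<le> 1" using b(2) by simp
        show "0 \<le> v n c i \<and> v n c i \<le> 1" if i: "i \<in> ?T" for i
          using vb(1)[OF g c(1), of i] order_trans[OF vT[OF c i] n1] i by auto
        have "(\<Sum>i\<in>?T. v n c i) \<le> real (card ?T) * (1 / real n)"
          by (rule sum_bounded_above) (rule vT[OF c])
        also have "card ?T \<le> n" using card_mono[of "{..<n}" ?T] by auto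
        then have "real (card ?T) * (1 / real n) \<le> real n * (1 / real n)" by (intro mult_right_mono) auto
        also have "\<dots> = 1" using b(2) by simp
        finally show "(\<Sum>i\<in>?T. v n c i) \<le> 1" .
      qed
      also have "\<dots> \<le> ennreal (exp (- ((D + 1) * E n)) + exp (- ((D + 1) * E n)))"
      proof (intro ennreal_leI add_left_mono)
        have "(D + 1) * E n \<le> (D + 1) * k n" using E_k[OF g] D by (intro mult_left_mono) auto
        moreover have "M' * k n = 4 * ((D + 1) * k n) + 2 * k n" by (simp add: M'_def algebra_simps)
        ultimately show "exp ((2 * 1 - M' * k n) / (4 * 1)) \<le> exp (- ((D + 1) * E n))"
          using Ik b(5) by simp
      qed
      also have "\<dots> \<le> ennreal (exp (- D * E n))" by (intro ennreal_leI two_exp_le E1)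
      finally show ?case .
    qed
    then show ?thesis by blast
  qed
  show ?thesis
  proof (rule contracts_at_rateI[where U = U and E = E and k = k and D = "2 + R0" and B = "c1 powr (- \<beta>) * C\<^sup>2", OF \<sigma> vp post])
    show "\<forall>\<^sub>F n in at_top_along N. orth_mat n (U n)"
      using good by eventually_elim (rule U[OF base(1)])
    show "\<forall>\<^sub>F n in at_top_along N. prob_space (exponential_prior n (G n) r) \<and> sets (exponential_prior n (G n) r) = sets (fun_space n)"
      using good
    proof eventually_elim
      case (elim n)
      have "n \<in> N" by (rule base(1)[OF elim])
      then show ?case
        using prob_space_scale_mixture[OF U v_meas] sets_scale_mixture[OF U v_meas] by (simp add: prior)
    qed
    have "filterlim I at_top (at_top_along N)"
      using filterlim_effective_dim[OF r \<beta>] unfolding I_def by (rule filterlim_mono) auto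
    then show "filterlim E at_top (at_top_along N)"
      by (rule filterlim_at_top_mono) (use good I_E in \<open>auto elim: eventually_mono\<close>)
    show "\<forall>\<^sub>F n in at_top_along N. real n \<le> exp (E n)"
      using good
    proof eventually_elim
      case (elim n)
      have "exp (ln (real n)) \<le> exp (E n)" using base(4)[OF elim] I_E[OF elim] by (simp add: l_def)
      then show ?case using base(2)[OF elim] by simp
    qed
    show "\<forall>\<^sub>F n in at_top_along N. E n \<le> k n" using good by eventually_elim (rule E_k)
    show "\<forall>\<^sub>F n in at_top_along N. real n powr (- \<beta> / (r + 2 * \<beta>)) * ln (real n) powr (r / 2 + 2) \<ge> 0 \<and>
        real n * (real n powr (- \<beta> / (r + 2 * \<beta>)) * ln (real n) powr (r / 2 + 2))\<^sup>2 = k n"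
      using good
    proof eventually_elim
      case (elim n)
      have "real n * (real n powr (- \<beta> / (r + 2 * \<beta>)) * ln (real n) powr (r / 2 + 2))\<^sup>2
          = real n * (real n powr (- \<beta> / (r + 2 * \<beta>)))\<^sup>2 * (l n powr (s + 1))\<^sup>2"
        by (simp add: l_def s_def power_mult_distrib add.assoc)
      also have "(l n powr (s + 1))\<^sup>2 = l n powr (2 * s + 2)"
        by (simp add: power2_eq_square flip: powr_add)
      also have "real n * (real n powr (- \<beta> / (r + 2 * \<beta>)))\<^sup>2 * l n powr (2 * s + 2) = k n"
        unfolding effective_dim_rate[OF r \<beta> base(2)[OF elim]] k_def I_def ..
      finally show ?case by simp
    qed
    show "\<forall>\<^sub>F n in at_top_along N. (\<Sum>i\<in>{i. i < n \<and> k n \<le> real i}. (coef n (U n) (f0 n) i)\<^sup>2) \<le> c1 powr (- \<beta>) * C\<^sup>2 * k n"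
      using good
    proof eventually_elim
      case (elim n)
      show ?case
        using low_coef_tail[OF r \<beta> base(2)[OF elim], of i1 "k n" "lam n"] base[OF elim] S[OF elim] c1
          I_E[OF elim] E_k[OF elim]
        by (simp add: I_def)
    qed
    show "\<forall>\<^sub>F n in at_top_along N. ennreal (exp (- (2 + R0) * E n)) \<le>
      (\<integral>\<^sup>+f. ennreal (exp (- (1 / \<sigma>\<^sup>2) * (\<Sum>i<n. (f i - f0 n i)\<^sup>2))) \<partial>exponential_prior n (G n) r)"
      using good by eventually_elim (rule evid)
  qed (use tails in auto)
qed

theorem theorem5p1:
  fixes N :: "nat set"
    and G :: "nat \<Rightarrow> nat pair_pre_digraph"
    and r \<beta> C \<sigma> :: real
    and f0 :: "nat \<Rightarrow> nat \<Rightarrow> real"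
    and post :: "nat \<Rightarrow> (nat \<Rightarrow> real) measure \<Rightarrow> (nat \<Rightarrow> real) \<Rightarrow> (nat \<Rightarrow> real) measure"
  assumes "r \<ge> 1"
    and "graph_sequence N G"
    and "geometry_condition N G r"
    and "\<beta> > 0" and "C > 0"
    and "\<And>n. n \<in> N \<Longrightarrow> f0 n \<in> sobolev_ball n (G n) r \<beta> C"
    and "\<sigma> > 0"
    and "post = posterior_known_var \<sigma> \<or>
         (\<exists>a b h. 0 < a \<and> a < b \<and> \<sigma> \<in> {a..b} \<and>
            continuous_on {a..b} h \<and> (\<forall>s\<in>{a..b}. h s > 0) \<and> (h has_integral 1) {a..b} \<and>
            post = posterior_unknown_var
              (density lborel (\<lambda>s. ennreal (indicator {a..b} s * h s))))"
  shows "(\<forall>\<alpha>>0. \<beta> \<le> \<alpha> + r / 2 \<longrightarrow>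
            contracts_at_rate N \<sigma> f0
              (\<lambda>n. post n (power_prior n (G n) r \<alpha>))
              (\<lambda>n. real n powr (- \<beta> / (r + 2 * \<beta>)))) \<and>
         (\<exists>\<kappa>>0.
            contracts_at_rate N \<sigma> f0
              (\<lambda>n. post n (exponential_prior n (G n) r))
              (\<lambda>n. real n powr (- \<beta> / (r + 2 * \<beta>)) * ln (real n) powr \<kappa>))"
proof -
  obtain Q a b q where vp: "variance_prior \<sigma> Q a b q"
    and post: "\<And>n P y A. prob_space P \<Longrightarrow> sets P = sets (fun_space n) \<Longrightarrow> y \<in> space (fun_space n) \<Longrightarrow> A \<in> sets P \<Longrightarrow>
       measure (post n P y) A = measure (posterior_unknown_var Q n P y) A"
    using posterior_variance_prior[OF assms(7,8)] by blast
  show ?thesis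
  \<comment> \<open>The squared logarithmic factor is k / I = (ln n)^(2 s + 2) with s = r/2 + 1, so
    \<kappa> = s + 1 = r/2 + 2.\<close>
  proof (intro conjI allI impI exI[of _ "r / 2 + 2"])
    show "contracts_at_rate N \<sigma> f0 (\<lambda>n. post n (power_prior n (G n) r \<alpha>)) (\<lambda>n. real n powr (- \<beta> / (r + 2 * \<beta>)))"
      if "\<alpha> > 0" "\<beta> \<le> \<alpha> + r / 2" for \<alpha>
      using power_prior_contracts[OF assms(1-4,6,7) vp post that] .
    show "contracts_at_rate N \<sigma> f0 (\<lambda>n. post n (exponential_prior n (G n) r))
        (\<lambda>n. real n powr (- \<beta> / (r + 2 * \<beta>)) * ln (real n) powr (r / 2 + 2))"
      using exponential_prior_contracts[OF assms(1-4,6,7) vp post] .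
    show "r / 2 + 2 > 0" using assms(1) by simp
  qed
qed

end
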